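(* Let $G$ be a finitely generated residually finite group and $\Omega$ a square matrix over $\mathbb{C}G$ with $\mathrm{det}^{\mathrm r}_{\mathcal N(G)}(\Omega)\neq 0$. For every fixed $\Phi=(\phi_1,\dots,\phi_n)\in H^1(G;\mathbb{R})^n$, the function $V_\Phi(T)=\mathrm{det}^{\mathrm r}_{\mathcal N(G)}(\kappa(\Phi,T)\Omega)$ is multiplicatively convex on $\mathbb{R}_{>0}^n$, i.e. $V_\Phi$ is positive and $(s_1,\dots,s_n)\mapsto\log V_\Phi(e^{s_1},\dots,e^{s_n})$ is a convex function on $\mathbb{R}^n$.
   Context: For $\Phi=(\phi_1,\dots,\phi_n)$, $\phi_i\in H^1(G;\mathbb{R})=\mathrm{Hom}(G,\mathbb{R})$, and $T=(t_1,\dots,t_n)\in\mathbb{R}_{>0}^n$, the Alexander multi-twist $\kappa(\Phi,T):\mathbb{C}G\to\mathbb{C}G$ is the $\mathbb{C}$-linear map $g\mapsto t_1^{\phi_1(g)}\cdots t_n^{\phi_n(g)}g$, applied entrywise to matrices. For a $p\times p$ matrix $A$ over $\mathbb{C}G$ (acting on $l^2(G)^p$), $\mathrm{det}^{\mathrm r}_{\mathcal N(G)}(A)$ is the Fuglede–Kadison determinant $\det_{\mathcal N(G)}(A)$ if the induced operator is injective and of determinant class, and $0$ otherwise. *)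

theory Defs
  imports "HOL-Analysis.Analysis" "HOL-Algebra.Algebra"
begin

definition in_CG :: "'g monoid \<Rightarrow> ('g \<Rightarrow> complex) \<Rightarrow> bool" where
  "in_CG G a \<longleftrightarrow> finite {g. a g \<noteq> 0} \<and> {g. a g \<noteq> 0} \<subseteq> carrier G"

definition cg_mult :: "'g monoid \<Rightarrow> ('g \<Rightarrow> complex) \<Rightarrow> ('g \<Rightarrow> complex) \<Rightarrow> 'g \<Rightarrow> complex" where
  "cg_mult G a b = (\<lambda>g. if g \<in> carrier G
      then (\<Sum>h\<in>{h. a h \<noteq> 0}. a h * b (inv\<^bsub>G\<^esub> h \<otimes>\<^bsub>G\<^esub> g)) else 0)"

definition cg_star :: "'g monoid \<Rightarrow> ('g \<Rightarrow> complex) \<Rightarrow> 'g \<Rightarrow> complex" where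
  "cg_star G a = (\<lambda>g. if g \<in> carrier G then cnj (a (inv\<^bsub>G\<^esub> g)) else 0)"

definition cg_unit :: "'g monoid \<Rightarrow> 'g \<Rightarrow> complex" where
  "cg_unit G = (\<lambda>g. if g = \<one>\<^bsub>G\<^esub> then 1 else 0)"

definition is_cgmat :: "'g monoid \<Rightarrow> nat \<Rightarrow> (nat \<Rightarrow> nat \<Rightarrow> 'g \<Rightarrow> complex) \<Rightarrow> bool" where
  "is_cgmat G p A \<longleftrightarrow> (\<forall>i<p. \<forall>j<p. in_CG G (A i j))"

definition cgmat_mult :: "'g monoid \<Rightarrow> nat \<Rightarrow> (nat \<Rightarrow> nat \<Rightarrow> 'g \<Rightarrow> complex)
    \<Rightarrow> (nat \<Rightarrow> nat \<Rightarrow> 'g \<Rightarrow> complex) \<Rightarrow> (nat \<Rightarrow> nat \<Rightarrow> 'g \<Rightarrow> complex)" where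
  "cgmat_mult G p A B = (\<lambda>i j g. \<Sum>k<p. cg_mult G (A i k) (B k j) g)"

definition cgmat_star :: "'g monoid \<Rightarrow> (nat \<Rightarrow> nat \<Rightarrow> 'g \<Rightarrow> complex) \<Rightarrow> (nat \<Rightarrow> nat \<Rightarrow> 'g \<Rightarrow> complex)" where
  "cgmat_star G A = (\<lambda>i j. cg_star G (A j i))"

definition cgmat_one :: "'g monoid \<Rightarrow> (nat \<Rightarrow> nat \<Rightarrow> 'g \<Rightarrow> complex)" where
  "cgmat_one G = (\<lambda>i j. if i = j then cg_unit G else (\<lambda>_. 0))"

definition cgmat_pow :: "'g monoid \<Rightarrow> nat \<Rightarrow> (nat \<Rightarrow> nat \<Rightarrow> 'g \<Rightarrow> complex) \<Rightarrow> nat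
    \<Rightarrow> (nat \<Rightarrow> nat \<Rightarrow> 'g \<Rightarrow> complex)" where
  "cgmat_pow G p A k = ((\<lambda>B. cgmat_mult G p B A) ^^ k) (cgmat_one G)"

definition cgmat_trace :: "'g monoid \<Rightarrow> nat \<Rightarrow> (nat \<Rightarrow> nat \<Rightarrow> 'g \<Rightarrow> complex) \<Rightarrow> complex" where
  "cgmat_trace G p A = (\<Sum>i<p. A i i \<one>\<^bsub>G\<^esub>)"

definition in_l2 :: "'g monoid \<Rightarrow> ('g \<Rightarrow> complex) \<Rightarrow> bool" where
  "in_l2 G x \<longleftrightarrow> (\<forall>g. g \<notin> carrier G \<longrightarrow> x g = 0) \<and> (\<lambda>g. (cmod (x g))^2) summable_on carrier G"

definition l2_rmult :: "'g monoid \<Rightarrow> ('g \<Rightarrow> complex) \<Rightarrow> ('g \<Rightarrow> complex) \<Rightarrow> 'g \<Rightarrow> complex" where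
  "l2_rmult G x a = (\<lambda>g. if g \<in> carrier G
      then (\<Sum>h\<in>{h. a h \<noteq> 0}. x (g \<otimes>\<^bsub>G\<^esub> inv\<^bsub>G\<^esub> h) * a h) else 0)"

definition rmult_injective :: "'g monoid \<Rightarrow> nat \<Rightarrow> (nat \<Rightarrow> nat \<Rightarrow> 'g \<Rightarrow> complex) \<Rightarrow> bool" where
  "rmult_injective G p A \<longleftrightarrow>
     (\<forall>x :: nat \<Rightarrow> 'g \<Rightarrow> complex. (\<forall>i<p. in_l2 G (x i)) \<and>
        (\<forall>j<p. \<forall>g. (\<Sum>i<p. l2_rmult G (x i) (A i j) g) = 0)
        \<longrightarrow> (\<forall>i<p. \<forall>g. x i g = 0))"

(* spectral measure of adj(r_A) r_A = r_{A A-star} w.r.t. the von Neumann trace: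
   the compactly supported finite Borel measure on R with the moments tr((A A-star)^k) *)
definition FK_spectral_measure :: "'g monoid \<Rightarrow> nat \<Rightarrow> (nat \<Rightarrow> nat \<Rightarrow> 'g \<Rightarrow> complex) \<Rightarrow> real measure" where
  "FK_spectral_measure G p A = (THE \<mu>. sets \<mu> = sets borel \<and> finite_measure \<mu> \<and>
      (\<exists>C. emeasure \<mu> (- {0..C}) = 0) \<and>
      (\<forall>k::nat. integrable \<mu> (\<lambda>t. t ^ k) \<and>
         complex_of_real (\<integral>t. t ^ k \<partial>\<mu>) =
           cgmat_trace G p (cgmat_pow G p (cgmat_mult G p A (cgmat_star G A)) k)))"

definition FK_det_r :: "'g monoid \<Rightarrow> nat \<Rightarrow> (nat \<Rightarrow> nat \<Rightarrow> 'g \<Rightarrow> complex) \<Rightarrow> real" where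
  "FK_det_r G p A = (let \<mu> = FK_spectral_measure G p A in
     if rmult_injective G p A \<and> set_integrable \<mu> {0<..} (\<lambda>t. ln t)
     then exp (1/2 * (LINT t:{0<..}|\<mu>. ln t)) else 0)"

definition kappa :: "('n::finite \<Rightarrow> 'g \<Rightarrow> real) \<Rightarrow> real^'n \<Rightarrow> ('g \<Rightarrow> complex) \<Rightarrow> 'g \<Rightarrow> complex" where
  "kappa \<Phi> T a = (\<lambda>g. complex_of_real (\<Prod>i\<in>UNIV. (T $ i) powr (\<Phi> i g)) * a g)"

definition kappa_mat :: "('n::finite \<Rightarrow> 'g \<Rightarrow> real) \<Rightarrow> real^'n \<Rightarrow> (nat \<Rightarrow> nat \<Rightarrow> 'g \<Rightarrow> complex)
    \<Rightarrow> (nat \<Rightarrow> nat \<Rightarrow> 'g \<Rightarrow> complex)" where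
  "kappa_mat \<Phi> T A = (\<lambda>i j. kappa \<Phi> T (A i j))"

definition real_character :: "'g monoid \<Rightarrow> ('g \<Rightarrow> real) \<Rightarrow> bool" where
  "real_character G \<phi> \<longleftrightarrow> (\<forall>x\<in>carrier G. \<forall>y\<in>carrier G. \<phi> (x \<otimes>\<^bsub>G\<^esub> y) = \<phi> x + \<phi> y)"

definition finitely_generated_group :: "'g monoid \<Rightarrow> bool" where
  "finitely_generated_group G \<longleftrightarrow> (\<exists>S. finite S \<and> S \<subseteq> carrier G \<and> generate G S = carrier G)"

definition residually_finite :: "'g monoid \<Rightarrow> bool" where
  "residually_finite G \<longleftrightarrow> (\<forall>g\<in>carrier G. g \<noteq> \<one>\<^bsub>G\<^esub> \<longrightarrow>
     (\<exists>N. N \<lhd> G \<and> finite (rcosets\<^bsub>G\<^esub> N) \<and> g \<notin> N))"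

end

theory Submission
  imports Defs "HOL-Probability.Probability"
begin

text \<open>For a \<open>p \<times> p\<close> matrix \<open>A\<close> and a character
  let \<open>A\<^sub>t\<close> be the matrix \<open>A\<close> twisted by \<open>e\<^sup>t\<close>, and let \<open>F\<^sub>\<epsilon>(t) = tr log (A\<^sub>t A\<^sub>t\<^sup>* + \<epsilon>)\<close>. The Cauchy--Schwarz
  inequality for determinants gives \<open>F\<^sub>\<epsilon>(t + 2h) + F\<^sub>\<epsilon>(t) \<ge> 2 Re tr log (A\<^bsub>t+2h\<^esub> A\<^sub>t\<^sup>* + \<epsilon>)\<close>. Twisting is
  multiplicative and preserves the trace, so the products \<open>A\<^bsub>t+2h\<^esub> A\<^sub>t\<^sup>*\<close> and \<open>A\<^bsub>t+h\<^esub> A\<^bsub>t+h\<^esub>\<^sup>*\<close> have the same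
  moments; for small \<open>h\<close> the right-hand side is therefore \<open>2 F\<^sub>\<epsilon>(t + h)\<close>, and \<open>F\<^sub>\<epsilon>\<close> is convex. Only the
  infinitesimal form of the determinant inequality is required, with an error \<open>O(h\<^sup>3)\<close>, and this can be read off
  the traces of the powers of \<open>1 - (A A\<^sup>* + \<epsilon>) / K\<close>, without any operator algebra.
  As \<open>\<epsilon>\<close> decreases to \<open>0\<close>, \<open>F\<^sub>\<epsilon>\<close> decreases to twice the logarithm of the determinant. The limit is convex with values
  in \<open>[-\<infinity>, \<infinity>)\<close>, and being finite at \<open>0\<close> it is finite everywhere.\<close>

section \<open>Almost midpoint convex functions\<close>

text \<open>\<open>FK_spectral_measure\<close> is a definite description by moments, so a measure
  with these moments has to be built (Hausdorff's moment problem, solved through positivity of the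
  trace) and shown unique. From then on every regularised logarithmic integral is a limit of traces:
  ln (t + \<epsilon>) is a power series in 1 - (t + \<epsilon>) / K that converges uniformly on the
  spectrum, and this is what \<epsilon> > 0 buys. The constant of the cubic error may depend on
  \<epsilon>; convexity at fixed \<epsilon> only needs an error o(h^2), and convexity survives the
  limit. In the second difference the linear terms cancel under the trace, and the quadratic ones
  telescope along the logarithmic series to a quantity of one sign. \<open>FK_det_r\<close> also
  demands injectivity. It is translated in both directions into the absence of an atom of the
  spectral measure at 0: once to exploit the hypothesis on the given matrix, once to conclude for
  the twisted ones. Finiteness spreads from 0 to s because 0 is the midpoint of s and -s.\<close>

lemma convex_on_if_almost_midpoint_convex:
  fixes f :: "real \<Rightarrow> real"
  assumes cont: "continuous_on UNIV f"
    and mid: "\<And>a b. \<exists>C. \<exists>d>0. \<forall>x h. a \<le> x \<and> x \<le> b \<and> 0 < h \<and> h < d \<longrightarrow>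
                 f x + f (x + 2 * h) - 2 * f (x + h) \<ge> - C * h ^ 3"
  shows "convex_on UNIV f"
proof (rule convex_on_linorderI)
  show "convex (UNIV :: real set)" by simp
next
  fix t x y :: real
  assume t: "0 < t" "t < 1" and xy: "x < y"
  define z where "z = (1 - t) * x + t * y"
  define c where "c = (f y - f x) / (y - x)"
  define lin where "lin u = f x + c * (u - x)" for u
  have z: "x < z" "z < y"
  proof -
    have "z - x = t * (y - x)" "y - z = (1 - t) * (y - x)" by (simp_all add: z_def algebra_simps)
    moreover have "t * (y - x) > 0" "(1 - t) * (y - x) > 0" using t xy by simp_all
    ultimately show "x < z" "z < y" by (metis diff_gt_0_iff_gt)+
  qed
  have linz: "lin z = (1 - t) * f x + t * f y"
  proof -
    have "z - x = t * (y - x)" by (simp add: z_def algebra_simps)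
    then have "c * (z - x) = t * (f y - f x)" using xy by (simp add: c_def)
    then show ?thesis by (simp add: lin_def algebra_simps)
  qed
  have "f z \<le> lin z"
  proof (rule ccontr)
    assume "\<not> f z \<le> lin z"
    then have gap: "f z - lin z > 0" by simp
    \<comment> \<open>Maximum principle: adding a parabola that vanishes at \<open>x\<close> and
      \<open>y\<close> preserves the violation of the chord inequality, and this \<delta> spends
      only half of the gap at \<open>z\<close> on it. At the interior maximum of \<open>g\<close>
      the second difference is at most 0, yet the parabola adds 2 \<delta> h^2 to it, which
      outweighs a cubic error.\<close>
    define \<delta> where "\<delta> = (f z - lin z) / (2 * ((z - x) * (y - z)))"
    have zz: "(z - x) * (y - z) > 0" using z by simp
    have \<delta>: "\<delta> > 0" using gap zz by (simp add: \<delta>_def)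
    define g where "g u = f u - lin u + \<delta> * ((u - x) * (u - y))" for u
    have "\<delta> * D = (f z - lin z) / 2" if "\<delta> = (f z - lin z) / (2 * D)" "D > 0" for D
      using that by simp
    from this[OF \<delta>_def zz] have "\<delta> * ((z - x) * (y - z)) = (f z - lin z) / 2" .
    moreover have "\<delta> * ((z - x) * (z - y)) = - (\<delta> * ((z - x) * (y - z)))" by (simp add: algebra_simps)
    ultimately have "g z = (f z - lin z) / 2" unfolding g_def by (simp only:) (simp add: field_simps)
    then have gz: "g z > 0" using gap by simp
    have gx: "g x = 0" "g y = 0" using xy by (simp_all add: g_def lin_def c_def)
    have contg: "continuous_on {x..y} g"
      unfolding g_def lin_def
      by (intro continuous_intros continuous_on_subset[OF cont]) auto
    obtain m where m: "m \<in> {x..y}" "\<And>u. u \<in> {x..y} \<Longrightarrow> g u \<le> g m"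
      using continuous_attains_sup[OF compact_Icc _ contg] xy by fastforce
    have "g m > 0" using gz m(2)[of z] z by simp
    then have mm: "x < m" "m < y" using gx m(1) by (auto simp: less_le)
    obtain C d where Cd: "d > 0" "\<And>u h. x \<le> u \<Longrightarrow> u \<le> y \<Longrightarrow> 0 < h \<Longrightarrow> h < d \<Longrightarrow>
                 f u + f (u + 2 * h) - 2 * f (u + h) \<ge> - C * h ^ 3"
      using mid[of x y] by blast
    \<comment> \<open>The bounds keep m - h and m + h inside [x, y] and give C h \<le> \<delta>;
      half of \<open>d\<close> makes the inequality h < d strict.\<close>
    define h where "h = Min {d / 2, m - x, y - m, \<delta> / (\<bar>C\<bar> + 1)}"
    have h0: "h > 0" using Cd(1) mm \<delta> by (simp add: h_def)
    have h1: "h \<le> d / 2" "h \<le> m - x" "h \<le> y - m" "h \<le> \<delta> / (\<bar>C\<bar> + 1)"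
      unfolding h_def by (rule Min_le, simp, simp)+
    have "h < d" using h1 Cd(1) by linarith
    have A: "f (m - h) + f (m + h) - 2 * f m \<ge> - C * h ^ 3"
      using Cd(2)[of "m - h" h] h1 h0 mm \<open>h < d\<close> by (simp add: algebra_simps)
    have lin2: "lin (m - h) + lin (m + h) - 2 * lin m = 0"
      by (simp add: lin_def algebra_simps)
    have quad: "(m - h - x) * (m - h - y) + (m + h - x) * (m + h - y) - 2 * ((m - x) * (m - y)) = 2 * h ^ 2"
      by (simp add: algebra_simps power2_eq_square)
    have "g (m - h) + g (m + h) - 2 * g m
        = (f (m - h) + f (m + h) - 2 * f m) - (lin (m - h) + lin (m + h) - 2 * lin m)
          + \<delta> * ((m - h - x) * (m - h - y) + (m + h - x) * (m + h - y) - 2 * ((m - x) * (m - y)))"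
      unfolding g_def by (simp add: algebra_simps)
    also have "\<dots> \<ge> - C * h ^ 3 + 2 * \<delta> * h ^ 2" unfolding lin2 quad using A by simp
    finally have B: "g (m - h) + g (m + h) - 2 * g m \<ge> - C * h ^ 3 + 2 * \<delta> * h ^ 2" .
    have "g (m - h) \<le> g m" "g (m + h) \<le> g m" using m(2) h1 h0 mm by simp_all
    with B have "2 * \<delta> * h ^ 2 \<le> C * h ^ 3" by linarith
    also have "C * h ^ 3 = (C * h) * h ^ 2" by (simp add: power3_eq_cube power2_eq_square)
    also have "\<dots> \<le> \<delta> * h ^ 2"
    proof (rule mult_right_mono)
      have "C * h \<le> (\<bar>C\<bar> + 1) * h" using h0 by (intro mult_right_mono) auto
      also have "\<dots> \<le> (\<bar>C\<bar> + 1) * (\<delta> / (\<bar>C\<bar> + 1))" using h1 by (intro mult_left_mono) auto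
      also have "\<dots> = \<delta>" by simp
      finally show "C * h \<le> \<delta>" .
    qed simp
    finally have "2 * \<delta> * h ^ 2 \<le> \<delta> * h ^ 2" .
    moreover have "\<delta> * h ^ 2 > 0" using \<delta> h0 by simp
    ultimately show False by simp
  qed
  then show "f ((1 - t) *\<^sub>R x + t *\<^sub>R y) \<le> (1 - t) * f x + t * f y"
    using linz by (simp add: z_def)
qed

section \<open>The Hausdorff moment problem\<close>

text \<open>\<open>w k l\<close> stands for the integral of t^k (1 - t)^l against the measure to be
  found, and \<open>split\<close> is the identity t + (1 - t) = 1. Carrying both exponents turns
  Hausdorff's condition on iterated differences of the moments into plain nonnegativity.\<close>

locale hausdorff_moments =
  fixes w :: "nat \<Rightarrow> nat \<Rightarrow> real"
  assumes nonneg: "w k l \<ge> 0"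
    and split: "w k l = w (Suc k) l + w k (Suc l)"
begin

text \<open>The binomial expansion of 1 = (t + (1 - t))^m, multiplied by t^j (1 - t)^l and
  integrated.\<close>

lemma binomial_sum: "(\<Sum>i\<le>m. real (m choose i) * w (j + i) (l + (m - i))) = w j l"
proof (induction m arbitrary: j l)
  case 0
  then show ?case by simp
next
  case (Suc m)
  have "(\<Sum>i\<le>Suc m. real (Suc m choose i) * w (j + i) (l + (Suc m - i)))
     = real (Suc m choose 0) * w j (l + Suc m)
       + (\<Sum>i\<le>m. real (Suc m choose Suc i) * w (j + Suc i) (l + (Suc m - Suc i)))"
    by (subst sum.atMost_Suc_shift) simp
  also have "(\<Sum>i\<le>m. real (Suc m choose Suc i) * w (j + Suc i) (l + (Suc m - Suc i)))
     = (\<Sum>i\<le>m. real (m choose i) * w (Suc j + i) (l + (m - i)))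
      + (\<Sum>i\<le>m. real (m choose Suc i) * w (j + Suc i) (l + (m - i)))"
    by (simp add: sum.distrib[symmetric] algebra_simps)
  also have "(\<Sum>i\<le>m. real (m choose Suc i) * w (j + Suc i) (l + (m - i)))
      = (\<Sum>i<m. real (m choose Suc i) * w (j + Suc i) (l + (m - i)))"
    by (simp add: lessThan_Suc_atMost[symmetric])
  also have "\<dots> = (\<Sum>i<m. real (m choose Suc i) * w (j + Suc i) (Suc l + (m - Suc i)))"
    by (intro sum.cong) (auto simp: Suc_diff_Suc)
  finally have "(\<Sum>i\<le>Suc m. real (Suc m choose i) * w (j + i) (l + (Suc m - i)))
     = (\<Sum>i\<le>m. real (m choose i) * w (Suc j + i) (l + (m - i)))
      + (real (m choose 0) * w (j + 0) (Suc l + (m - 0))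
         + (\<Sum>i<m. real (m choose Suc i) * w (j + Suc i) (Suc l + (m - Suc i))))"
    by simp
  also have "real (m choose 0) * w (j + 0) (Suc l + (m - 0))
         + (\<Sum>i<m. real (m choose Suc i) * w (j + Suc i) (Suc l + (m - Suc i)))
      = (\<Sum>i\<le>m. real (m choose i) * w (j + i) (Suc l + (m - i)))"
    by (subst sum.lessThan_Suc_shift[symmetric]) (simp add: lessThan_Suc_atMost)
  finally show ?case unfolding Suc.IH using split[of j l] by simp
qed

text \<open>For fixed t the binomial law has a j-th factorial moment proportional to t^j;
  integrating over t gives the identity. Its exactness for every n is why binomial coefficients of k
  come before powers of k.\<close>

lemma factorial_moment:
  assumes "j \<le> n"
  shows "(\<Sum>k\<le>n. real (n choose k) * w k (n - k) * real (k choose j)) = real (n choose j) * w j 0"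
proof -
  have "(\<Sum>k\<le>n. real (n choose k) * w k (n - k) * real (k choose j))
      = (\<Sum>k\<in>{j..n}. real (n choose k) * w k (n - k) * real (k choose j))"
    by (rule sum.mono_neutral_right) auto
  also have "\<dots> = (\<Sum>k\<in>{j..n}. real (n choose j) * (real ((n - j) choose (k - j)) * w k (n - k)))"
  proof (intro sum.cong refl)
    fix k assume k: "k \<in> {j..n}"
    then have "(n choose k) * (k choose j) = (n choose j) * ((n - j) choose (k - j))"
      by (intro choose_mult) auto
    then have "real (n choose k) * real (k choose j) = real (n choose j) * real ((n - j) choose (k - j))"
      by (metis of_nat_mult)
    then show "real (n choose k) * w k (n - k) * real (k choose j)
       = real (n choose j) * (real ((n - j) choose (k - j)) * w k (n - k))"
      by (metis (no_types, lifting) mult.assoc mult.commute)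
  qed
  also have "\<dots> = real (n choose j) * (\<Sum>k\<in>{j..n}. real ((n - j) choose (k - j)) * w k (n - k))"
    by (simp add: sum_distrib_left)
  also have "(\<Sum>k\<in>{j..n}. real ((n - j) choose (k - j)) * w k (n - k))
     = (\<Sum>i\<le>n-j. real ((n - j) choose i) * w (j + i) (0 + ((n - j) - i)))"
    using assms by (intro sum.reindex_bij_witness[of _ "\<lambda>i. j + i" "\<lambda>k. k - j"]) auto
  also have "\<dots> = w j 0" by (rule binomial_sum)
  finally show ?thesis .
qed

end

text \<open>The quotient of binomial coefficients is a product of j factors (k - i) / (n - i), each
  close to k / n, and products of numbers of modulus at most 1 differ by at most the sum of the
  differences of the factors. For fixed j the error is of order 1 / n, so factorial moments may
  replace ordinary ones in the limit.\<close>

lemma power_minus_binomial_ratio: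
  fixes n k j :: nat
  assumes "j < n" "k \<le> n"
  shows "\<bar>(real k / real n) ^ j - real (k choose j) / real (n choose j)\<bar> \<le> real j * (real j / real (n - j))"
proof -
  have ratio: "real (k choose j) / real (n choose j) = (\<Prod>i\<in>{0..<j}. real (k - i) / real (n - i))"
  proof (cases "j \<le> k")
    case True
    have nz: "(\<Prod>i\<in>{0..<j}. real (j - i)) \<noteq> 0" by simp
    have "real (k choose j) = (\<Prod>i\<in>{0..<j}. real (k - i)) / (\<Prod>i\<in>{0..<j}. real (j - i))"
         "real (n choose j) = (\<Prod>i\<in>{0..<j}. real (n - i)) / (\<Prod>i\<in>{0..<j}. real (j - i))"
      using True assms by (simp_all add: binomial_altdef_of_nat prod_dividef)
    then show ?thesis using nz by (simp add: prod_dividef)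
  next
    case False
    \<comment> \<open>For k < j both sides vanish: truncated subtraction makes the factor with i = k
      zero.\<close>
    then have "k \<in> {0..<j}" by simp
    then have "(\<Prod>i\<in>{0..<j}. real (k - i) / real (n - i)) = 0"
      by (intro prod_zero) (auto intro!: bexI[of _ k])
    then show ?thesis using False by (simp only: binomial_eq_0 not_le of_nat_0 div_0)
  qed
  have "\<bar>(\<Prod>i\<in>{0..<j}. real k / real n) - (\<Prod>i\<in>{0..<j}. real (k - i) / real (n - i))\<bar>
     \<le> (\<Sum>i\<in>{0..<j}. \<bar>real k / real n - real (k - i) / real (n - i)\<bar>)"
    using norm_prod_diff[of "{0..<j}" "\<lambda>_. real k / real n" "\<lambda>i. real (k - i) / real (n - i)"] assms
    by (simp add: divide_simps)
  also have "\<dots> \<le> (\<Sum>i\<in>{0..<j}. real j / real (n - j))"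
  proof (rule sum_mono)
    fix i assume i: "i \<in> {0..<j}"
    have n: "real (n - i) = real n - real i" "real (n - j) = real n - real j" using assms i by auto
    show "\<bar>real k / real n - real (k - i) / real (n - i)\<bar> \<le> real j / real (n - j)"
    proof (cases "i \<le> k")
      case True
      have "real k / real n - real (k - i) / real (n - i) = (real i / real (n - i)) * ((real n - real k) / real n)"
        using True assms i by (simp add: n field_simps of_nat_diff)
      also have "\<bar>\<dots>\<bar> \<le> (real i / real (n - i)) * 1"
        using assms unfolding abs_mult by (intro mult_mono) (auto simp: divide_simps)
      also have "\<dots> \<le> real j / real (n - j)" using i assms by (auto intro!: frac_le)
      finally show ?thesis .
    next
      case False
      then have "\<bar>real k / real n - real (k - i) / real (n - i)\<bar> = real k / real n" by simp
      also have "\<dots> \<le> real j / real (n - j)" using False i assms by (auto intro!: frac_le)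
      finally show ?thesis .
    qed
  qed
  finally show ?thesis unfolding ratio by simp
qed

context hausdorff_moments
begin

text \<open>The law of k / n when k is binomial with a random parameter t distributed by the measure
  sought. It can be written down from \<open>w\<close> alone and should converge to that
  measure.\<close>

definition bernstein_measure :: "nat \<Rightarrow> real measure" where
  "bernstein_measure n = distr (measure_pmf (embed_pmf (\<lambda>k. if k \<le> n then real (n choose k) * w k (n - k) else 0)))
      borel (\<lambda>k. real k / real n)"

lemma pmf_bernstein:
  assumes "w 0 0 = 1"
  shows "pmf (embed_pmf (\<lambda>k. if k \<le> n then real (n choose k) * w k (n - k) else 0)) k
     = (if k \<le> n then real (n choose k) * w k (n - k) else 0)"
proof (rule pmf_embed_pmf)
  show "\<And>x. 0 \<le> (if x \<le> n then real (n choose x) * w x (n - x) else 0)" by (simp add: nonneg)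
  have "(\<integral>\<^sup>+ x. ennreal (if x \<le> n then real (n choose x) * w x (n - x) else 0) \<partial>count_space UNIV)
     = (\<Sum>x\<in>{..n}. ennreal (if x \<le> n then real (n choose x) * w x (n - x) else 0))"
    by (rule nn_integral_count_space') auto
  also have "\<dots> = ennreal (\<Sum>x\<le>n. real (n choose x) * w x (n - x))"
    by (subst sum_ennreal) (auto simp: nonneg)
  also have "(\<Sum>x\<le>n. real (n choose x) * w x (n - x)) = 1"
    using factorial_moment[of 0 n] assms by simp
  finally show "(\<integral>\<^sup>+ x. ennreal (if x \<le> n then real (n choose x) * w x (n - x) else 0) \<partial>count_space UNIV) = 1"
    by simp
qed

lemma integral_bernstein:
  fixes f :: "real \<Rightarrow> real"
  assumes "w 0 0 = 1" and [measurable]: "f \<in> borel_measurable borel"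
  shows "(\<integral>t. f t \<partial>bernstein_measure n) = (\<Sum>k\<le>n. real (n choose k) * w k (n - k) * f (real k / real n))"
proof -
  let ?p = "embed_pmf (\<lambda>k. if k \<le> n then real (n choose k) * w k (n - k) else 0)"
  have "(\<integral>t. f t \<partial>bernstein_measure n) = measure_pmf.expectation ?p (\<lambda>k. f (real k / real n))"
    unfolding bernstein_measure_def by (rule integral_distr) auto
  also have "\<dots> = (\<Sum>k\<le>n. f (real k / real n) * pmf ?p k)"
    by (rule integral_measure_pmf_real) (auto simp: set_pmf_iff pmf_bernstein[OF assms(1)] split: if_splits)
  also have "\<dots> = (\<Sum>k\<le>n. real (n choose k) * w k (n - k) * f (real k / real n))"
    by (intro sum.cong) (auto simp: pmf_bernstein[OF assms(1)])
  finally show ?thesis .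
qed

text \<open>The Bernstein measures live on [0, 1] and are therefore tight. A weak limit along a
  subsequence has the right moments, because theirs converge to \<open>w j 0\<close> along the whole
  sequence.\<close>

lemma ex_prob_measure:
  assumes w1: "w 0 0 = 1"
  shows "\<exists>\<mu> :: real measure. prob_space \<mu> \<and> sets \<mu> = sets borel \<and> (AE t in \<mu>. t \<in> {0..1})
           \<and> (\<forall>k. (\<integral>t. t ^ k \<partial>\<mu>) = w k 0)"
proof -
  have rd: "real_distribution (bernstein_measure n)" for n
    unfolding bernstein_measure_def by (rule prob_space.real_distribution_distr) (auto simp: measure_pmf.prob_space_axioms)
  have supp: "AE t in bernstein_measure n. t \<in> {0..1}" for n
    unfolding bernstein_measure_def
    by (subst AE_distr_iff)
       (auto simp: AE_measure_pmf_iff set_pmf_iff pmf_bernstein[OF w1] divide_simps split: if_splits)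
  have "tight bernstein_measure"
    unfolding tight_def
  proof (intro conjI allI impI)
    fix e :: real assume e: "e > 0"
    have "measure (bernstein_measure n) {-1<..1} = 1" for n
    proof -
      interpret real_distribution "bernstein_measure n" by (rule rd)
      show ?thesis by (subst prob_eq_1) (use supp[of n] in \<open>auto\<close>)
    qed
    then show "\<exists>a b. a < b \<and> (\<forall>n. 1 - e < measure (bernstein_measure n) {a<..b})"
      using e by (intro exI[of _ "-1"] exI[of _ 1]) auto
  qed (rule rd)
  from tight_imp_convergent_subsubsequence[OF this strict_mono_id]
  obtain r M where r: "strict_mono r" and M: "real_distribution M"
    and wc: "weak_conv_m (bernstein_measure \<circ> r) M" by auto
  interpret M: real_distribution M by (rule M)
  have lim: "(\<lambda>n. \<integral>t. f t \<partial>bernstein_measure (r n)) \<longlonglongrightarrow> (\<integral>t. f t \<partial>M)"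
    if "\<And>x. isCont f x" "\<And>x. norm (f x) \<le> B" for f :: "real \<Rightarrow> real" and B
    using weak_conv_imp_integral_bdd_continuous_conv[of "bernstein_measure \<circ> r" M, OF _ M wc that] rd by simp
  \<comment> \<open>Weak convergence tests bounded continuous functions only. Clamping to [0, 1]
    makes the powers bounded without changing them on the support.\<close>
  define cl :: "real \<Rightarrow> real" where "cl t = max 0 (min 1 t)" for t
  have cl: "continuous_on UNIV cl" "\<bar>cl t\<bar> \<le> 1" "t \<in> {0..1} \<Longrightarrow> cl t = t" "t \<notin> {0..1} \<Longrightarrow> cl t \<noteq> t" for t
    unfolding cl_def by (auto intro!: continuous_intros)
  have clm[measurable]: "cl \<in> borel_measurable borel" using cl(1) by (rule borel_measurable_continuous_onI)
  have suppM: "AE t in M. t \<in> {0..1}"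
  proof -
    \<comment> \<open>Bounded, continuous and zero exactly on [0, 1], so its vanishing integrals
      pass to the limit and confine the limit measure to that interval.\<close>
    define f where "f t = min 1 \<bar>t - cl t\<bar>" for t
    have fc: "continuous_on UNIV f" unfolding f_def by (intro continuous_intros cl)
    have [measurable]: "f \<in> borel_measurable borel" using fc by (rule borel_measurable_continuous_onI)
    have fb: "norm (f t) \<le> 1" for t by (auto simp: f_def)
    have "(\<integral>t. f t \<partial>bernstein_measure n) = (\<integral>t. 0 \<partial>bernstein_measure n)" for n
    proof -
      interpret real_distribution "bernstein_measure n" by (rule rd)
      show ?thesis by (rule integral_cong_AE) (use supp[of n] in \<open>auto simp: f_def cl\<close>)
    qed
    then have "(\<lambda>n. 0) \<longlonglongrightarrow> (\<integral>t. f t \<partial>M)"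
      using lim[of f 1] fb fc by (simp add: continuous_on_eq_continuous_at)
    then have "(\<integral>t. f t \<partial>M) = 0" by (simp add: LIMSEQ_const_iff)
    moreover have "integrable M f" by (rule M.integrable_const_bound[where B=1]) (use fb in auto)
    ultimately have "AE t in M. f t = 0"
      by (subst (asm) integral_nonneg_eq_0_iff_AE) (auto simp: f_def)
    have zero: "t \<in> {0..1}" if "f t = 0" for t
      using that cl(4)[of t] by (cases "t \<in> {0..1}") (simp_all add: f_def min_def split: if_splits)
    from \<open>AE t in M. f t = 0\<close> show ?thesis by (rule eventually_mono) (rule zero)
  qed
  have mom: "(\<integral>t. t ^ j \<partial>M) = w j 0" for j
  proof -
    have clj: "continuous_on UNIV (\<lambda>t. cl t ^ j)" by (intro continuous_intros cl)
    have clb: "norm (cl t ^ j) \<le> 1" for t using cl(2)[of t] by (simp add: power_abs power_le_one)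
    have conv: "(\<lambda>n. \<integral>t. cl t ^ j \<partial>bernstein_measure (r n)) \<longlonglongrightarrow> (\<integral>t. cl t ^ j \<partial>M)"
      using lim[of "\<lambda>t. cl t ^ j" 1] clb clj by (simp add: continuous_on_eq_continuous_at)
    have "(\<lambda>n. (\<integral>t. cl t ^ j \<partial>bernstein_measure n) - w j 0) \<longlonglongrightarrow> 0"
    proof (rule Lim_null_comparison)
      show "\<forall>\<^sub>F n in sequentially. norm ((\<integral>t. cl t ^ j \<partial>bernstein_measure n) - w j 0) \<le> real j * (real j / real (n - j))"
        using eventually_gt_at_top[of j]
      proof eventually_elim
        case (elim n)
        have tot: "(\<Sum>k\<le>n. real (n choose k) * w k (n - k)) = 1" using factorial_moment[of 0 n] w1 by simp
        have wj: "w j 0 = (\<Sum>k\<le>n. real (n choose k) * w k (n - k) * (real (k choose j) / real (n choose j)))"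
          using factorial_moment[of j n] elim by (simp add: sum_divide_distrib[symmetric])
        have "(\<integral>t. cl t ^ j \<partial>bernstein_measure n) = (\<Sum>k\<le>n. real (n choose k) * w k (n - k) * cl (real k / real n) ^ j)"
          by (rule integral_bernstein[OF w1]) simp
        also have "\<dots> = (\<Sum>k\<le>n. real (n choose k) * w k (n - k) * (real k / real n) ^ j)"
          by (intro sum.cong refl) (subst cl(3), auto simp: divide_simps)
        finally have diff: "(\<integral>t. cl t ^ j \<partial>bernstein_measure n) - w j 0
           = (\<Sum>k\<le>n. real (n choose k) * w k (n - k) * ((real k / real n) ^ j - real (k choose j) / real (n choose j)))"
          unfolding wj by (simp add: sum_subtractf[symmetric] algebra_simps)
        have "norm ((\<integral>t. cl t ^ j \<partial>bernstein_measure n) - w j 0)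
            \<le> (\<Sum>k\<le>n. real (n choose k) * w k (n - k) * (real j * (real j / real (n - j))))"
          unfolding real_norm_def diff
        proof (rule order_trans[OF sum_abs], rule sum_mono)
          fix k assume "k \<in> {..n}"
          then have "\<bar>(real k / real n) ^ j - real (k choose j) / real (n choose j)\<bar> \<le> real j * (real j / real (n - j))"
            using elim by (intro power_minus_binomial_ratio) auto
          moreover have "real (n choose k) * w k (n - k) \<ge> 0" by (simp add: nonneg)
          moreover have "\<bar>c * r\<bar> \<le> c * B" if "\<bar>r\<bar> \<le> B" "c \<ge> 0" for c r B :: real
            using that by (simp add: abs_mult mult_left_mono)
          ultimately show "\<bar>real (n choose k) * w k (n - k) * ((real k / real n) ^ j - real (k choose j) / real (n choose j))\<bar>
              \<le> real (n choose k) * w k (n - k) * (real j * (real j / real (n - j)))" by blast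
        qed
        also have "\<dots> = (\<Sum>k\<le>n. real (n choose k) * w k (n - k)) * (real j * (real j / real (n - j)))"
          by (rule sum_distrib_right[symmetric])
        also have "\<dots> = real j * (real j / real (n - j))" by (simp add: tot)
        finally show ?case .
      qed
      show "(\<lambda>n. real j * (real j / real (n - j))) \<longlonglongrightarrow> 0"
      proof -
        have "(\<lambda>n. real j * (real j / real n)) \<longlonglongrightarrow> real j * 0"
          by (intro tendsto_mult tendsto_const lim_const_over_n)
        then have "(\<lambda>n. real j * (real j / real (n + j - j))) \<longlonglongrightarrow> 0" by simp
        then show ?thesis by (rule LIMSEQ_offset)
      qed
    qed
    then have "(\<lambda>n. \<integral>t. cl t ^ j \<partial>bernstein_measure n) \<longlonglongrightarrow> w j 0" by (simp add: LIM_zero_iff)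
    from LIMSEQ_subseq_LIMSEQ[OF this r] have "(\<lambda>n. \<integral>t. cl t ^ j \<partial>bernstein_measure (r n)) \<longlonglongrightarrow> w j 0"
      by (simp add: o_def)
    then have "(\<integral>t. cl t ^ j \<partial>M) = w j 0" using conv LIMSEQ_unique by blast
    moreover have "(\<integral>t. cl t ^ j \<partial>M) = (\<integral>t. t ^ j \<partial>M)"
      by (rule integral_cong_AE) (use suppM in \<open>auto simp: cl(3)\<close>)
    ultimately show ?thesis by simp
  qed
  show ?thesis
    using suppM mom M.prob_space_axioms by (intro exI[of _ M]) auto
qed

end

section \<open>Uniqueness of a compactly supported measure with given moments\<close>

lemma (in finite_measure) integrable_bounded_AE:
  fixes f :: "'a \<Rightarrow> real"
  assumes "f \<in> borel_measurable M" "AE t in M. \<bar>f t\<bar> \<le> B"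
  shows "integrable M f"
  using assms by (intro integrable_const_bound[where B=B]) auto

lemma AE_Icc_if_emeasure_Compl_eq_0:
  fixes \<mu> :: "real measure"
  assumes "sets \<mu> = sets borel" "emeasure \<mu> (- {0..C}) = 0"
  shows "AE t in \<mu>. t \<in> {0..C}"
proof (rule AE_I[where N="- {0..C}"])
  show "- {0..C} \<in> sets \<mu>" using assms(1) by simp
qed (use assms in auto)

lemma integrable_continuous_bounded_support:
  fixes f :: "real \<Rightarrow> real" and M :: "real measure"
  assumes "finite_measure M" and sets [measurable_cong, simp]: "sets M = sets borel"
    and supp: "AE t in M. t \<in> {0..C}" and f: "continuous_on UNIV f"
  shows "integrable M f"
proof -
  interpret finite_measure M by fact
  have [measurable]: "f \<in> borel_measurable borel" using f by (rule borel_measurable_continuous_onI)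
  have "compact (f ` {0..C})"
    by (intro compact_continuous_image continuous_on_subset[OF f]) auto
  then have "bounded (f ` {0..C})" by (rule compact_imp_bounded)
  then obtain b where "\<forall>x\<in>f ` {0..C}. norm x \<le> b" unfolding bounded_iff by blast
  then have b: "\<bar>f t\<bar> \<le> b" if "t \<in> {0..C}" for t using that by simp
  show ?thesis by (rule integrable_bounded_AE[where B=b], simp, rule eventually_mono[OF supp], rule b)
qed

text \<open>Polynomials are dense in the continuous functions on a common compact support, so
  integrals of continuous functions agree. Continuous ramps descending to the indicator of a
  half-line then make the distribution functions agree.\<close>

lemma bounded_measure_eqI_moments:
  fixes \<mu> \<nu> :: "real measure"
  assumes "finite_measure \<mu>" "finite_measure \<nu>"
    and sets[measurable_cong, simp]: "sets \<mu> = sets borel" "sets \<nu> = sets borel"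
    and supp: "AE t in \<mu>. t \<in> {0..C}" "AE t in \<nu>. t \<in> {0..D}"
    and mom: "\<And>k::nat. (\<integral>t. t ^ k \<partial>\<mu>) = (\<integral>t. t ^ k \<partial>\<nu>)"
  shows "\<mu> = \<nu>"
proof -
  interpret m: finite_measure \<mu> by fact
  interpret n: finite_measure \<nu> by fact
  define B where "B = max C D"
  have suppB: "AE t in \<mu>. t \<in> {0..B}" "AE t in \<nu>. t \<in> {0..B}"
    by (rule eventually_mono[OF supp(1)], simp add: B_def le_max_iff_disj)
      (rule eventually_mono[OF supp(2)], simp add: B_def le_max_iff_disj)
  have integrable_cont: "integrable \<mu> f" "integrable \<nu> f" if "continuous_on UNIV f" for f :: "real \<Rightarrow> real"
    using integrable_continuous_bounded_support[OF assms(1) sets(1) suppB(1) that]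
      integrable_continuous_bounded_support[OF assms(2) sets(2) suppB(2) that] by auto
  have cont_eq: "(\<integral>t. f t \<partial>\<mu>) = (\<integral>t. f t \<partial>\<nu>)" if f: "continuous_on UNIV f" for f :: "real \<Rightarrow> real"
  proof -
    define M where "M = measure \<mu> (space \<mu>) + measure \<nu> (space \<nu>)"
    have M0: "M \<ge> 0" by (simp add: M_def)
    have "\<bar>(\<integral>t. f t \<partial>\<mu>) - (\<integral>t. f t \<partial>\<nu>)\<bar> \<le> e * M" if e: "e > 0" for e
    proof -
      obtain g where g: "real_polynomial_function g" "\<And>t. t \<in> {0..B} \<Longrightarrow> \<bar>f t - g t\<bar> < e"
        using Stone_Weierstrass_real_polynomial_function[of "{0..B}" f e] continuous_on_subset[OF f] e by auto
      then obtain a n where gs: "g = (\<lambda>x. \<Sum>i\<le>n. a i * x ^ i)"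
        using real_polynomial_function_iff_sum by auto
      have gc: "continuous_on UNIV g" unfolding gs by (intro continuous_intros)
      have ge: "(\<integral>t. g t \<partial>\<mu>) = (\<integral>t. g t \<partial>\<nu>)"
        unfolding gs using integrable_cont[of "\<lambda>t. t ^ _"] by (simp add: mom continuous_intros)
      have approx: "\<bar>(\<integral>t. f t \<partial>\<rho>) - (\<integral>t. g t \<partial>\<rho>)\<bar> \<le> e * measure \<rho> (space \<rho>)"
        if "finite_measure \<rho>" "integrable \<rho> f" "integrable \<rho> g" "AE t in \<rho>. t \<in> {0..B}" for \<rho>
      proof -
        interpret finite_measure \<rho> by fact
        have "\<bar>(\<integral>t. f t \<partial>\<rho>) - (\<integral>t. g t \<partial>\<rho>)\<bar> = \<bar>\<integral>t. f t - g t \<partial>\<rho>\<bar>" using that by simp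
        also have "\<dots> \<le> (\<integral>t. \<bar>f t - g t\<bar> \<partial>\<rho>)" by (rule integral_abs_bound)
        also have "\<dots> \<le> (\<integral>t. e \<partial>\<rho>)"
        proof (rule integral_mono_AE)
          show "AE t in \<rho>. \<bar>f t - g t\<bar> \<le> e"
            by (rule eventually_mono[OF that(4)], rule less_imp_le, rule g(2))
        qed (use that in auto)
        finally show ?thesis by (simp add: mult.commute)
      qed
      note 1 = approx[OF assms(1) integrable_cont(1)[OF f] integrable_cont(1)[OF gc] suppB(1)]
        and 2 = approx[OF assms(2) integrable_cont(2)[OF f] integrable_cont(2)[OF gc] suppB(2)]
      show ?thesis using 1 2 ge by (simp add: M_def algebra_simps)
    qed
    note approx = this
    have "\<bar>(\<integral>t. f t \<partial>\<mu>) - (\<integral>t. f t \<partial>\<nu>)\<bar> \<le> 0"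
    proof (rule field_le_epsilon)
      fix d :: real assume d: "d > 0"
      \<comment> \<open>Division by \<open>M + 1\<close>, since the total mass \<open>M\<close> may
        be 0.\<close>
      have "\<bar>(\<integral>t. f t \<partial>\<mu>) - (\<integral>t. f t \<partial>\<nu>)\<bar> \<le> d / (M + 1) * M" by (rule approx) (use d M0 in simp)
      also have "\<dots> \<le> d / (M + 1) * (M + 1)" using d M0 by (intro mult_left_mono) auto
      also have "\<dots> = 0 + d" using M0 by simp
      finally show "\<bar>(\<integral>t. f t \<partial>\<mu>) - (\<integral>t. f t \<partial>\<nu>)\<bar> \<le> 0 + d" .
    qed
    then show ?thesis by simp
  qed
  have "measure \<mu> {..a} = measure \<nu> {..a}" for a
  proof -
    define f where "f n t = max 0 (min 1 (1 - real n * (t - a)))" for n t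
    have fc: "continuous_on UNIV (f n)" for n unfolding f_def by (intro continuous_intros)
    have fm[measurable]: "f n \<in> borel_measurable borel" for n using fc by (rule borel_measurable_continuous_onI)
    have lim: "(\<lambda>n. f n t) \<longlonglongrightarrow> indicator {..a} t" for t
    proof (cases "t \<le> a")
      case True
      then have "f n t = 1" for n by (simp add: f_def mult_le_0_iff)
      then show ?thesis using True by simp
    next
      case False
      obtain N where N: "real N * (t - a) > 1" using False reals_Archimedean3[of "t - a"] by auto
      have "f n t = 0" if "n \<ge> N" for n
      proof -
        have "real N * (t - a) \<le> real n * (t - a)" using that False by (intro mult_right_mono) auto
        then show ?thesis using N by (simp add: f_def)
      qed
      then have "\<forall>\<^sub>F n in sequentially. f n t = 0" by (auto simp: eventually_sequentially)
      then show ?thesis using False by (simp add: tendsto_eventually)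
    qed
    have conv: "(\<lambda>n. \<integral>t. f n t \<partial>\<rho>) \<longlonglongrightarrow> (\<integral>t. indicat_real {..a} t \<partial>\<rho>)"
      if "finite_measure \<rho>" and [measurable_cong, simp]: "sets \<rho> = sets borel" for \<rho>
    proof -
      interpret finite_measure \<rho> by fact
      show ?thesis by (rule integral_dominated_convergence[where w="\<lambda>_. 1"]) (use lim in \<open>auto simp: f_def\<close>)
    qed
    have "(\<integral>t. indicat_real {..a} t \<partial>\<mu>) = (\<integral>t. indicat_real {..a} t \<partial>\<nu>)"
      using conv[OF assms(1) sets(1)] conv[OF assms(2) sets(2)] unfolding cont_eq[OF fc] by (rule LIMSEQ_unique)
    then show ?thesis by simp
  qed
  then have "cdf \<mu> = cdf \<nu>" by (auto simp: cdf_def2)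
  then show ?thesis
    by (intro cdf_unique') (auto simp: finite_borel_measure_def finite_borel_measure_axioms_def assms sets_eq_imp_space_eq)
qed

section \<open>Logarithmic integrals\<close>

lemma ln_power_series_bounds:
  fixes x :: real
  assumes "0 < x" "x \<le> 1"
  shows "(\<lambda>N. \<Sum>k=1..N. (1 - x) ^ k / real k) \<longlonglongrightarrow> - ln x"
    and "\<bar>\<Sum>k=1..N. (1 - x) ^ k / real k\<bar> \<le> - ln x"
proof -
  have "(\<lambda>n. - ((- (- (1 - x))) ^ n) / real n) sums ln (1 + - (1 - x))"
    by (rule ln_series') (use assms in auto)
  from sums_minus[OF this] have S: "(\<lambda>n. (1 - x) ^ n / real n) sums - ln x" by simp
  have eq: "(\<Sum>k=1..N. (1 - x) ^ k / real k) = (\<Sum>k<Suc N. (1 - x) ^ k / real k)" for N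
    by (subst sum.lessThan_Suc_shift) (simp add: sum.atLeast1_atMost_eq)
  from S show "(\<lambda>N. \<Sum>k=1..N. (1 - x) ^ k / real k) \<longlonglongrightarrow> - ln x"
    unfolding eq sums_def by (rule LIMSEQ_Suc)
  have "(\<Sum>k<Suc N. (1 - x) ^ k / real k) \<le> suminf (\<lambda>k. (1 - x) ^ k / real k)"
    by (rule sum_le_suminf) (use S assms in \<open>auto simp: sums_iff\<close>)
  moreover have "(\<Sum>k<Suc N. (1 - x) ^ k / real k) \<ge> 0" using assms by (intro sum_nonneg) auto
  ultimately show "\<bar>\<Sum>k=1..N. (1 - x) ^ k / real k\<bar> \<le> - ln x"
    unfolding eq using S by (simp add: sums_iff)
qed

text \<open>With \<open>K\<close> at least C + \<epsilon> the argument (t + \<epsilon>) / K lies in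
  (0, 1], and ln is expanded around 1. The approximants involve integrals of polynomials, hence
  moments only; the constant ln K - ln \<epsilon> dominates all partial sums.\<close>

lemma integral_ln_add_eq_lim:
  fixes \<mu> :: "real measure"
  assumes "finite_measure \<mu>" and sets[measurable_cong, simp]: "sets \<mu> = sets borel"
    and supp: "AE t in \<mu>. t \<in> {0..C}"
    and e: "0 < \<epsilon>" "C + \<epsilon> \<le> K"
  shows "(\<lambda>N. measure \<mu> UNIV * ln K - (\<Sum>k=1..N. (\<integral>t. (1 - (t + \<epsilon>) / K) ^ k \<partial>\<mu>) / real k))
            \<longlonglongrightarrow> (\<integral>t. ln (t + \<epsilon>) \<partial>\<mu>)"
    and "integrable \<mu> (\<lambda>t. ln (t + \<epsilon>))"
proof -
  interpret finite_measure \<mu> by fact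
  show int: "integrable \<mu> (\<lambda>t. ln (t + \<epsilon>))"
  proof (rule integrable_bounded_AE[where B="\<bar>ln \<epsilon>\<bar> + \<bar>ln K\<bar>"])
    show "AE t in \<mu>. \<bar>ln (t + \<epsilon>)\<bar> \<le> \<bar>ln \<epsilon>\<bar> + \<bar>ln K\<bar>"
      using supp
    proof eventually_elim
      case (elim t)
      then have "ln \<epsilon> \<le> ln (t + \<epsilon>)" "ln (t + \<epsilon>) \<le> ln K" using e by auto
      then show ?case by linarith
    qed
  qed simp
  have sp: "space \<mu> = UNIV" using sets_eq_imp_space_eq[OF sets] by simp
  have ip: "integrable \<mu> (\<lambda>t. (1 - (t + \<epsilon>) / K) ^ k)" for k
  proof (rule integrable_bounded_AE[where B=1])
    show "AE t in \<mu>. \<bar>(1 - (t + \<epsilon>) / K) ^ k\<bar> \<le> 1"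
      using supp
    proof eventually_elim
      case (elim t)
      then have "\<bar>1 - (t + \<epsilon>) / K\<bar> \<le> 1" using e by (auto simp: divide_simps)
      then show ?case by (simp add: power_abs power_le_one)
    qed
  qed simp
  have ae: "AE t in \<mu>. 0 < (t + \<epsilon>) / K \<and> (t + \<epsilon>) / K \<le> 1 \<and> - ln ((t + \<epsilon>) / K) = ln K - ln (t + \<epsilon>)
       \<and> ln \<epsilon> \<le> ln (t + \<epsilon>)"
    using supp by eventually_elim (use e in \<open>auto simp: ln_div\<close>)
  have "(\<lambda>N. \<integral>t. (\<Sum>k=1..N. (1 - (t + \<epsilon>) / K) ^ k / real k) \<partial>\<mu>) \<longlonglongrightarrow> (\<integral>t. ln K - ln (t + \<epsilon>) \<partial>\<mu>)"
  proof (rule integral_dominated_convergence[where w="\<lambda>_. ln K - ln \<epsilon>"])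
    show "AE t in \<mu>. (\<lambda>N. \<Sum>k=1..N. (1 - (t + \<epsilon>) / K) ^ k / real k) \<longlonglongrightarrow> ln K - ln (t + \<epsilon>)"
      using ae by eventually_elim (metis ln_power_series_bounds(1))
    show "AE t in \<mu>. norm (\<Sum>k=1..N. (1 - (t + \<epsilon>) / K) ^ k / real k) \<le> ln K - ln \<epsilon>" for N
      using ae
    proof eventually_elim
      case (elim t)
      then have "\<bar>\<Sum>k=1..N. (1 - (t + \<epsilon>) / K) ^ k / real k\<bar> \<le> - ln ((t + \<epsilon>) / K)"
        by (intro ln_power_series_bounds) auto
      then show ?case using elim unfolding real_norm_def by linarith
    qed
  qed auto
  also have "(\<lambda>N. \<integral>t. (\<Sum>k=1..N. (1 - (t + \<epsilon>) / K) ^ k / real k) \<partial>\<mu>)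
     = (\<lambda>N. \<Sum>k=1..N. (\<integral>t. (1 - (t + \<epsilon>) / K) ^ k \<partial>\<mu>) / real k)"
    using ip by (simp add: Bochner_Integration.integral_sum)
  also have "(\<integral>t. ln K - ln (t + \<epsilon>) \<partial>\<mu>) = measure \<mu> UNIV * ln K - (\<integral>t. ln (t + \<epsilon>) \<partial>\<mu>)"
    using int by (simp add: sp)
  finally have "(\<lambda>N. measure \<mu> UNIV * ln K - (\<Sum>k=1..N. (\<integral>t. (1 - (t + \<epsilon>) / K) ^ k \<partial>\<mu>) / real k))
     \<longlonglongrightarrow> measure \<mu> UNIV * ln K - (measure \<mu> UNIV * ln K - (\<integral>t. ln (t + \<epsilon>) \<partial>\<mu>))"
    by (intro tendsto_diff tendsto_const)
  then show "(\<lambda>N. measure \<mu> UNIV * ln K - (\<Sum>k=1..N. (\<integral>t. (1 - (t + \<epsilon>) / K) ^ k \<partial>\<mu>) / real k))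
            \<longlonglongrightarrow> (\<integral>t. ln (t + \<epsilon>) \<partial>\<mu>)" by simp
qed

text \<open>Monotone convergence for -ln (t + 1 / (n + 1)), shifted to be nonnegative. A bound
  uniform in n leaves no room for an atom at 0, whose contribution is its mass times -ln (n + 1) and
  falls without bound; the same bound makes the limit integrable.\<close>

lemma integral_ln_add_tendsto:
  fixes \<mu> :: "real measure"
  assumes "finite_measure \<mu>" and sets [measurable_cong, simp]: "sets \<mu> = sets borel"
    and supp: "AE t in \<mu>. t \<in> {0..C}"
    and bound: "\<And>n. B \<le> (\<integral>t. ln (t + inverse (real (Suc n))) \<partial>\<mu>)"
  shows "measure \<mu> {0} = 0"
    and "set_integrable \<mu> {0<..} ln"
    and "(\<lambda>n. \<integral>t. ln (t + inverse (real (Suc n))) \<partial>\<mu>) \<longlonglongrightarrow> (LINT t:{0<..}|\<mu>. ln t)"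
proof -
  interpret finite_measure \<mu> by fact
  define M where "M = measure \<mu> UNIV"
  have sp: "space \<mu> = UNIV" using sets_eq_imp_space_eq[OF sets] by simp
  \<comment> \<open>An upper bound for all the logarithms on the support, so that \<open>g n\<close>
    is nonnegative there and increases with n. The \<open>max\<close> covers a negative
    \<open>C\<close>, which a null measure permits.\<close>
  define D where "D = ln (max C 0 + 1)"
  define g where "g n t = D - ln (t + inverse (real (Suc n)))" for n t
  have inv: "0 < inverse (real (Suc n))" "inverse (real (Suc n)) \<le> 1" for n by (simp_all add: divide_simps)
  have gm [measurable]: "g n \<in> borel_measurable borel" for n unfolding g_def by measurable
  have lni: "integrable \<mu> (\<lambda>t. ln (t + inverse (real (Suc n))))" for n
    by (rule integral_ln_add_eq_lim(2)[OF \<open>finite_measure \<mu>\<close> sets supp inv(1) order_refl])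
  have gi: "integrable \<mu> (g n)" for n unfolding g_def using lni by simp
  have gval: "(\<integral>t. g n t \<partial>\<mu>) = D * M - (\<integral>t. ln (t + inverse (real (Suc n))) \<partial>\<mu>)" for n
    unfolding g_def using lni by (simp add: M_def sp)
  then have gle: "(\<integral>t. g n t \<partial>\<mu>) \<le> D * M - B" for n using bound[of n] by simp
  have gnonneg: "AE t in \<mu>. 0 \<le> g n t" for n
  proof (rule eventually_mono[OF supp])
    fix t assume "t \<in> {0..C}"
    then have "ln (t + inverse (real (Suc n))) \<le> D"
      unfolding D_def using inv[of n] by (intro ln_mono) (auto intro: add_nonneg_pos)
    then show "0 \<le> g n t" by (simp add: g_def)
  qed
  have gmono: "AE t in \<mu>. g n t \<le> g (Suc n) t" for n
  proof (rule eventually_mono[OF supp])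
    fix t assume t: "t \<in> {0..C}"
    have "inverse (real (Suc (Suc n))) \<le> inverse (real (Suc n))" by simp
    then have "ln (t + inverse (real (Suc (Suc n)))) \<le> ln (t + inverse (real (Suc n)))"
      using t inv by (intro ln_mono) (auto intro: add_nonneg_pos)
    then show "g n t \<le> g (Suc n) t" by (simp add: g_def)
  qed
  show zero: "measure \<mu> {0} = 0"
  proof (rule ccontr)
    assume "measure \<mu> {0} \<noteq> 0"
    then have m0: "measure \<mu> {0} > 0" using measure_nonneg[of \<mu> "{0}"] by linarith
    have le: "(D + ln (real (Suc n))) * measure \<mu> {0} \<le> D * M - B" for n
    proof -
      have "(D + ln (real (Suc n))) * measure \<mu> {0} = (\<integral>t. (D + ln (real (Suc n))) * indicator {0} t \<partial>\<mu>)"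
        by (simp add: sp)
      also have "\<dots> \<le> (\<integral>t. g n t \<partial>\<mu>)"
      proof (rule integral_mono_AE)
        show "integrable \<mu> (\<lambda>t. (D + ln (real (Suc n))) * indicator {0} t)"
          by (intro integrable_mult_right) (auto intro!: integrable_real_indicator simp: emeasure_eq_measure)
        show "AE t in \<mu>. (D + ln (real (Suc n))) * indicator {0} t \<le> g n t"
        proof (rule eventually_mono[OF gnonneg[of n]])
          fix t assume "0 \<le> g n t"
          then show "(D + ln (real (Suc n))) * indicator {0} t \<le> g n t"
            by (cases "t = 0") (auto simp: g_def ln_inverse)
        qed
      qed (rule gi)
      finally show ?thesis using gle[of n] by linarith
    qed
    define x where "x = (D * M - B) / measure \<mu> {0} - D"
    obtain n where n: "exp x < real n" using reals_Archimedean2 by blast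
    also have "real n < exp (ln (real (Suc n)))" by simp
    finally have "x < ln (real (Suc n))" by (simp only: exp_less_cancel_iff)
    then have "(D * M - B) / measure \<mu> {0} < D + ln (real (Suc n))" by (simp add: x_def)
    then have "D * M - B < (D + ln (real (Suc n))) * measure \<mu> {0}" using m0 by (simp only: pos_divide_less_eq)
    with le[of n] show False by simp
  qed
  have pos: "AE t in \<mu>. 0 < t"
  proof -
    have "AE t in \<mu>. t \<noteq> 0"
      by (rule AE_I[where N="{0}"]) (auto simp: emeasure_eq_measure zero)
    with supp show ?thesis by eventually_elim auto
  qed
  define u where "u t = D - indicator {0<..} t *\<^sub>R ln t" for t :: real
  have "incseq (\<lambda>n. \<integral>t. g n t \<partial>\<mu>)"
    by (intro incseq_SucI integral_mono_AE gi gmono)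
  then obtain L where L: "(\<lambda>n. \<integral>t. g n t \<partial>\<mu>) \<longlonglongrightarrow> L"
    using incseq_convergent[of "\<lambda>n. \<integral>t. g n t \<partial>\<mu>" "D * M - B"] gle by blast
  have mono': "AE t in \<mu>. mono (\<lambda>n. g n t)"
  proof -
    have "AE t in \<mu>. \<forall>n. g n t \<le> g (Suc n) t" using gmono by (simp add: AE_all_countable)
    then show ?thesis by (rule eventually_mono) (simp add: mono_iff_le_Suc)
  qed
  have lim: "AE t in \<mu>. (\<lambda>n. g n t) \<longlonglongrightarrow> u t"
  proof (rule eventually_mono[OF pos])
    fix t :: real assume t: "0 < t"
    have "(\<lambda>n. D - ln (t + inverse (real (Suc n)))) \<longlonglongrightarrow> D - ln (t + 0)"
      by (intro tendsto_intros LIMSEQ_inverse_real_of_nat) (use t in auto)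
    then show "(\<lambda>n. g n t) \<longlonglongrightarrow> u t" using t by (simp add: g_def u_def)
  qed
  have um: "u \<in> borel_measurable \<mu>" unfolding u_def by measurable
  have ui: "integrable \<mu> u" and uL: "integral\<^sup>L \<mu> u = L"
    using integrable_monotone_convergence[OF gi mono' lim L um]
      integral_monotone_convergence[OF gi mono' lim L um] by auto
  have "(\<lambda>t. indicator {0<..} t *\<^sub>R ln t) = (\<lambda>t. D - u t)" by (simp add: u_def)
  moreover have "integrable \<mu> (\<lambda>t. D - u t)" using ui by simp
  ultimately show si: "set_integrable \<mu> {0<..} ln" unfolding set_integrable_def by simp
  have "L = D * M - (LINT t:{0<..}|\<mu>. ln t)"
    unfolding uL[symmetric] u_def set_lebesgue_integral_def
    using si unfolding set_integrable_def by (simp add: M_def sp)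
  moreover have "(\<lambda>n. D * M - (\<integral>t. g n t \<partial>\<mu>)) \<longlonglongrightarrow> D * M - L" by (intro tendsto_intros L)
  ultimately show "(\<lambda>n. \<integral>t. ln (t + inverse (real (Suc n))) \<partial>\<mu>) \<longlonglongrightarrow> (LINT t:{0<..}|\<mu>. ln t)"
    by (simp add: gval)
qed

lemma integral_ln_le_integral_ln_add:
  fixes \<mu> :: "real measure"
  assumes "finite_measure \<mu>" and sets [measurable_cong, simp]: "sets \<mu> = sets borel"
    and supp: "AE t in \<mu>. t \<in> {0..C}"
    and zero: "measure \<mu> {0} = 0" and int: "set_integrable \<mu> {0<..} ln" and e: "0 < \<epsilon>"
  shows "(LINT t:{0<..}|\<mu>. ln t) \<le> (\<integral>t. ln (t + \<epsilon>) \<partial>\<mu>)"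
  unfolding set_lebesgue_integral_def
proof (rule integral_mono_AE)
  interpret finite_measure \<mu> by fact
  show "integrable \<mu> (\<lambda>t. indicator {0<..} t *\<^sub>R ln t)" using int by (simp add: set_integrable_def)
  show "integrable \<mu> (\<lambda>t. ln (t + \<epsilon>))"
    by (rule integral_ln_add_eq_lim(2)[OF \<open>finite_measure \<mu>\<close> sets supp e order_refl])
  have "AE t in \<mu>. t \<noteq> 0" by (rule AE_I[where N="{0}"]) (auto simp: emeasure_eq_measure zero)
  with supp show "AE t in \<mu>. indicator {0<..} t *\<^sub>R ln t \<le> ln (t + \<epsilon>)"
    by eventually_elim (use e in auto)
qed

section \<open>Algebras with a positive trace\<close>

lemma power_scaleR: "(c *\<^sub>R x) ^ n = c ^ n *\<^sub>R x ^ n" for x :: "'a::real_algebra_1"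
  by (induction n) (simp_all add: mult.commute)

lemma summable_square_geometric:
  fixes r :: real
  assumes "0 < r" "r < 1"
  shows "summable (\<lambda>n. real n ^ 2 * r ^ n)"
proof (rule summable_comparison_test_ev)
  \<comment> \<open>With q the fourth root of r, the sequence n q^n tends to 0. Squaring it gives
    n^2 r^(n/2), and the other factor r^(n/2) remains as a geometric majorant.\<close>
  have "(\<lambda>n. (real n * sqrt (sqrt r) ^ n) ^ 2) \<longlonglongrightarrow> 0 ^ 2"
    using assms by (intro tendsto_power powser_times_n_limit_0) simp
  moreover have "(real n * sqrt (sqrt r) ^ n) ^ 2 = real n ^ 2 * sqrt r ^ n" for n
  proof -
    have "(sqrt (sqrt r) ^ n) ^ 2 = (sqrt (sqrt r) ^ 2) ^ n" by (metis power_mult mult.commute)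
    then show ?thesis using assms by (simp add: power_mult_distrib)
  qed
  ultimately have "(\<lambda>n. real n ^ 2 * sqrt r ^ n) \<longlonglongrightarrow> 0" by simp
  then have "\<forall>\<^sub>F n in sequentially. norm (real n ^ 2 * sqrt r ^ n) < 1"
    using order_tendstoD(2)[OF tendsto_norm_zero] by force
  then show "\<forall>\<^sub>F n in sequentially. norm (real n ^ 2 * r ^ n) \<le> sqrt r ^ n"
  proof eventually_elim
    case (elim n)
    have "r ^ n = sqrt r ^ n * sqrt r ^ n" using assms by (simp add: power_mult_distrib[symmetric])
    then have "norm (real n ^ 2 * r ^ n) = norm (real n ^ 2 * sqrt r ^ n) * sqrt r ^ n"
      using assms by (simp add: abs_mult)
    also have "\<dots> \<le> 1 * sqrt r ^ n" using elim assms by (intro mult_right_mono) auto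
    finally show ?case by simp
  qed
  show "summable (\<lambda>n. sqrt r ^ n)" using assms by (intro summable_geometric) auto
qed

text \<open>The operator algebra is reduced to what traces can see: a real-valued trace that is
  positive on products x x^*, without completeness or functional calculus. Closure, commutation
  under the trace and positivity are confined to \<open>S\<close> because the ambient type will also
  hold matrices that are unrelated to the group.\<close>

locale tracial_star_algebra =
  fixes S :: "'a::real_algebra_1 set" and star :: "'a \<Rightarrow> 'a" and \<tau> :: "'a \<Rightarrow> real"
  assumes one_in [simp, intro]: "1 \<in> S"
    and add_in [simp, intro]: "x \<in> S \<Longrightarrow> y \<in> S \<Longrightarrow> x + y \<in> S"
    and mult_in [simp, intro]: "x \<in> S \<Longrightarrow> y \<in> S \<Longrightarrow> x * y \<in> S"
    and scaleR_in [simp, intro]: "x \<in> S \<Longrightarrow> c *\<^sub>R x \<in> S"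
    and star_in [simp, intro]: "x \<in> S \<Longrightarrow> star x \<in> S"
    and star_add [simp]: "star (x + y) = star x + star y"
    and star_mult [simp]: "star (x * y) = star y * star x"
    and star_scaleR [simp]: "star (c *\<^sub>R x) = c *\<^sub>R star x"
    and star_star [simp]: "star (star x) = x"
    and tr_add [simp]: "\<tau> (x + y) = \<tau> x + \<tau> y"
    and tr_scaleR [simp]: "\<tau> (c *\<^sub>R x) = c * \<tau> x"
    and tr_commute: "x \<in> S \<Longrightarrow> y \<in> S \<Longrightarrow> \<tau> (x * y) = \<tau> (y * x)"
    and tr_star [simp]: "\<tau> (star x) = \<tau> x"
    and tr_nonneg: "x \<in> S \<Longrightarrow> \<tau> (x * star x) \<ge> 0"
begin

lemma zero_in [simp, intro]: "0 \<in> S" using scaleR_in[OF one_in, of 0] by simp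
lemma uminus_in [simp, intro]: "x \<in> S \<Longrightarrow> - x \<in> S" using scaleR_in[of x "-1"] by simp
lemma diff_in [simp, intro]: "x \<in> S \<Longrightarrow> y \<in> S \<Longrightarrow> x - y \<in> S" using add_in[of x "- y"] by simp
lemma of_real_in [simp, intro]: "of_real c \<in> S" by (simp add: of_real_def)
lemma power_in [simp, intro]: "x \<in> S \<Longrightarrow> x ^ n \<in> S" by (induction n) auto
lemma star_zero [simp]: "star 0 = 0" using star_scaleR[of 0 0] by simp
lemma star_uminus [simp]: "star (- x) = - star x" using star_scaleR[of "-1" x] by simp
lemma star_diff [simp]: "star (x - y) = star x - star y" using star_add[of x "- y"] by simp
lemma star_one [simp]: "star 1 = 1"
  by (metis mult.right_neutral star_mult star_star)
lemma star_of_real [simp]: "star (of_real c) = of_real c" by (simp add: of_real_def)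
lemma star_power [simp]: "star (x ^ n) = star x ^ n" by (induction n) (auto simp: power_commutes)

lemma tr_zero [simp]: "\<tau> 0 = 0" using tr_scaleR[of 0 0] by simp
lemma tr_uminus [simp]: "\<tau> (- x) = - \<tau> x" using tr_scaleR[of "-1" x] by simp
lemma tr_diff [simp]: "\<tau> (x - y) = \<tau> x - \<tau> y" using tr_add[of x "- y"] by simp
lemma tr_sum [simp]: "\<tau> (sum f I) = (\<Sum>i\<in>I. \<tau> (f i))"
  by (induction I rule: infinite_finite_induct) auto

section \<open>The trace seminorm and bounded right multiplications\<close>

definition hnorm :: "'a \<Rightarrow> real" where "hnorm x = sqrt (\<tau> (x * star x))"

lemma hnorm_nonneg [simp]: "x \<in> S \<Longrightarrow> hnorm x \<ge> 0" by (simp add: hnorm_def tr_nonneg)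
lemma hnorm_square: "x \<in> S \<Longrightarrow> hnorm x ^ 2 = \<tau> (x * star x)" by (simp add: hnorm_def tr_nonneg)

lemma tr_inner_commute: "\<tau> (x * star y) = \<tau> (y * star x)"
  using tr_star[of "x * star y"] by simp

lemma tr_Cauchy_Schwarz:
  assumes x: "x \<in> S" and y: "y \<in> S"
  shows "\<bar>\<tau> (x * star y)\<bar> \<le> hnorm x * hnorm y"
proof -
  let ?a = "\<tau> (x * star x)" and ?b = "\<tau> (x * star y)" and ?c = "\<tau> (y * star y)"
  have q: "0 \<le> ?a + 2 * t * ?b + t ^ 2 * ?c" for t
  proof -
    have "\<tau> ((x + t *\<^sub>R y) * star (x + t *\<^sub>R y)) = ?a + 2 * t * ?b + t ^ 2 * ?c"
      using tr_inner_commute[of x y] by (simp add: algebra_simps power2_eq_square)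
    then show ?thesis using tr_nonneg[of "x + t *\<^sub>R y"] x y by simp
  qed
  have "?b ^ 2 \<le> ?a * ?c"
  proof (cases "?c = 0")
    case True
    have "?b = 0"
    proof (rule ccontr)
      assume b: "?b \<noteq> 0"
      \<comment> \<open>With \<open>?c\<close> zero the quadratic polynomial in t is affine; at this
        t it takes the value -1.\<close>
      have "0 \<le> ?a + 2 * (- (?a + 1) / (2 * ?b)) * ?b" using q[of "- (?a + 1) / (2 * ?b)"] True by simp
      also have "\<dots> = - 1" using b by (simp add: field_simps)
      finally show False by simp
    qed
    then show ?thesis using True by simp
  next
    case False
    then have c: "?c > 0" using tr_nonneg[OF y] by simp
    have "0 \<le> ?a + 2 * (- ?b / ?c) * ?b + (- ?b / ?c) ^ 2 * ?c" by (rule q)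
    also have "\<dots> = ?a - ?b ^ 2 / ?c" using c by (simp add: field_simps power2_eq_square)
    finally show ?thesis using c by (simp add: field_simps)
  qed
  then have "sqrt (?b ^ 2) \<le> sqrt (?a * ?c)" by (rule real_sqrt_le_mono)
  then show ?thesis by (simp add: hnorm_def real_sqrt_mult)
qed

lemma hnorm_triangle:
  assumes x: "x \<in> S" and y: "y \<in> S"
  shows "hnorm (x + y) \<le> hnorm x + hnorm y"
proof (rule power2_le_imp_le)
  have "hnorm (x + y) ^ 2 = hnorm x ^ 2 + 2 * \<tau> (x * star y) + hnorm y ^ 2"
    using x y tr_inner_commute[of x y] by (simp add: hnorm_square algebra_simps)
  also have "\<dots> \<le> (hnorm x + hnorm y) ^ 2"
    using tr_Cauchy_Schwarz[OF x y] by (simp add: power2_sum)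
  finally show "hnorm (x + y) ^ 2 \<le> (hnorm x + hnorm y) ^ 2" .
qed (use x y in simp)

lemma hnorm_scaleR [simp]: "hnorm (c *\<^sub>R x) = \<bar>c\<bar> * hnorm x"
  by (simp add: hnorm_def real_sqrt_mult)

text \<open>An upper bound on the operator norm of right multiplication. It is kept as a relation
  instead of a norm: upper bounds add and multiply equally well, and no supremum has to be shown
  finite.\<close>

definition bd :: "real \<Rightarrow> 'a \<Rightarrow> bool" where
  "bd c x \<longleftrightarrow> x \<in> S \<and> 0 \<le> c \<and> (\<forall>y\<in>S. hnorm (y * x) \<le> c * hnorm y)"

lemma bd_in: "bd c x \<Longrightarrow> x \<in> S" and bd_nonneg: "bd c x \<Longrightarrow> 0 \<le> c"
  and bdD: "bd c x \<Longrightarrow> y \<in> S \<Longrightarrow> hnorm (y * x) \<le> c * hnorm y"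
  by (auto simp: bd_def)

lemma bd_mono: "bd c x \<Longrightarrow> c \<le> d \<Longrightarrow> bd d x"
  unfolding bd_def by (meson hnorm_nonneg mult_right_mono order_trans)

lemma bd_one: "bd 1 1" by (simp add: bd_def)
lemma bd_zero: "bd 0 0" by (simp add: bd_def hnorm_def)

lemma bd_mult:
  assumes "bd c x" "bd d y"
  shows "bd (c * d) (x * y)"
  unfolding bd_def
proof (intro conjI ballI)
  show "x * y \<in> S" "0 \<le> c * d" using assms by (auto simp: bd_def)
  fix z assume z: "z \<in> S"
  have "hnorm (z * x * y) \<le> d * hnorm (z * x)" using assms z by (intro bdD) (auto dest: bd_in)
  also have "\<dots> \<le> d * (c * hnorm z)" using assms z by (intro mult_left_mono bdD) (auto dest: bd_nonneg)
  finally show "hnorm (z * (x * y)) \<le> c * d * hnorm z" by (simp add: mult_ac)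
qed

lemma bd_add:
  assumes "bd c x" "bd d y"
  shows "bd (c + d) (x + y)"
  unfolding bd_def
proof (intro conjI ballI)
  show "x + y \<in> S" "0 \<le> c + d" using assms by (auto simp: bd_def)
  fix z assume z: "z \<in> S"
  have "hnorm (z * x + z * y) \<le> hnorm (z * x) + hnorm (z * y)"
    using assms z by (intro hnorm_triangle) (auto dest: bd_in)
  also have "\<dots> \<le> c * hnorm z + d * hnorm z" using assms z by (intro add_mono bdD)
  finally show "hnorm (z * (x + y)) \<le> (c + d) * hnorm z" by (simp add: algebra_simps)
qed

lemma bd_scaleR:
  assumes "bd c x"
  shows "bd (\<bar>r\<bar> * c) (r *\<^sub>R x)"
  using assms unfolding bd_def by (auto simp: mult.assoc intro!: mult_left_mono)

lemma bd_uminus: "bd c x \<Longrightarrow> bd c (- x)"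
  using bd_scaleR[of c x "-1"] by simp

lemma bd_star:
  assumes "bd c x"
  shows "bd c (star x)"
  unfolding bd_def
proof (intro conjI ballI)
  show "star x \<in> S" "0 \<le> c" using assms by (auto simp: bd_def)
  fix z assume z: "z \<in> S"
  have x: "x \<in> S" using assms by (rule bd_in)
  let ?u = "z * star x"
  have u: "?u \<in> S" using x z by simp
  have "hnorm ?u ^ 2 = \<tau> (?u * x * star z)" using u by (simp add: hnorm_square mult.assoc)
  also have "\<dots> \<le> hnorm (?u * x) * hnorm z"
    using tr_Cauchy_Schwarz[of "?u * x" z] x z by simp
  also have "\<dots> \<le> (c * hnorm ?u) * hnorm z"
    using assms u z by (intro mult_right_mono bdD) auto
  finally have *: "hnorm ?u * hnorm ?u \<le> hnorm ?u * (c * hnorm z)" by (simp add: power2_eq_square mult_ac)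
  show "hnorm ?u \<le> c * hnorm z"
  proof (cases "hnorm ?u = 0")
    case True
    then show ?thesis using assms z by (simp add: bd_nonneg)
  next
    case False
    then have "hnorm ?u > 0" using hnorm_nonneg[OF u] by linarith
    then show ?thesis using * by (simp add: mult_le_cancel_left)
  qed
qed

lemma bd_power: "bd c x \<Longrightarrow> bd (c ^ n) (x ^ n)"
  by (induction n) (auto intro: bd_one bd_mult)

lemma bd_tr:
  assumes "bd c x"
  shows "\<bar>\<tau> x\<bar> \<le> c * \<tau> 1"
proof -
  have "\<bar>\<tau> x\<bar> \<le> hnorm x * hnorm 1" using tr_Cauchy_Schwarz[of x 1] bd_in[OF assms] by simp
  also have "\<dots> \<le> (c * hnorm 1) * hnorm 1"
    using bdD[OF assms one_in] by (intro mult_right_mono) auto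
  also have "\<dots> = c * \<tau> 1" using hnorm_square[of 1] by (simp add: power2_eq_square)
  finally show ?thesis .
qed

lemma tr_one_nonneg: "\<tau> 1 \<ge> 0" using tr_nonneg[of 1] by simp

text \<open>The operator inequality x x^* \<le> a has no other meaning here than positivity of this
  quadratic form in \<open>y\<close>.\<close>

lemma tr_pos_of_real_minus:
  assumes "bd b x" "b ^ 2 \<le> a" "y \<in> S"
  shows "\<tau> (y * (of_real a - x * star x) * star y) \<ge> 0"
proof -
  have x: "x \<in> S" using assms(1) by (rule bd_in)
  have "hnorm (y * x) ^ 2 \<le> (b * hnorm y) ^ 2"
    using bdD[OF assms(1,3)] x assms by (intro power_mono) auto
  also have "\<dots> \<le> a * hnorm y ^ 2" using assms by (simp add: power_mult_distrib mult_right_mono)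
  finally have "\<tau> (y * x * star (y * x)) \<le> a * \<tau> (y * star y)" using x assms by (simp add: hnorm_square)
  then show ?thesis by (simp add: algebra_simps of_real_def)
qed

text \<open>In operator terms, 0 \<le> s \<le> a for s = a - x x^*. In place of functional calculus
  there is the identity a^2 - s^2 = x (a - x^* x) x^* + a x x^*, whose summands are both positive.
  That the bound is a, and not a + b^2 as from the triangle inequality, is what keeps the
  logarithmic series convergent.\<close>

lemma bd_of_real_minus:
  assumes b: "bd b x" and ba: "b ^ 2 \<le> a"
  shows "bd a (of_real a - x * star x)"
  unfolding bd_def
proof (intro conjI ballI)
  have x: "x \<in> S" using b by (rule bd_in)
  have a: "a \<ge> 0" using ba by (meson order_trans zero_le_power2)
  show "of_real a - x * star x \<in> S" "0 \<le> a" using x a by auto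
  fix y assume y: "y \<in> S"
  let ?s = "of_real a - x * star x" and ?s' = "of_real a - star x * star (star x)"
  have 1: "\<tau> (y * x * ?s' * star (y * x)) \<ge> 0"
    by (rule tr_pos_of_real_minus[OF bd_star[OF b] ba]) (use x y in simp)
  have 2: "\<tau> (y * x * star (y * x)) \<ge> 0" by (rule tr_nonneg) (use x y in simp)
  have eq: "a ^ 2 * \<tau> (y * star y) - \<tau> ((y * ?s) * star (y * ?s))
     = \<tau> (y * x * ?s' * star (y * x)) + a * \<tau> (y * x * star (y * x))"
    by (simp add: algebra_simps of_real_def power2_eq_square)
  have "a * \<tau> (y * x * star (y * x)) \<ge> 0" using a 2 by simp
  then have "hnorm (y * ?s) ^ 2 \<le> (a * hnorm y) ^ 2"
    using eq 1 x y by (simp add: hnorm_square power_mult_distrib)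
  then show "hnorm (y * ?s) \<le> a * hnorm y"
    by (rule power2_le_imp_le) (use a y in simp)
qed

text \<open>The terms of the expansion of \<open>(s + f)\<^sup>n\<close> that are linear and quadratic in \<open>f\<close>
  (the latter polarised), and the remainder.\<close>

primrec expand1 :: "'a \<Rightarrow> 'a \<Rightarrow> nat \<Rightarrow> 'a" where
  "expand1 s f 0 = 0"
| "expand1 s f (Suc n) = s * expand1 s f n + f * s ^ n"

primrec expand2 :: "'a \<Rightarrow> 'a \<Rightarrow> 'a \<Rightarrow> nat \<Rightarrow> 'a" where
  "expand2 s f g 0 = 0"
| "expand2 s f g (Suc n) = s * expand2 s f g n + f * expand1 s g n"

primrec expand3 :: "'a \<Rightarrow> 'a \<Rightarrow> nat \<Rightarrow> 'a" where
  "expand3 s f 0 = 0"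
| "expand3 s f (Suc n) = (s + f) * expand3 s f n + f * expand2 s f f n"

lemma power_expand: "(s + f) ^ n = s ^ n + expand1 s f n + expand2 s f f n + expand3 s f n"
  by (induction n) (simp_all add: algebra_simps)

lemma expand1_in [simp]: "s \<in> S \<Longrightarrow> f \<in> S \<Longrightarrow> expand1 s f n \<in> S" by (induction n) auto
lemma expand2_in [simp]: "s \<in> S \<Longrightarrow> f \<in> S \<Longrightarrow> g \<in> S \<Longrightarrow> expand2 s f g n \<in> S" by (induction n) auto

lemma expand1_add: "expand1 s (f + g) n = expand1 s f n + expand1 s g n"
  by (induction n) (simp_all add: algebra_simps)
lemma expand2_add_left: "expand2 s (f + f') g n = expand2 s f g n + expand2 s f' g n"
  by (induction n) (simp_all add: algebra_simps)
lemma expand2_add_right: "expand2 s f (g + g') n = expand2 s f g n + expand2 s f g' n"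
  by (induction n) (simp_all add: algebra_simps expand1_add)

lemma bd_expand1:
  assumes "bd r s" "0 < r" "bd c f"
  shows "bd (real n * r ^ n * (c / r)) (expand1 s f n)"
proof (induction n)
  case 0
  show ?case by (simp add: bd_zero)
next
  case (Suc n)
  have "bd (r * (real n * r ^ n * (c / r)) + c * r ^ n) (s * expand1 s f n + f * s ^ n)"
    by (intro bd_add bd_mult bd_power Suc assms)
  also have "r * (real n * r ^ n * (c / r)) + c * r ^ n = real (Suc n) * r ^ Suc n * (c / r)"
    using assms(2) by (simp add: field_simps)
  finally show ?case by simp
qed

lemma bd_expand2:
  assumes "bd r s" "0 < r" "bd c f" "bd d g"
  shows "bd (real n ^ 2 * r ^ n * (c / r) * (d / r)) (expand2 s f g n)"
proof (induction n)
  case 0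
  show ?case by (simp add: bd_zero)
next
  case (Suc n)
  have cd: "0 \<le> c" "0 \<le> d" using assms by (auto dest: bd_nonneg)
  have "bd (r * (real n ^ 2 * r ^ n * (c / r) * (d / r)) + c * (real n * r ^ n * (d / r)))
      (s * expand2 s f g n + f * expand1 s g n)"
    by (intro bd_add bd_mult Suc assms bd_expand1)
  moreover have "r * (real n ^ 2 * r ^ n * (c / r) * (d / r)) + c * (real n * r ^ n * (d / r))
     = (real n ^ 2 + real n) * (r ^ Suc n * (c / r) * (d / r))"
    using assms(2) by (simp add: field_simps)
  moreover have "\<dots> \<le> real (Suc n) ^ 2 * (r ^ Suc n * (c / r) * (d / r))"
    using assms(2) cd by (intro mult_right_mono) (auto simp: power2_eq_square algebra_simps)
  ultimately show ?case by (auto intro: bd_mono simp: mult.assoc)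
qed

text \<open>The recursion keeps the factor \<open>s + f\<close> on the left, so a common bound
  \<open>r\<close> for \<open>s\<close> and \<open>s + f\<close> is enough. Multiplying the
  remainder out into words in s and f would cost a factor like (1 + c / r)^n instead.\<close>

lemma bd_expand3:
  assumes "bd r s" "bd r (s + f)" "0 < r" "bd c f"
  shows "bd (real n ^ 3 * r ^ n * (c / r) ^ 3) (expand3 s f n)"
proof (induction n)
  case 0
  show ?case by (simp add: bd_zero)
next
  case (Suc n)
  have cd: "0 \<le> c" using assms by (auto dest: bd_nonneg)
  have "bd (r * (real n ^ 3 * r ^ n * (c / r) ^ 3) + c * (real n ^ 2 * r ^ n * (c / r) * (c / r)))
      ((s + f) * expand3 s f n + f * expand2 s f f n)"
    by (intro bd_add[of _ "(s + f) * expand3 s f n"] bd_mult Suc assms bd_expand2)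
  moreover have "r * (real n ^ 3 * r ^ n * (c / r) ^ 3) + c * (real n ^ 2 * r ^ n * (c / r) * (c / r))
     = (real n ^ 3 + real n ^ 2) * (r ^ Suc n * (c / r) ^ 3)"
    using assms(3) by (simp add: field_simps power3_eq_cube)
  moreover have "\<dots> \<le> real (Suc n) ^ 3 * (r ^ Suc n * (c / r) ^ 3)"
    using assms(3) cd
    by (intro mult_right_mono) (auto simp: power2_eq_square power3_eq_cube algebra_simps)
  ultimately show ?case by (auto intro: bd_mono simp: mult.assoc)
qed

section \<open>Traces of the linear and quadratic terms\<close>

lemma tr_expand1:
  assumes "s \<in> S" "f \<in> S"
  shows "\<tau> (s ^ m * expand1 s f n) = real n * \<tau> (s ^ (m + n - 1) * f)"
proof (induction n arbitrary: m)
  case (Suc n)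
  have "\<tau> (s ^ m * expand1 s f (Suc n)) = \<tau> (s ^ Suc m * expand1 s f n) + \<tau> (s ^ m * f * s ^ n)"
    by (simp add: power_Suc2 distrib_left mult.assoc del: power_Suc)
  also have "\<tau> (s ^ m * f * s ^ n) = \<tau> (s ^ (m + n) * f)"
    using assms tr_commute[of "s ^ m * f" "s ^ n"]
    by (simp add: power_add[symmetric] mult.assoc[symmetric] add.commute)
  finally show ?case unfolding Suc.IH by (cases n) (simp_all add: algebra_simps)
qed simp

lemma expand1_eq_sum: "expand1 s f n = (\<Sum>j<n. s ^ j * f * s ^ (n - 1 - j))"
proof (induction n)
  case (Suc n)
  have "(\<Sum>j<Suc n. s ^ j * f * s ^ (Suc n - 1 - j)) = f * s ^ n + (\<Sum>j<n. s ^ Suc j * f * s ^ (n - Suc j))"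
    by (subst sum.lessThan_Suc_shift) simp
  also have "(\<Sum>j<n. s ^ Suc j * f * s ^ (n - Suc j)) = s * expand1 s f n"
    unfolding Suc.IH by (simp add: sum_distrib_left mult.assoc)
  finally show ?case by (simp add: add.commute)
qed simp

text \<open>The factor \<open>s ^ m\<close> is what the recursion accumulates in front. Cyclicity
  brings every word into the form s^i f s^j g, and n - 1 - j words share the same j.\<close>

lemma tr_expand2_aux:
  assumes "s \<in> S" "f \<in> S" "g \<in> S"
  shows "\<tau> (s ^ m * expand2 s f g n) = (\<Sum>j<n. real (n - 1 - j) * \<tau> (s ^ (m + n - 2 - j) * f * s ^ j * g))"
proof (induction n arbitrary: m)
  case (Suc n)
  have "\<tau> (s ^ m * expand2 s f g (Suc n)) = \<tau> (s ^ Suc m * expand2 s f g n) + \<tau> (s ^ m * f * expand1 s g n)"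
    by (simp add: power_Suc2 distrib_left mult.assoc del: power_Suc)
  also have "\<tau> (s ^ m * f * expand1 s g n) = (\<Sum>j<n. \<tau> (s ^ (m + n - 1 - j) * f * s ^ j * g))"
  proof -
    have "\<tau> (s ^ m * f * expand1 s g n) = (\<Sum>j<n. \<tau> (s ^ m * f * s ^ j * g * s ^ (n - 1 - j)))"
      by (simp add: expand1_eq_sum sum_distrib_left mult.assoc)
    also have "\<dots> = (\<Sum>j<n. \<tau> (s ^ (m + n - 1 - j) * f * s ^ j * g))"
    proof (intro sum.cong refl)
      fix j assume j: "j \<in> {..<n}"
      have "\<tau> (s ^ m * f * s ^ j * g * s ^ (n - 1 - j)) = \<tau> (s ^ (n - 1 - j) * s ^ m * f * s ^ j * g)"
        using assms tr_commute[of "s ^ m * f * s ^ j * g" "s ^ (n - 1 - j)"] by (simp add: mult.assoc)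
      also have "s ^ (n - 1 - j) * s ^ m = s ^ (m + n - 1 - j)"
        using j by (simp add: power_add[symmetric] add.commute)
      finally show "\<tau> (s ^ m * f * s ^ j * g * s ^ (n - 1 - j)) = \<tau> (s ^ (m + n - 1 - j) * f * s ^ j * g)" .
    qed
    finally show ?thesis .
  qed
  also have "\<tau> (s ^ Suc m * expand2 s f g n) + (\<Sum>j<n. \<tau> (s ^ (m + n - 1 - j) * f * s ^ j * g))
     = (\<Sum>j<n. real (n - j) * \<tau> (s ^ (m + n - 1 - j) * f * s ^ j * g))"
    unfolding Suc.IH sum.distrib[symmetric]
  proof (intro sum.cong refl)
    fix j assume "j \<in> {..<n}"
    then have "Suc m + n - 2 - j = m + n - 1 - j" "real (n - j) = real (n - 1 - j) + 1" by auto
    then show "real (n - 1 - j) * \<tau> (s ^ (Suc m + n - 2 - j) * f * s ^ j * g) + \<tau> (s ^ (m + n - 1 - j) * f * s ^ j * g)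
      = real (n - j) * \<tau> (s ^ (m + n - 1 - j) * f * s ^ j * g)" by (simp only:) (simp add: algebra_simps)
  qed
  finally show ?case by simp
qed simp

lemma tr_expand2:
  assumes "s \<in> S" "f \<in> S" "g \<in> S"
  shows "\<tau> (expand2 s f g (Suc (Suc k))) = (\<Sum>j\<le>k. real (Suc k - j) * \<tau> (s ^ (k - j) * f * s ^ j * g))"
  using tr_expand2_aux[OF assms, of 0 "Suc (Suc k)"] by (simp add: lessThan_Suc_atMost)

text \<open>The weight k + 1 - j from one order and j + 1 from the other add up to k + 2, the
  exponent. The logarithmic series divides by the exponent, so after symmetrisation no weights are
  left.\<close>

lemma tr_expand2_symmetrised:
  assumes "s \<in> S" "f \<in> S" "g \<in> S"
  shows "\<tau> (expand2 s f g (Suc (Suc k))) + \<tau> (expand2 s g f (Suc (Suc k)))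
      = real (Suc (Suc k)) * (\<Sum>j\<le>k. \<tau> (s ^ (k - j) * f * s ^ j * g))"
proof -
  have "\<tau> (expand2 s g f (Suc (Suc k))) = (\<Sum>j\<le>k. real (Suc k - j) * \<tau> (s ^ (k - j) * g * s ^ j * f))"
    by (rule tr_expand2) (use assms in auto)
  also have "\<dots> = (\<Sum>j\<le>k. real (Suc j) * \<tau> (s ^ j * g * s ^ (k - j) * f))"
    by (rule sum.reindex_bij_witness[of _ "\<lambda>j. k - j" "\<lambda>j. k - j"]) (auto simp: Suc_diff_le)
  also have "\<dots> = (\<Sum>j\<le>k. real (Suc j) * \<tau> (s ^ (k - j) * f * s ^ j * g))"
  proof (intro sum.cong refl)
    fix j
    have "\<tau> (s ^ j * g * (s ^ (k - j) * f)) = \<tau> (s ^ (k - j) * f * (s ^ j * g))"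
      by (rule tr_commute) (use assms in auto)
    then show "real (Suc j) * \<tau> (s ^ j * g * s ^ (k - j) * f) = real (Suc j) * \<tau> (s ^ (k - j) * f * s ^ j * g)"
      by (simp add: mult.assoc)
  qed
  finally have eq: "\<tau> (expand2 s g f (Suc (Suc k))) = (\<Sum>j\<le>k. real (Suc j) * \<tau> (s ^ (k - j) * f * s ^ j * g))" .
  show ?thesis
    unfolding tr_expand2[OF assms] eq sum_distrib_left sum.distrib[symmetric]
  proof (intro sum.cong refl)
    fix j assume "j \<in> {..k}"
    then have "real (Suc k - j) + real (Suc j) = real (Suc (Suc k))" by (simp add: of_nat_diff)
    then show "real (Suc k - j) * \<tau> (s ^ (k - j) * f * s ^ j * g) + real (Suc j) * \<tau> (s ^ (k - j) * f * s ^ j * g)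
        = real (Suc (Suc k)) * \<tau> (s ^ (k - j) * f * s ^ j * g)"
      by (simp only: distrib_right[symmetric])
  qed
qed

text \<open>With perturbation f + f^* on one side and twice the perturbation f on the other, the
  linear terms have equal trace and cancel in the second difference. The companion for squares
  cancels f f and f^* f^* likewise, so only the mixed terms survive.\<close>

lemma tr_expand1_star:
  assumes "s \<in> S" "f \<in> S" "star s = s"
  shows "\<tau> (expand1 s (star f) n) = \<tau> (expand1 s f n)"
proof -
  have "\<tau> (s ^ k * star f) = \<tau> (s ^ k * f)" for k
    using tr_star[of "s ^ k * star f"] tr_commute[of f "s ^ k"] assms by simp
  then show ?thesis using tr_expand1[of s f 0 n] tr_expand1[of s "star f" 0 n] assms by simp
qed

lemma tr_expand2_star:
  assumes "s \<in> S" "f \<in> S" "star s = s"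
  shows "\<tau> (expand2 s (star f) (star f) n) = \<tau> (expand2 s f f n)"
proof -
  have *: "\<tau> (s ^ i * star f * s ^ j * star f) = \<tau> (s ^ i * f * s ^ j * f)" for i j
    using tr_star[of "s ^ i * star f * s ^ j * star f"] tr_commute[of "f * s ^ j * f" "s ^ i"] assms
    by (simp add: mult.assoc)
  show ?thesis
    using tr_expand2_aux[of s f f 0 n] tr_expand2_aux[of s "star f" "star f" 0 n] assms by (simp add: *)
qed


text \<open>No square roots are available, so the terms with \<open>i\<close> and \<open>m - i\<close> both odd are not visibly
  nonnegative; each is dominated by the mean of its two neighbours.\<close>

lemma tr_power_sandwich_nonneg:
  assumes in_S: "s \<in> S" "t \<in> S" "e \<in> S" and sa: "star s = s" "star t = t"
    and pos: "\<And>y. y \<in> S \<Longrightarrow> \<tau> (y * s * star y) \<ge> 0" "\<And>y. y \<in> S \<Longrightarrow> \<tau> (y * t * star y) \<ge> 0"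
  shows "(\<Sum>i\<le>m. \<tau> (s ^ i * e * t ^ (m - i) * star e)) \<ge> 0"
proof -
  define c where "c i j = \<tau> (s ^ i * e * t ^ j * star e)" for i j
  have pow_pos: "\<tau> (y * r ^ j * star y) \<ge> 0"
    if r: "r \<in> S" "star r = r" and p: "\<And>y. y \<in> S \<Longrightarrow> \<tau> (y * r * star y) \<ge> 0" and y: "y \<in> S" for r y j
  proof (cases "even j")
    case True
    then obtain k where "j = k + k" by (metis even_two_times_div_two mult_2)
    then show ?thesis using tr_nonneg[of "y * r ^ k"] r y by (simp add: power_add mult.assoc)
  next
    case False
    then obtain k where "j = k + Suc k" by (metis odd_two_times_div_two_succ mult_2 add_Suc_right Suc_eq_plus1)
    then have "r ^ j = r ^ k * (r * r ^ k)" by (simp only: power_add power_Suc)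
    then show ?thesis using p[of "y * r ^ k"] r y by (simp add: mult.assoc)
  qed
  have even_left: "c (k + k) j \<ge> 0" for k j
  proof -
    have "c (k + k) j = \<tau> (s ^ k * (s ^ k * e * t ^ j * star e))" by (simp add: c_def power_add mult.assoc)
    also have "\<dots> = \<tau> ((s ^ k * e * t ^ j * star e) * s ^ k)" by (rule tr_commute) (use in_S in auto)
    also have "\<dots> = \<tau> ((s ^ k * e) * t ^ j * star (s ^ k * e))" by (simp add: sa mult.assoc)
    also have "\<dots> \<ge> 0" by (rule pow_pos) (use in_S sa pos in auto)
    finally show ?thesis .
  qed
  have even_right: "c i (k + k) \<ge> 0" for k i
  proof -
    have "c i (k + k) = \<tau> ((s ^ i * e * t ^ k) * (t ^ k * star e))" by (simp add: c_def power_add mult.assoc)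
    also have "\<dots> = \<tau> ((t ^ k * star e) * (s ^ i * e * t ^ k))" by (rule tr_commute) (use in_S in auto)
    also have "\<dots> = \<tau> ((t ^ k * star e) * s ^ i * star (t ^ k * star e))" by (simp add: sa mult.assoc)
    also have "\<dots> \<ge> 0" by (rule pow_pos) (use in_S sa pos in auto)
    finally show ?thesis .
  qed
  have both_odd: "2 * c (Suc (k + k)) (Suc (l + l)) + c (k + k) (Suc (Suc (l + l))) + c (Suc (Suc (k + k))) (l + l) \<ge> 0" for k l
  proof -
    define y where "y = s ^ k * e * t ^ l"
    have y: "y \<in> S" using in_S by (simp add: y_def)
    have odd_pow: "z ^ Suc (j + j) = z ^ j * z * z ^ j" and even_pow: "z ^ Suc (Suc (j + j)) = z ^ j * z * z * z ^ j"
      for z :: 'a and j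
      by (simp_all only: power_Suc2[symmetric] power_add[symmetric]) simp_all
    have move: "\<tau> (s ^ k * z) = \<tau> (z * s ^ k)" if "z \<in> S" for z by (rule tr_commute) (use in_S that in auto)
    have 1: "c (k + k) (Suc (Suc (l + l))) = \<tau> (y * t * t * star y)"
    proof -
      have "c (k + k) (Suc (Suc (l + l))) = \<tau> (s ^ k * (y * t * t * t ^ l * star e))"
        unfolding c_def even_pow by (simp add: y_def power_add mult.assoc)
      then show ?thesis using move[of "y * t * t * t ^ l * star e"] in_S y by (simp add: y_def sa mult.assoc)
    qed
    have 2: "c (Suc (Suc (k + k))) (l + l) = \<tau> (s * y * star y * s)"
    proof -
      have "c (Suc (Suc (k + k))) (l + l) = \<tau> (s ^ k * (s * (s * y * t ^ l * star e)))"
        unfolding c_def even_pow by (simp add: y_def power_add mult.assoc)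
      also have "\<dots> = \<tau> (s * (s * y * t ^ l * star e * s ^ k))"
        using move[of "s * (s * y * t ^ l * star e)"] in_S y by (simp add: mult.assoc)
      also have "\<dots> = \<tau> (s * y * star y * s)"
        using tr_commute[of s "s * y * t ^ l * star e * s ^ k"] in_S y by (simp add: y_def sa mult.assoc)
      finally show ?thesis .
    qed
    have 3: "c (Suc (k + k)) (Suc (l + l)) = \<tau> (s * y * t * star y)"
    proof -
      have "c (Suc (k + k)) (Suc (l + l)) = \<tau> (s ^ k * (s * y * t * t ^ l * star e))"
        unfolding c_def odd_pow by (simp add: y_def mult.assoc)
      then show ?thesis using move[of "s * y * t * t ^ l * star e"] in_S y by (simp add: y_def sa mult.assoc)
    qed
    have 4: "\<tau> (y * t * star y * s) = \<tau> (s * y * t * star y)"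
      using tr_commute[of s "y * t * star y"] in_S y by (simp add: mult.assoc)
    have "0 \<le> \<tau> ((y * t + s * y) * star (y * t + s * y))" by (rule tr_nonneg) (use in_S y in auto)
    also have "\<dots> = \<tau> (y * t * t * star y) + \<tau> (y * t * star y * s) + \<tau> (s * y * t * star y) + \<tau> (s * y * star y * s)"
      by (simp add: algebra_simps sa)
    finally show ?thesis using 1 2 3 4 by simp
  qed
  show ?thesis
  proof (cases "even m")
    case False
    \<comment> \<open>For odd m one of i and m - i is even, so each term is nonnegative by
      itself.\<close>
    have "c i (m - i) \<ge> 0" if "i \<le> m" for i
    proof (cases "even i")
      case True
      then obtain k where "i = k + k" by (metis even_two_times_div_two mult_2)
      then show ?thesis using even_left by simp
    next
      case odd: False
      then have "even (m - i)" using False that by simp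
      then obtain k where "m - i = k + k" by (metis even_two_times_div_two mult_2)
      then show ?thesis using even_right by simp
    qed
    then show ?thesis unfolding c_def by (intro sum_nonneg) auto
  next
    case True
    then obtain n where m: "m = n + n" by (metis even_two_times_div_two mult_2)
    \<comment> \<open>Every even term is spent in halves on its two odd neighbours. The end terms on
      the right keep their unspent halves, which is what the next induction step draws on.\<close>
    have "2 * (\<Sum>i\<le>k + k. c i (m - i)) \<ge> c 0 m + c (k + k) (m - (k + k))" if "k \<le> n" for k
      using that
    proof (induction k)
      case (Suc k)
      have k: "m - Suc (k + k) = Suc ((n - Suc k) + (n - Suc k))" "m - (k + k) = Suc (Suc ((n - Suc k) + (n - Suc k)))"
        "m - Suc (Suc (k + k)) = (n - Suc k) + (n - Suc k)"
        using Suc.prems m by auto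
      have "2 * (\<Sum>i\<le>Suc k + Suc k. c i (m - i)) = 2 * (\<Sum>i\<le>k + k. c i (m - i))
          + 2 * c (Suc (k + k)) (m - Suc (k + k)) + 2 * c (Suc (Suc (k + k))) (m - Suc (Suc (k + k)))"
        by simp
      moreover have "2 * c (Suc (k + k)) (m - Suc (k + k)) + c (k + k) (m - (k + k))
          + c (Suc (Suc (k + k))) (m - Suc (Suc (k + k))) \<ge> 0"
        unfolding k by (rule both_odd)
      moreover have "c 0 m + c (k + k) (m - (k + k)) \<le> 2 * (\<Sum>i\<le>k + k. c i (m - i))"
        using Suc by simp
      ultimately show ?case by simp
    qed simp
    from this[of n] show ?thesis
      using even_left[of 0 m] even_left[of n 0] even_right[of 0 n] m
      by (simp add: c_def)
  qed
qed

text \<open>The three bases are s, s + F and s + G + H, with F of first order in E, G = F + F^* and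
  H of second order. Once the linear terms cancel, the second-order part is n (a D(n - 2) - D(n -
  1)), where D is nonnegative by \<open>tr_power_sandwich_nonneg\<close>. The slack a + e \<le> r is
  for s + F, which need not be self-adjoint and is bounded by the triangle inequality only.\<close>

lemma tr_power_second_difference:
  fixes A E :: 'a and a :: real
  assumes A: "bd b A" and E: "bd e E" and A1: "bd b (A + E)"
    and ba: "b ^ 2 \<le> a" and b1: "b \<le> 1" and e1: "e \<le> 1" and r: "a + e \<le> r" "r \<le> 1" "0 < r"
  defines "s \<equiv> of_real a - A * star A" and "t \<equiv> of_real a - star A * A"
  defines "D \<equiv> \<lambda>m. \<Sum>i\<le>m. \<tau> (s ^ i * E * t ^ (m - i) * star E)"
  shows "\<tau> ((of_real a - (A + E) * star (A + E)) ^ n) + \<tau> (s ^ n) - 2 * \<tau> ((of_real a - (A + E) * star A) ^ n)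
     \<le> - real n * (D (n - 1) - (if n \<ge> 2 then a * D (n - 2) else 0)) + real n ^ 3 * r ^ n * (34 * \<tau> 1 * e ^ 3 / r ^ 3)"
proof -
  have in_S: "A \<in> S" "E \<in> S" using A E by (auto dest: bd_in)
  have a0: "a \<ge> 0" using ba by (meson order_trans zero_le_power2)
  have b0: "b \<ge> 0" and e0: "e \<ge> 0" using A E by (auto dest: bd_nonneg)
  have s_in: "s \<in> S" and t_in: "t \<in> S" using in_S by (auto simp: s_def t_def)
  have s_sa: "star s = s" by (simp add: s_def)
  define F where "F = - (E * star A)"
  define G where "G = F + star F"
  define H where "H = - (E * star E)"
  have FGH: "F \<in> S" "G \<in> S" "H \<in> S" using in_S by (auto simp: F_def G_def H_def)
  have S1: "of_real a - (A + E) * star (A + E) = s + (G + H)"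
    by (simp add: s_def F_def G_def H_def algebra_simps)
  have Y: "of_real a - (A + E) * star A = s + F"
    by (simp add: s_def F_def algebra_simps)
  have bs: "bd r s" unfolding s_def using bd_of_real_minus[OF A ba] r e0 by (auto intro: bd_mono)
  have bF: "bd e F"
  proof -
    have "bd (e * b) F" unfolding F_def by (intro bd_uminus bd_mult E bd_star A)
    then show ?thesis by (rule bd_mono) (use b1 e0 mult_left_le in auto)
  qed
  have bG: "bd (2 * e) G" unfolding G_def using bd_add[OF bF bd_star[OF bF]] by simp
  have bH: "bd (e * e) H" unfolding H_def by (intro bd_uminus bd_mult E bd_star)
  have bH': "bd e H" using bH by (rule bd_mono) (use e0 e1 mult_left_le in auto)
  have bGH: "bd (3 * e) (G + H)" using bd_add[OF bG bH'] by simp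
  have bS1: "bd r (s + (G + H))"
    unfolding S1[symmetric] using bd_of_real_minus[OF A1 ba] r e0 by (auto intro: bd_mono)
  have bY: "bd r (s + F)"
  proof -
    have "bd (a + e) (s + F)" unfolding s_def by (intro bd_add bF bd_of_real_minus[OF A ba])
    then show ?thesis using r(1) by (rule bd_mono)
  qed
  \<comment> \<open>All terms of third order in \<open>e\<close>: the pairings that involve H, and
    the cubic remainders. Their constants 3, 2, 27 and twice 1 add up to 34.\<close>
  define R where "R = \<tau> (expand2 s H (G + H) n) + \<tau> (expand2 s G H n) + \<tau> (expand3 s (G + H) n) - 2 * \<tau> (expand3 s F n)"
  have R: "R \<le> real n ^ 3 * r ^ n * (34 * \<tau> 1 * e ^ 3 / r ^ 3)"
  proof -
    define q where "q = real n ^ 3 * r ^ n * (\<tau> 1 * e ^ 3 / r ^ 3)"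
    have q0: "q \<ge> 0" unfolding q_def using e0 r tr_one_nonneg by simp
    have n23: "real n ^ 2 * r ^ n * (\<tau> 1 * e ^ 3 / r ^ 2) \<le> q"
    proof -
      have "real n ^ 2 \<le> real n ^ 3" by (cases n) (auto intro!: power_increasing)
      moreover have "\<tau> 1 * e ^ 3 / r ^ 2 \<le> \<tau> 1 * e ^ 3 / r ^ 3"
        using r e0 tr_one_nonneg by (intro divide_left_mono power_decreasing) auto
      ultimately show ?thesis unfolding q_def using r e0 tr_one_nonneg by (intro mult_mono) auto
    qed
    have 1: "\<tau> (expand2 s H (G + H) n) \<le> 3 * q"
    proof -
      have "\<bar>\<tau> (expand2 s H (G + H) n)\<bar> \<le> (real n ^ 2 * r ^ n * (e * e / r) * (3 * e / r)) * \<tau> 1"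
        by (intro bd_tr bd_expand2 bs bH bGH r)
      also have "\<dots> = 3 * (real n ^ 2 * r ^ n * (\<tau> 1 * e ^ 3 / r ^ 2))"
        by (simp add: power2_eq_square power3_eq_cube)
      finally show ?thesis using n23 by linarith
    qed
    have 2: "\<tau> (expand2 s G H n) \<le> 2 * q"
    proof -
      have "\<bar>\<tau> (expand2 s G H n)\<bar> \<le> (real n ^ 2 * r ^ n * (2 * e / r) * (e * e / r)) * \<tau> 1"
        by (intro bd_tr bd_expand2 bs bH bG r)
      also have "\<dots> = 2 * (real n ^ 2 * r ^ n * (\<tau> 1 * e ^ 3 / r ^ 2))"
        by (simp add: power2_eq_square power3_eq_cube)
      finally show ?thesis using n23 by linarith
    qed
    have 3: "\<tau> (expand3 s (G + H) n) \<le> 27 * q"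
    proof -
      have "\<bar>\<tau> (expand3 s (G + H) n)\<bar> \<le> (real n ^ 3 * r ^ n * (3 * e / r) ^ 3) * \<tau> 1"
        by (intro bd_tr bd_expand3 bs bS1 bGH r)
      also have "\<dots> = 27 * q" by (simp add: q_def power_mult_distrib power_divide)
      finally show ?thesis by linarith
    qed
    have 4: "- \<tau> (expand3 s F n) \<le> q"
    proof -
      have "\<bar>\<tau> (expand3 s F n)\<bar> \<le> (real n ^ 3 * r ^ n * (e / r) ^ 3) * \<tau> 1"
        by (intro bd_tr bd_expand3 bs bY bF r)
      also have "\<dots> = q" by (simp add: q_def power_divide)
      finally show ?thesis by linarith
    qed
    have "R \<le> 34 * q" unfolding R_def using 1 2 3 4 by linarith
    then show ?thesis by (simp add: q_def mult_ac)
  qed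
  have split: "\<tau> ((s + (G + H)) ^ n) + \<tau> (s ^ n) - 2 * \<tau> ((s + F) ^ n)
     = \<tau> (expand1 s H n) + (\<tau> (expand2 s F (star F) n) + \<tau> (expand2 s (star F) F n)) + R"
    unfolding power_expand[of s "G + H"] power_expand[of s F] R_def
    using tr_expand1_star[OF s_in FGH(1) s_sa, of n] tr_expand2_star[OF s_in FGH(1) s_sa, of n]
    by (simp add: G_def expand1_add expand2_add_left expand2_add_right)
  \<comment> \<open>\<open>star A\<close> intertwines \<open>s\<close> with \<open>t\<close>, so the
    powers of \<open>s\<close> between the two factors F become powers of \<open>t\<close>; then
    \<open>star A * A\<close> = a - t produces the difference.\<close>
  have c: "\<tau> (s ^ i * F * s ^ j * star F) = a * \<tau> (s ^ i * E * t ^ j * star E) - \<tau> (s ^ i * E * t ^ Suc j * star E)" for i j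
  proof -
    have comm: "star A * s ^ j = t ^ j * star A"
    proof (induction j)
      case (Suc j)
      have "star A * s = t * star A" by (simp add: s_def t_def algebra_simps of_real_def)
      then have "star A * s ^ Suc j = t * (star A * s ^ j)" by (simp add: mult.assoc[symmetric])
      then show ?case using Suc by (simp add: mult.assoc)
    qed simp
    have AA: "star A * A = of_real a - t" by (simp add: t_def)
    have "s ^ i * F * s ^ j * star F = s ^ i * E * (star A * s ^ j) * A * star E"
      by (simp add: F_def mult.assoc)
    also have "\<dots> = s ^ i * E * t ^ j * (star A * A) * star E" by (simp add: comm mult.assoc)
    also have "\<dots> = a *\<^sub>R (s ^ i * E * t ^ j * star E) - s ^ i * E * t ^ Suc j * star E"
      by (simp add: AA algebra_simps of_real_def power_commutes)
    finally show ?thesis by simp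
  qed
  have main: "\<tau> (expand1 s H n) + (\<tau> (expand2 s F (star F) n) + \<tau> (expand2 s (star F) F n))
     = - real n * (D (n - 1) - (if n \<ge> 2 then a * D (n - 2) else 0))"
  proof -
    have H1: "\<tau> (expand1 s H n) = - real n * \<tau> (s ^ (n - 1) * E * star E)"
      using tr_expand1[OF s_in FGH(3), of 0 n] by (simp add: H_def mult.assoc)
    consider "n = 0" | "n = 1" | k where "n = Suc (Suc k)" by (metis One_nat_def not0_implies_Suc)
    then show ?thesis
    proof cases
      case 3
      have "\<tau> (expand2 s F (star F) n) + \<tau> (expand2 s (star F) F n)
        = real n * (\<Sum>j\<le>k. \<tau> (s ^ (k - j) * F * s ^ j * star F))"
        unfolding 3 by (rule tr_expand2_symmetrised) (use s_in FGH in auto)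
      also have "(\<Sum>j\<le>k. \<tau> (s ^ (k - j) * F * s ^ j * star F))
         = a * (\<Sum>j\<le>k. \<tau> (s ^ (k - j) * E * t ^ j * star E)) - (\<Sum>j\<le>k. \<tau> (s ^ (k - j) * E * t ^ Suc j * star E))"
        by (simp only: c sum_subtractf sum_distrib_left)
      also have "(\<Sum>j\<le>k. \<tau> (s ^ (k - j) * E * t ^ j * star E)) = D k"
        unfolding D_def by (rule sum.reindex_bij_witness[of _ "\<lambda>j. k - j" "\<lambda>j. k - j"]) auto
      also have "(\<Sum>j\<le>k. \<tau> (s ^ (k - j) * E * t ^ Suc j * star E)) = (\<Sum>i\<le>k. \<tau> (s ^ i * E * t ^ (Suc k - i) * star E))"
        by (rule sum.reindex_bij_witness[of _ "\<lambda>j. k - j" "\<lambda>j. k - j"]) (auto simp: Suc_diff_le)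
      \<comment> \<open>The sum lacks the summand i = k + 1 of \<open>D (Suc k)\<close>. The
        contribution of H, computed in \<open>H1\<close>, supplies exactly this summand.\<close>
      also have "\<dots> = D (Suc k) - \<tau> (s ^ Suc k * E * star E)" unfolding D_def by simp
      finally have eq: "\<tau> (expand2 s F (star F) n) + \<tau> (expand2 s (star F) F n)
         = real n * (a * D k - (D (Suc k) - \<tau> (s ^ Suc k * E * star E)))" .
      have "n - 1 = Suc k" "n - 2 = k" "n \<ge> 2" using 3 by auto
      then show ?thesis unfolding H1 eq by (simp only: if_True) (simp add: algebra_simps)
    qed (simp_all add: H1 D_def H_def)
  qed
  show ?thesis unfolding S1 Y split main using R by simp
qed

text \<open>After division by n the second-order terms are a D(n - 2) - D(n - 1). They telescope,
  and as a \<le> 1 and D \<ge> 0 their sum is at most 0, so only the cubic error is left. This is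
  the infinitesimal determinant inequality, stated for partial sums of the series of -ln.\<close>

lemma sum_tr_power_second_difference:
  fixes A E :: 'a and a :: real
  assumes A: "bd b A" and E: "bd e E" and A1: "bd b (A + E)"
    and ba: "b ^ 2 \<le> a" and b1: "b \<le> 1" and e1: "e \<le> 1" and r: "a + e \<le> r" "r \<le> 1" "0 < r"
  shows "(\<Sum>n=1..N. (\<tau> ((of_real a - (A + E) * star (A + E)) ^ n) + \<tau> ((of_real a - A * star A) ^ n)
              - 2 * \<tau> ((of_real a - (A + E) * star A) ^ n)) / real n)
     \<le> (\<Sum>n=1..N. real n ^ 2 * r ^ n) * (34 * \<tau> 1 / r ^ 3) * e ^ 3"
proof -
  have in_S: "A \<in> S" "E \<in> S" using A E by (auto dest: bd_in)
  have a1: "a \<le> 1" using r bd_nonneg[OF E] by simp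
  define D where "D m = (\<Sum>i\<le>m. \<tau> ((of_real a - A * star A) ^ i * E * (of_real a - star A * A) ^ (m - i) * star E))" for m
  have D0: "D m \<ge> 0" for m
    unfolding D_def
  proof (rule tr_power_sandwich_nonneg)
    show "\<tau> (y * (of_real a - star A * A) * star y) \<ge> 0" if "y \<in> S" for y
      using tr_pos_of_real_minus[OF bd_star[OF A] ba that] by simp
  qed (use in_S tr_pos_of_real_minus[OF A ba] in auto)
  have tele: "(\<Sum>n=1..N. D (n - 1) - (if n \<ge> 2 then a * D (n - 2) else 0)) \<ge> (if N = 0 then 0 else D (N - 1))"
  proof (induction N)
    case (Suc N)
    have "a * D (N - 1) \<le> D (N - 1)" using mult_right_mono[OF a1 D0[of "N - 1"]] by simp
    then show ?case using Suc D0 by (auto simp: numeral_2_eq_2 Suc_le_eq split: if_splits)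
  qed simp
  have "(\<Sum>n=1..N. (\<tau> ((of_real a - (A + E) * star (A + E)) ^ n) + \<tau> ((of_real a - A * star A) ^ n)
              - 2 * \<tau> ((of_real a - (A + E) * star A) ^ n)) / real n)
     \<le> (\<Sum>n=1..N. - (D (n - 1) - (if n \<ge> 2 then a * D (n - 2) else 0)) + real n ^ 2 * r ^ n * (34 * \<tau> 1 * e ^ 3 / r ^ 3))"
  proof (rule sum_mono)
    fix n assume "n \<in> {1..N}"
    then have n: "real n > 0" by simp
    have "real n ^ 3 = real n * real n ^ 2" by (simp add: power3_eq_cube power2_eq_square)
    then have eq: "- real n * x + real n ^ 3 * r ^ n * y = real n * (- x + real n ^ 2 * r ^ n * y)" for x y
      by (simp add: algebra_simps)
    show "(\<tau> ((of_real a - (A + E) * star (A + E)) ^ n) + \<tau> ((of_real a - A * star A) ^ n)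
              - 2 * \<tau> ((of_real a - (A + E) * star A) ^ n)) / real n
      \<le> - (D (n - 1) - (if n \<ge> 2 then a * D (n - 2) else 0)) + real n ^ 2 * r ^ n * (34 * \<tau> 1 * e ^ 3 / r ^ 3)"
      using tr_power_second_difference[OF assms, of n] n
      unfolding D_def[symmetric] eq by (simp add: pos_divide_le_eq mult.commute)
  qed
  also have "\<dots> = - (\<Sum>n=1..N. D (n - 1) - (if n \<ge> 2 then a * D (n - 2) else 0))
      + (\<Sum>n=1..N. real n ^ 2 * r ^ n * (34 * \<tau> 1 * e ^ 3 / r ^ 3))"
    by (simp only: sum.distrib sum_negf)
  also have "\<dots> \<le> (\<Sum>n=1..N. real n ^ 2 * r ^ n * (34 * \<tau> 1 * e ^ 3 / r ^ 3))"
    using tele D0[of "N - 1"] by (auto split: if_splits)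
  also have "\<dots> = (\<Sum>n=1..N. real n ^ 2 * r ^ n) * (34 * \<tau> 1 * e ^ 3 / r ^ 3)"
    by (rule sum_distrib_right[symmetric])
  finally show ?thesis by (simp add: mult_ac)
qed

lemma tr_power_diff_le:
  assumes "bd r s" "bd r (s + f)" "0 < r" "bd c f"
  shows "\<bar>\<tau> ((s + f) ^ n) - \<tau> (s ^ n)\<bar> \<le> real n * r ^ n * (c / r) * \<tau> 1"
proof -
  have "bd (real n * r ^ n * (c / r)) ((s + f) ^ n - s ^ n)"
  proof (induction n)
    case 0
    show ?case by (simp add: bd_zero)
  next
    case (Suc n)
    have "bd (r * (real n * r ^ n * (c / r)) + c * r ^ n) ((s + f) * ((s + f) ^ n - s ^ n) + f * s ^ n)"
      by (intro bd_add[of _ "(s + f) * _"] bd_mult bd_power Suc assms)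
    also have "r * (real n * r ^ n * (c / r)) + c * r ^ n = real (Suc n) * r ^ Suc n * (c / r)"
      using assms(3) by (simp add: field_simps)
    finally show ?case by (simp add: algebra_simps)
  qed
  from bd_tr[OF this] show ?thesis by simp
qed


text \<open>The positivity that the moment problem asks for. Halves of the powers move to the two
  sides as y and y^*, leaving exponents 0 and 1 only. The one product without an evident sign, u v
  with v = 1 - u, needs no square root: since u + v = 1, it equals u v u + v u v.\<close>

lemma tr_power_one_minus_power_nonneg:
  assumes x: "bd b x" and b: "b ^ 2 \<le> 1"
  defines "u \<equiv> x * star x"
  shows "\<tau> (u ^ k * (1 - u) ^ l) \<ge> 0"
proof -
  define v where "v = 1 - u"
  have xS: "x \<in> S" using x by (rule bd_in)
  have uv_in: "u \<in> S" "v \<in> S" using xS by (auto simp: u_def v_def)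
  have sa: "star u = u" "star v = v" by (simp_all add: u_def v_def)
  have comm: "u * v = v * u" by (simp add: v_def algebra_simps)
  have pu: "\<tau> (y * u * star y) \<ge> 0" if "y \<in> S" for y
    using tr_nonneg[of "y * x"] xS that by (simp add: u_def mult.assoc)
  have pv: "\<tau> (y * v * star y) \<ge> 0" if "y \<in> S" for y
    using tr_pos_of_real_minus[OF x b that] by (simp add: v_def u_def)
  have puv: "\<tau> (y * (u * v) * star y) \<ge> 0" if "y \<in> S" for y
  proof -
    have "u * v = u * v * (u + v)" by (simp add: v_def)
    also have "\<dots> = u * v * u + v * u * v" by (simp add: distrib_left comm)
    finally have eq: "u * v = u * v * u + v * u * v" .
    have "y * (u * v) * star y = y * (u * v * u + v * u * v) * star y"
      by (rule arg_cong[where f="\<lambda>z. y * z * star y", OF eq])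
    also have "\<dots> = (y * u) * v * star (y * u) + (y * v) * u * star (y * v)"
      by (simp add: sa distrib_left distrib_right mult.assoc)
    finally show ?thesis using pv[of "y * u"] pu[of "y * v"] that uv_in by simp
  qed
  define i j where "i = k div 2" and "j = l div 2"
  define y where "y = u ^ i * v ^ j"
  have y: "y \<in> S" using uv_in by (simp add: y_def)
  have uv_pow: "u ^ m * v ^ n = v ^ n * u ^ m" for m n
    by (metis comm power_commuting_commutes)
  have ysa: "star y = y" by (simp add: y_def sa uv_pow)
  have split: "u ^ k * v ^ l = y * (u ^ (k mod 2) * v ^ (l mod 2)) * star y"
  proof -
    have "u ^ k = u ^ i * u ^ (k mod 2) * u ^ i" "v ^ l = v ^ j * v ^ (l mod 2) * v ^ j"
      unfolding i_def j_def power_add[symmetric] by (rule arg_cong[where f="power _"], presburger)+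
    then have "u ^ k * v ^ l = u ^ i * (u ^ (k mod 2 + i) * v ^ j) * v ^ (l mod 2) * v ^ j"
      by (simp add: power_add mult.assoc)
    also have "\<dots> = u ^ i * v ^ j * u ^ (k mod 2) * (u ^ i * v ^ (l mod 2)) * v ^ j"
      unfolding uv_pow[of "k mod 2 + i" j] by (simp add: power_add mult.assoc)
    also have "\<dots> = y * (u ^ (k mod 2) * v ^ (l mod 2)) * y"
      unfolding uv_pow[of i "l mod 2"] by (simp add: y_def mult.assoc)
    finally show ?thesis by (simp add: ysa)
  qed
  have "k mod 2 = 0 \<or> k mod 2 = 1" "l mod 2 = 0 \<or> l mod 2 = 1" by auto
  then have "\<tau> (y * (u ^ (k mod 2) * v ^ (l mod 2)) * star y) \<ge> 0"
    using tr_nonneg[OF y] pu[OF y] pv[OF y] puv[OF y] by auto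
  then have "\<tau> (u ^ k * v ^ l) \<ge> 0" by (simp only: split)
  then show ?thesis by (simp only: v_def)
qed

section \<open>Spectral measures characterised by moments\<close>

definition is_spectral :: "real measure \<Rightarrow> 'a \<Rightarrow> bool" where
  "is_spectral \<mu> x \<longleftrightarrow> sets \<mu> = sets borel \<and> finite_measure \<mu> \<and> (\<exists>C. AE t in \<mu>. t \<in> {0..C})
     \<and> (\<forall>k. (\<integral>t. t ^ k \<partial>\<mu>) = \<tau> ((x * star x) ^ k))"

lemma is_spectral_unique: "is_spectral \<mu> x \<Longrightarrow> is_spectral \<nu> x \<Longrightarrow> \<mu> = \<nu>"
  unfolding is_spectral_def by (elim conjE exE, rule bounded_measure_eqI_moments) auto

text \<open>Dividing x x^* by C and the trace by \<open>\<tau> 1\<close> produces a Hausdorff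
  problem on [0, 1]; the solution is then stretched by C and given the mass
  \<open>\<tau> 1\<close>.\<close>

lemma ex_is_spectral:
  assumes x: "bd b x" and b: "b ^ 2 \<le> C" "0 < C"
  shows "\<exists>\<mu>. is_spectral \<mu> x \<and> (AE t in \<mu>. t \<in> {0..C})"
proof (cases "\<tau> 1 = 0")
  \<comment> \<open>The trace cannot be normalised here, but all moments vanish and the null measure
    has them. Matrices of size 0 are of this kind.\<close>
  case True
  have xS: "x \<in> S" using x by (rule bd_in)
  have "\<tau> ((x * star x) ^ k) = 0" for k
    using bd_tr[OF bd_power[OF bd_mult[OF x bd_star[OF x]], of k]] True by simp
  moreover have ae: "AE t in null_measure (borel :: real measure). P t" for P
    by (rule AE_I[where N=UNIV]) auto
  moreover have "(\<integral>t. t ^ k \<partial>null_measure borel) = (0::real)" for k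
    by (rule integral_eq_zero_AE) (rule ae)
  moreover have "finite_measure (null_measure (borel :: real measure))" by (rule finite_measureI) simp
  ultimately show ?thesis
    unfolding is_spectral_def by (intro exI[of _ "null_measure borel"]) auto
next
  case False
  then have t1: "\<tau> 1 > 0" using tr_one_nonneg by simp
  define x' where "x' = (1 / sqrt C) *\<^sub>R x"
  have x': "bd (b / sqrt C) x'" using bd_scaleR[OF x, of "1 / sqrt C"] b by (simp add: x'_def)
  have b': "(b / sqrt C) ^ 2 \<le> 1" using b by (simp add: power_divide)
  define Z where "Z = x' * star x'"
  have Z: "Z = (1 / C) *\<^sub>R (x * star x)" using b by (simp add: Z_def x'_def)
  interpret hausdorff_moments "\<lambda>k l. \<tau> (Z ^ k * (1 - Z) ^ l) / \<tau> 1"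
  proof
    show "\<tau> (Z ^ k * (1 - Z) ^ l) / \<tau> 1 \<ge> 0" for k l
      using tr_power_one_minus_power_nonneg[OF x' b'] t1 by (simp add: Z_def)
    have "Z ^ k * (1 - Z) ^ l = Z ^ Suc k * (1 - Z) ^ l + Z ^ k * (1 - Z) ^ Suc l" for k l
    proof -
      have "Z ^ k * (1 - Z) ^ l = Z ^ k * (Z + (1 - Z)) * (1 - Z) ^ l" by simp
      also have "\<dots> = Z ^ k * Z * (1 - Z) ^ l + Z ^ k * ((1 - Z) * (1 - Z) ^ l)"
        by (simp only: distrib_left distrib_right mult.assoc)
      finally show ?thesis by (simp only: power_Suc2[of Z k] power_Suc[of "1 - Z" l])
    qed
    then show "\<tau> (Z ^ k * (1 - Z) ^ l) / \<tau> 1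
       = \<tau> (Z ^ Suc k * (1 - Z) ^ l) / \<tau> 1 + \<tau> (Z ^ k * (1 - Z) ^ Suc l) / \<tau> 1" for k l
      by (metis add_divide_distrib tr_add)
  qed
  obtain M :: "real measure" where M: "prob_space M" and sM [measurable_cong, simp]: "sets M = sets borel"
    and suppM: "AE t in M. t \<in> {0..1}" and mom: "\<And>k. (\<integral>t. t ^ k \<partial>M) = \<tau> (Z ^ k * (1 - Z) ^ 0) / \<tau> 1"
    using ex_prob_measure t1 by auto
  interpret M: prob_space M by (rule M)
  define N where "N = distr M borel (\<lambda>t. C * t)"
  interpret N: prob_space N unfolding N_def by (rule M.prob_space_distr) simp
  have sN [measurable_cong, simp]: "sets N = sets borel" by (simp add: N_def)
  define \<mu> where "\<mu> = density N (\<lambda>_. ennreal (\<tau> 1))"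
  have suppN: "AE t in N. t \<in> {0..C}"
    unfolding N_def
    by (subst AE_distr_iff, simp, simp, rule eventually_mono[OF suppM]) (use b in \<open>auto simp: mult_left_le\<close>)
  have supp: "AE t in \<mu>. t \<in> {0..C}"
    unfolding \<mu>_def by (subst AE_density, simp, rule eventually_mono[OF suppN]) simp
  have "emeasure \<mu> (space \<mu>) = ennreal (\<tau> 1) * emeasure N (space N)"
    unfolding \<mu>_def space_density by (rule emeasure_density_const[OF sets.top])
  then have "finite_measure \<mu>" by (intro finite_measureI) (simp add: N.emeasure_space_1)
  moreover have "(\<integral>t. t ^ k \<partial>\<mu>) = \<tau> ((x * star x) ^ k)" for k
  proof -
    have "(\<integral>t. t ^ k \<partial>\<mu>) = \<tau> 1 * (\<integral>t. t ^ k \<partial>N)"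
      unfolding \<mu>_def by (subst integral_density) (use t1 in auto)
    also have "(\<integral>t. t ^ k \<partial>N) = (\<integral>t. (C * t) ^ k \<partial>M)"
      unfolding N_def by (subst integral_distr) auto
    also have "\<dots> = C ^ k * (\<tau> (Z ^ k) / \<tau> 1)" by (simp add: power_mult_distrib mom)
    also have "\<tau> 1 * (C ^ k * (\<tau> (Z ^ k) / \<tau> 1)) = C ^ k * \<tau> (Z ^ k)" using t1 by simp
    also have "Z ^ k = (1 / C) ^ k *\<^sub>R (x * star x) ^ k" unfolding Z by (rule power_scaleR)
    finally show ?thesis using b by (simp add: power_divide)
  qed
  ultimately show ?thesis
    unfolding is_spectral_def using supp by (intro exI[of _ \<mu>]) (auto simp: \<mu>_def)
qed

lemma is_spectral_AE:
  assumes "is_spectral \<mu> x" "bd b x" "b ^ 2 \<le> C" "0 < C"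
  shows "AE t in \<mu>. t \<in> {0..C}"
  using ex_is_spectral[OF assms(2-4)] is_spectral_unique[OF assms(1)] by blast

text \<open>The second factor serves the induction, in which multiplying out one factor of the first
  power raises \<open>m\<close>; later uses have m = 0 and m = 1.\<close>

lemma is_spectral_polynomial:
  assumes sp: "is_spectral \<mu> x"
  shows "\<tau> ((of_real \<alpha> + \<beta> *\<^sub>R (x * star x)) ^ n * (x * star x) ^ m) = (\<integral>t. (\<alpha> + \<beta> * t) ^ n * t ^ m \<partial>\<mu>)"
proof (induction n arbitrary: m)
  case 0
  then show ?case using sp by (simp add: is_spectral_def)
next
  case (Suc n)
  let ?X = "x * star x" and ?Y = "of_real \<alpha> + \<beta> *\<^sub>R (x * star x)"
  obtain C where C: "sets \<mu> = sets borel" "finite_measure \<mu>" "AE t in \<mu>. t \<in> {0..C}"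
    using sp by (auto simp: is_spectral_def)
  have int: "integrable \<mu> (\<lambda>t. (\<alpha> + \<beta> * t) ^ n * t ^ m)" for m
    by (rule integrable_continuous_bounded_support[OF C(2,1,3)]) (intro continuous_intros)
  have "?Y ^ Suc n * ?X ^ m = ?Y ^ n * (?Y * ?X ^ m)" by (simp add: power_Suc2 mult.assoc del: power_Suc)
  also have "?Y * ?X ^ m = \<alpha> *\<^sub>R ?X ^ m + \<beta> *\<^sub>R ?X ^ Suc m"
    by (simp add: distrib_right of_real_def)
  also have "?Y ^ n * (\<alpha> *\<^sub>R ?X ^ m + \<beta> *\<^sub>R ?X ^ Suc m) = \<alpha> *\<^sub>R (?Y ^ n * ?X ^ m) + \<beta> *\<^sub>R (?Y ^ n * ?X ^ Suc m)"
    by (simp only: distrib_left mult_scaleR_right)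
  finally have "\<tau> (?Y ^ Suc n * ?X ^ m) = \<alpha> * \<tau> (?Y ^ n * ?X ^ m) + \<beta> * \<tau> (?Y ^ n * ?X ^ Suc m)"
    by (simp only: tr_add tr_scaleR)
  also have "\<dots> = (\<integral>t. \<alpha> * ((\<alpha> + \<beta> * t) ^ n * t ^ m) + \<beta> * ((\<alpha> + \<beta> * t) ^ n * t ^ Suc m) \<partial>\<mu>)"
    unfolding Suc.IH using int[of m] int[of "Suc m"] by simp
  also have "\<dots> = (\<integral>t. (\<alpha> + \<beta> * t) ^ Suc n * t ^ m \<partial>\<mu>)"
    by (intro Bochner_Integration.integral_cong) (auto simp: algebra_simps)
  finally show ?case .
qed

lemma integral_ln_spectral_lim:
  assumes sp: "is_spectral \<mu> x" and x: "bd b x" and e: "0 < \<epsilon>" "b ^ 2 + \<epsilon> < K"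
  shows "(\<lambda>N. \<tau> 1 * ln K - (\<Sum>k=1..N. \<tau> ((of_real (1 - \<epsilon> / K) - (1 / K) *\<^sub>R (x * star x)) ^ k) / real k))
            \<longlonglongrightarrow> (\<integral>t. ln (t + \<epsilon>) \<partial>\<mu>)"
proof -
  have C: "b ^ 2 \<le> K - \<epsilon>" "0 < K - \<epsilon>" using e zero_le_power2[of b] by linarith+
  have s: "sets \<mu> = sets borel" "finite_measure \<mu>" using sp by (auto simp: is_spectral_def)
  have m: "measure \<mu> UNIV = \<tau> 1"
    using is_spectral_polynomial[OF sp, of 0 0 0 0] s sets_eq_imp_space_eq[OF s(1)] by simp
  have "(\<integral>t. (1 - (t + \<epsilon>) / K) ^ k \<partial>\<mu>) = \<tau> ((of_real (1 - \<epsilon> / K) - (1 / K) *\<^sub>R (x * star x)) ^ k)" for k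
  proof -
    have "1 - (t + \<epsilon>) / K = (1 - \<epsilon> / K) + (- 1 / K) * t" for t by (simp add: add_divide_distrib)
    then have "(\<integral>t. (1 - (t + \<epsilon>) / K) ^ k \<partial>\<mu>) = (\<integral>t. ((1 - \<epsilon> / K) + (- 1 / K) * t) ^ k * t ^ 0 \<partial>\<mu>)"
      by (simp only: power_0 mult_1_right)
    also have "\<dots> = \<tau> ((of_real (1 - \<epsilon> / K) + (- 1 / K) *\<^sub>R (x * star x)) ^ k * (x * star x) ^ 0)"
      by (rule is_spectral_polynomial[OF sp, symmetric])
    finally show ?thesis by simp
  qed
  then show ?thesis
    using integral_ln_add_eq_lim(1)[OF s(2,1) is_spectral_AE[OF sp x C] e(1), of K] m by simp
qed


text \<open>The factor k gained in the difference of k-th powers cancels against 1 / k and leaves a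
  geometric series, so the bound does not depend on N. In the limit it makes the regularised
  logarithmic integral locally Lipschitz, hence continuous.\<close>

lemma sum_tr_power_diff_le:
  assumes x: "bd b x" and y: "bd b y" and b: "b ^ 2 \<le> a" "b \<le> 1" and a: "0 < a" "a < 1" and d: "bd e (x - y)"
  shows "\<bar>(\<Sum>k=1..N. \<tau> ((of_real a - x * star x) ^ k) / real k) - (\<Sum>k=1..N. \<tau> ((of_real a - y * star y) ^ k) / real k)\<bar>
     \<le> 1 / (1 - a) * ((2 * e / a) * \<tau> 1)"
proof -
  let ?s = "of_real a - x * star x" and ?t = "of_real a - y * star y"
  define f where "f = ?s - ?t"
  have e: "0 \<le> e" using d by (rule bd_nonneg)
  have "bd (b * e + e * b) (- (y * star (x - y) + (x - y) * star x))"
    by (intro bd_uminus bd_add bd_mult bd_star x y d)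
  also have "- (y * star (x - y) + (x - y) * star x) = f" by (simp add: f_def algebra_simps)
  finally have bf: "bd (2 * e) f" by (rule bd_mono) (use b e mult_right_mono[of b 1 e] in \<open>simp add: mult.commute\<close>)
  have bS: "bd a ?t" "bd a (?t + f)"
    using bd_of_real_minus[OF x b(1)] bd_of_real_minus[OF y b(1)] by (simp_all add: f_def)
  have "\<bar>(\<Sum>k=1..N. \<tau> (?s ^ k) / real k) - (\<Sum>k=1..N. \<tau> (?t ^ k) / real k)\<bar>
     \<le> (\<Sum>k=1..N. \<bar>\<tau> (?s ^ k) / real k - \<tau> (?t ^ k) / real k\<bar>)"
    unfolding sum_subtractf[symmetric] by (rule sum_abs)
  also have "\<dots> \<le> (\<Sum>k=1..N. a ^ k * ((2 * e / a) * \<tau> 1))"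
  proof (rule sum_mono)
    fix k assume "k \<in> {1..N}"
    then have k: "real k > 0" by simp
    have "\<bar>\<tau> (?s ^ k) / real k - \<tau> (?t ^ k) / real k\<bar> = \<bar>\<tau> ((?t + f) ^ k) - \<tau> (?t ^ k)\<bar> / real k"
      using k by (simp add: f_def diff_divide_distrib[symmetric])
    also have "\<dots> \<le> (real k * a ^ k * (2 * e / a) * \<tau> 1) / real k"
      using k by (intro divide_right_mono tr_power_diff_le bS bf a) auto
    finally show "\<bar>\<tau> (?s ^ k) / real k - \<tau> (?t ^ k) / real k\<bar> \<le> a ^ k * ((2 * e / a) * \<tau> 1)" using k by simp
  qed
  also have "\<dots> = (\<Sum>k=1..N. a ^ k) * ((2 * e / a) * \<tau> 1)" by (rule sum_distrib_right[symmetric])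
  also have "\<dots> \<le> 1 / (1 - a) * ((2 * e / a) * \<tau> 1)"
  proof (rule mult_right_mono)
    have "(\<Sum>k=1..N. a ^ k) \<le> suminf (\<lambda>k. a ^ k)"
      using a by (intro sum_le_suminf) (auto intro!: summable_geometric)
    then show "(\<Sum>k=1..N. a ^ k) \<le> 1 / (1 - a)" using a by (simp add: suminf_geometric)
  qed (use a e tr_one_nonneg in simp)
  finally show ?thesis .
qed

text \<open>Convexity along one line in abstract form. The assumption \<open>twist\<close> lets the
  mixed product A(x + 2h) A(x)^* be replaced by the centred one under traces of powers. The
  estimates are made on a compact interval, where a single rescaling constant serves all
  parameters.\<close>

lemma convex_on_integral_ln_spectral:
  fixes A :: "real \<Rightarrow> 'a" and \<mu> :: "real \<Rightarrow> real measure"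
  assumes spec: "\<And>t. is_spectral (\<mu> t) (A t)"
    and bound: "\<And>l u. \<exists>b. \<forall>t\<in>{l..u}. bd b (A t)"
    and lip: "\<And>l u. \<exists>L. \<forall>s\<in>{l..u}. \<forall>t\<in>{l..u}. bd (L * \<bar>s - t\<bar>) (A s - A t)"
    and twist: "\<And>\<alpha> \<beta> x h n. \<tau> ((of_real \<alpha> - \<beta> *\<^sub>R (A (x + 2 * h) * star (A x))) ^ n)
          = \<tau> ((of_real \<alpha> - \<beta> *\<^sub>R (A (x + h) * star (A (x + h)))) ^ n)"
    and e: "0 < \<epsilon>"
  shows "convex_on UNIV (\<lambda>t. \<integral>y. ln (y + \<epsilon>) \<partial>\<mu> t)"
proof -
  define G where "G t = (\<integral>y. ln (y + \<epsilon>) \<partial>\<mu> t)" for t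
  have near: "\<exists>c C. \<exists>d>0. 0 \<le> c \<and> (\<forall>s\<in>{l..u}. \<forall>t\<in>{l..u}. \<bar>G s - G t\<bar> \<le> c * \<bar>s - t\<bar>)
      \<and> (\<forall>x h. x \<in> {l..u} \<and> x + 2 * h \<in> {l..u} \<and> 0 < h \<and> h < d \<longrightarrow> - C * h ^ 3 \<le> G x + G (x + 2 * h) - 2 * G (x + h))"
    if "l \<le> u" for l u
  proof -
    obtain b where b: "\<And>t. t \<in> {l..u} \<Longrightarrow> bd b (A t)" using bound by blast
    obtain L where L: "\<And>s t. s \<in> {l..u} \<Longrightarrow> t \<in> {l..u} \<Longrightarrow> bd (L * \<bar>s - t\<bar>) (A s - A t)" using lip by blast
    \<comment> \<open>The summand 1 gives K > 1 and makes b^2 + \<epsilon> < K strict. After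
      division by sqrt K the elements a - B B^* have the bound a = 1 - \<epsilon> / K < 1, the ratio
      of the logarithmic series.\<close>
    define K where "K = b ^ 2 + 1 + \<epsilon>"
    have K: "1 < K" "b ^ 2 + \<epsilon> < K" "b ^ 2 \<le> K - \<epsilon>" "\<epsilon> < K"
      using e zero_le_power2[of b] by (simp_all add: K_def add_nonneg_pos del: zero_le_power2)
    define a where "a = 1 - \<epsilon> / K"
    define B where "B t = (1 / sqrt K) *\<^sub>R A t" for t
    define c where "c = b / sqrt K"
    have a: "0 < a" "a < 1" using K e by (simp_all add: a_def)
    have prod: "B s * star (B t) = (1 / K) *\<^sub>R (A s * star (A t))" for s t
      using K by (simp add: B_def)
    have bdB: "bd c (B t)" if "t \<in> {l..u}" for t
      using bd_scaleR[OF b[OF that], of "1 / sqrt K"] K by (simp add: B_def c_def)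
    have ca: "c ^ 2 \<le> a"
    proof -
      have "c ^ 2 = b ^ 2 / K" using K by (simp add: c_def power_divide)
      also have "\<dots> \<le> (K - \<epsilon>) / K" using K by (intro divide_right_mono) auto
      finally show ?thesis using K by (simp add: a_def diff_divide_distrib)
    qed
    have c1: "c \<le> 1"
      by (rule power2_le_imp_le) (use ca a in simp_all)
    have lipB: "bd (\<bar>L\<bar> * \<bar>s - t\<bar>) (B s - B t)" if "s \<in> {l..u}" "t \<in> {l..u}" for s t
    proof -
      have 1: "bd (\<bar>1 / sqrt K\<bar> * (L * \<bar>s - t\<bar>)) (B s - B t)"
        unfolding B_def scaleR_diff_right[symmetric] by (rule bd_scaleR[OF L[OF that]])
      have "\<bar>1 / sqrt K\<bar> * (L * \<bar>s - t\<bar>) \<le> \<bar>1 / sqrt K\<bar> * (\<bar>L\<bar> * \<bar>s - t\<bar>)"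
        by (intro mult_left_mono mult_right_mono) auto
      also have "\<dots> \<le> 1 * (\<bar>L\<bar> * \<bar>s - t\<bar>)" using K by (intro mult_right_mono) auto
      finally show ?thesis using bd_mono[OF 1] by simp
    qed
    define T where "T N t = (\<Sum>k=1..N. \<tau> ((of_real a - B t * star (B t)) ^ k) / real k)" for N t
    have lim: "(\<lambda>N. \<tau> 1 * ln K - T N t) \<longlonglongrightarrow> G t" if "t \<in> {l..u}" for t
      unfolding T_def prod a_def G_def by (rule integral_ln_spectral_lim[OF spec b[OF that] e K(2)])
    have est: "\<bar>G s - G t\<bar> \<le> 2 * \<bar>L\<bar> / a * \<tau> 1 / (1 - a) * \<bar>s - t\<bar>" if st: "s \<in> {l..u}" "t \<in> {l..u}" for s t
    proof -
      have "(\<lambda>N. T N t - T N s) \<longlonglongrightarrow> G s - G t" using tendsto_diff[OF lim[OF st(1)] lim[OF st(2)]] by simp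
      then have conv: "(\<lambda>N. \<bar>T N t - T N s\<bar>) \<longlonglongrightarrow> \<bar>G s - G t\<bar>" by (rule tendsto_rabs)
      have le: "\<bar>T N t - T N s\<bar> \<le> 1 / (1 - a) * ((2 * (\<bar>L\<bar> * \<bar>t - s\<bar>) / a) * \<tau> 1)" for N
        unfolding T_def by (rule sum_tr_power_diff_le[OF bdB bdB ca c1 a lipB]) (use st in auto)
      have "\<bar>G s - G t\<bar> \<le> 1 / (1 - a) * ((2 * (\<bar>L\<bar> * \<bar>t - s\<bar>) / a) * \<tau> 1)"
        using conv by (rule LIMSEQ_le_const2) (use le in blast)
      then show ?thesis by (simp add: mult_ac abs_minus_commute[of t s])
    qed
    \<comment> \<open>Halfway between a and 1: \<open>d\<close> will force e \<le> (1 - a) / 2,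
      whence a + e \<le> r < 1.\<close>
    define r where "r = (1 + a) / 2"
    have r: "0 < r" "r < 1" "r \<le> 1" using a by (simp_all add: r_def)
    define Z where "Z = suminf (\<lambda>n. real n ^ 2 * r ^ n)"
    have Z: "(\<Sum>n=1..N. real n ^ 2 * r ^ n) \<le> Z" for N
      unfolding Z_def using r by (intro sum_le_suminf summable_square_geometric) auto
    define C where "C = Z * (34 * \<tau> 1 / r ^ 3) * (2 * \<bar>L\<bar>) ^ 3"
    define d where "d = (1 - a) / (4 * (\<bar>L\<bar> + 1))"
    have d0: "d > 0" using a by (simp add: d_def)
    have mid: "- C * h ^ 3 \<le> G x + G (x + 2 * h) - 2 * G (x + h)"
      if x: "x \<in> {l..u}" "x + 2 * h \<in> {l..u}" and h: "0 < h" "h < d" for x h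
    proof -
      have xh: "x + h \<in> {l..u}" using x h by auto
      define e where "e = 2 * \<bar>L\<bar> * h"
      have e0: "0 \<le> e" using h by (simp add: e_def)
      have er: "e \<le> (1 - a) / 2"
      proof -
        have "e \<le> 2 * (\<bar>L\<bar> + 1) * h" using h by (simp add: e_def)
        also have "\<dots> \<le> 2 * (\<bar>L\<bar> + 1) * d" using h by (intro mult_left_mono) auto
        also have "\<dots> = (1 - a) / 2" by (simp add: d_def field_simps)
        finally show ?thesis .
      qed
      define E where "E = B (x + 2 * h) - B x"
      have bE: "bd e E" unfolding E_def using lipB[OF x(2,1)] h by (simp add: e_def mult_ac)
      have AE: "B x + E = B (x + 2 * h)" by (simp add: E_def)
      \<comment> \<open>The step that turns the determinant inequality into convexity: the mixed
        term becomes the value at the midpoint x + h.\<close>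
      have tw: "\<tau> ((of_real a - (B x + E) * star (B x)) ^ n) = \<tau> ((of_real a - B (x + h) * star (B (x + h))) ^ n)" for n
        unfolding AE prod by (rule twist)
      have "T N (x + 2 * h) + T N x - 2 * T N (x + h) \<le> C * h ^ 3" for N
      proof -
        have "T N (x + 2 * h) + T N x - 2 * T N (x + h)
          = (\<Sum>n=1..N. (\<tau> ((of_real a - (B x + E) * star (B x + E)) ^ n) + \<tau> ((of_real a - B x * star (B x)) ^ n)
              - 2 * \<tau> ((of_real a - (B x + E) * star (B x)) ^ n)) / real n)"
          unfolding tw T_def by (simp add: AE add_divide_distrib diff_divide_distrib sum.distrib sum_subtractf sum_distrib_left)
        also have "\<dots> \<le> (\<Sum>n=1..N. real n ^ 2 * r ^ n) * (34 * \<tau> 1 / r ^ 3) * e ^ 3"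
          by (rule sum_tr_power_second_difference[OF bdB bE _ ca c1])
            (use bdB[OF x(2)] AE x er a r in \<open>auto simp: r_def\<close>)
        also have "\<dots> \<le> Z * (34 * \<tau> 1 / r ^ 3) * e ^ 3"
          using Z[of N] r e0 tr_one_nonneg by (intro mult_right_mono) auto
        finally show ?thesis by (simp add: C_def e_def power_mult_distrib)
      qed
      then have le: "- C * h ^ 3 \<le> (\<tau> 1 * ln K - T N x) + (\<tau> 1 * ln K - T N (x + 2 * h)) - 2 * (\<tau> 1 * ln K - T N (x + h))" for N
        by (simp add: algebra_simps)
      have "(\<lambda>N. (\<tau> 1 * ln K - T N x) + (\<tau> 1 * ln K - T N (x + 2 * h)) - 2 * (\<tau> 1 * ln K - T N (x + h)))
          \<longlonglongrightarrow> G x + G (x + 2 * h) - 2 * G (x + h)"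
        by (intro tendsto_add tendsto_diff tendsto_mult tendsto_const lim x xh)
      then show ?thesis by (rule LIMSEQ_le_const) (use le in blast)
    qed
    have "0 \<le> 2 * \<bar>L\<bar> / a * \<tau> 1 / (1 - a)" using a tr_one_nonneg by simp
    then show ?thesis using d0 est mid by blast
  qed
  have "isCont G t" for t
  proof -
    obtain c where c: "0 \<le> c" "\<And>x y. x \<in> {t - 1..t + 1} \<Longrightarrow> y \<in> {t - 1..t + 1} \<Longrightarrow> \<bar>G x - G y\<bar> \<le> c * \<bar>x - y\<bar>"
      using near[of "t - 1" "t + 1"] by auto
    have "c-lipschitz_on {t - 1..t + 1} G" by (rule lipschitz_onI) (use c in \<open>auto simp: dist_real_def\<close>)
    then have "continuous_on {t - 1..t + 1} G" by (rule lipschitz_on_continuous_on)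
    then show ?thesis by (rule continuous_on_interior) simp
  qed
  then have "continuous_on UNIV G" by (simp add: continuous_on_eq_continuous_at)
  then have "convex_on UNIV G"
  proof (rule convex_on_if_almost_midpoint_convex)
    fix l u :: real
    \<comment> \<open>For x \<le> u and h < 1 the point x + 2h stays below u + 2; the
      \<open>max\<close> keeps the interval nonempty when u < l.\<close>
    have "l \<le> max l u + 2" by simp
    from near[OF this] obtain C d where d: "0 < d" and le: "\<forall>x h. x \<in> {l..max l u + 2} \<and> x + 2 * h \<in> {l..max l u + 2}
        \<and> 0 < h \<and> h < d \<longrightarrow> - C * h ^ 3 \<le> G x + G (x + 2 * h) - 2 * G (x + h)" by blast
    have "- C * h ^ 3 \<le> G x + G (x + 2 * h) - 2 * G (x + h)" if "l \<le> x" "x \<le> u" "0 < h" "h < min d 1" for x h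
      by (rule le[rule_format]) (use that in auto)
    then show "\<exists>C. \<exists>d>0. \<forall>x h. l \<le> x \<and> x \<le> u \<and> 0 < h \<and> h < d \<longrightarrow> - C * h ^ 3 \<le> G x + G (x + 2 * h) - 2 * G (x + h)"
      using d by (intro exI[of _ C] exI[of _ "min d 1"]) auto
  qed
  then show ?thesis unfolding G_def .
qed

end

section \<open>Row- and column-finite matrices\<close>

text \<open>A type cannot depend on the group. The matrices with finitely many nonzero entries in every row and
  column form a ring for any index type, and the matrices over the group ring of every group on \<open>'g\<close>
  embed into this ring for the index type \<open>nat \<times> 'g\<close>.\<close>

typedef 'k fmat = "{M :: 'k \<Rightarrow> 'k \<Rightarrow> complex. (\<forall>a. finite {b. M a b \<noteq> 0}) \<and> (\<forall>b. finite {a. M a b \<noteq> 0})}"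
  morphisms entry Fmat
  by (rule exI[of _ "\<lambda>_ _. 0"]) simp

setup_lifting type_definition_fmat

lemma finite_row [simp]: "finite {b. entry M a b \<noteq> 0}" and finite_col [simp]: "finite {a. entry M a b \<noteq> 0}"
  using entry[of M] by auto

lemma fmat_eqI: "(\<And>a b. entry M a b = entry N a b) \<Longrightarrow> M = N"
  by (metis entry_inject ext)

instantiation fmat :: (type) "{zero, one, plus, minus, uminus, scaleR, times}"
begin

lift_definition zero_fmat :: "'a fmat" is "\<lambda>_ _. 0" by simp
lift_definition one_fmat :: "'a fmat" is "\<lambda>a b. if a = b then 1 else 0" by simp
lift_definition plus_fmat :: "'a fmat \<Rightarrow> 'a fmat \<Rightarrow> 'a fmat" is "\<lambda>M N a b. M a b + N a b"
proof (intro conjI allI)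
  fix M N :: "'a \<Rightarrow> 'a \<Rightarrow> complex" and c
  assume "(\<forall>a. finite {b. M a b \<noteq> 0}) \<and> (\<forall>b. finite {a. M a b \<noteq> 0})"
    and "(\<forall>a. finite {b. N a b \<noteq> 0}) \<and> (\<forall>b. finite {a. N a b \<noteq> 0})"
  then have "finite ({b. M c b \<noteq> 0} \<union> {b. N c b \<noteq> 0})" "finite ({a. M a c \<noteq> 0} \<union> {a. N a c \<noteq> 0})" by auto
  then show "finite {b. M c b + N c b \<noteq> 0}" "finite {a. M a c + N a c \<noteq> 0}"
    by (elim rev_finite_subset, force)+
qed
lift_definition uminus_fmat :: "'a fmat \<Rightarrow> 'a fmat" is "\<lambda>M a b. - M a b" by simp
definition minus_fmat :: "'a fmat \<Rightarrow> 'a fmat \<Rightarrow> 'a fmat" where "minus_fmat M N = M + uminus N"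
lift_definition scaleR_fmat :: "real \<Rightarrow> 'a fmat \<Rightarrow> 'a fmat" is "\<lambda>r M a b. r *\<^sub>R M a b" by simp
lift_definition times_fmat :: "'a fmat \<Rightarrow> 'a fmat \<Rightarrow> 'a fmat" is "\<lambda>M N a c. \<Sum>b\<in>{b. M a b \<noteq> 0}. M a b * N b c"
proof (intro conjI allI)
  fix M N :: "'a \<Rightarrow> 'a \<Rightarrow> complex" and d
  assume fin: "(\<forall>a. finite {b. M a b \<noteq> 0}) \<and> (\<forall>b. finite {a. M a b \<noteq> 0})"
    "(\<forall>a. finite {b. N a b \<noteq> 0}) \<and> (\<forall>b. finite {a. N a b \<noteq> 0})"
  have nz: "\<exists>b. M a b \<noteq> 0 \<and> N b c \<noteq> 0" if "(\<Sum>b\<in>{b. M a b \<noteq> 0}. M a b * N b c) \<noteq> 0" for a c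
    using that by (rule contrapos_np) (auto intro!: sum.neutral)
  have "finite (\<Union>b\<in>{b. M d b \<noteq> 0}. {c. N b c \<noteq> 0})" using fin by auto
  then show "finite {c. (\<Sum>b\<in>{b. M d b \<noteq> 0}. M d b * N b c) \<noteq> 0}"
    by (rule rev_finite_subset) (use nz in auto)
  have "finite (\<Union>b\<in>{b. N b d \<noteq> 0}. {a. M a b \<noteq> 0})" using fin by auto
  then show "finite {a. (\<Sum>b\<in>{b. M a b \<noteq> 0}. M a b * N b d) \<noteq> 0}"
    by (rule rev_finite_subset) (use nz in auto)
qed

instance ..

end

lemma entry_zero [simp]: "entry 0 a b = 0" by transfer simp
lemma entry_one [simp]: "entry 1 a b = (if a = b then 1 else 0)" by transfer simp
lemma entry_add [simp]: "entry (M + N) a b = entry M a b + entry N a b" by transfer simp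
lemma entry_uminus [simp]: "entry (- M) a b = - entry M a b" by transfer simp
lemma entry_diff [simp]: "entry (M - N) a b = entry M a b - entry N a b" by (simp add: minus_fmat_def)
lemma entry_scaleR [simp]: "entry (r *\<^sub>R M) a b = r *\<^sub>R entry M a b" by transfer simp

lemma entry_mult:
  assumes "finite B" "\<And>b. entry M a b \<noteq> 0 \<Longrightarrow> entry N b c \<noteq> 0 \<Longrightarrow> b \<in> B"
  shows "entry (M * N) a c = (\<Sum>b\<in>B. entry M a b * entry N b c)"
proof -
  have "entry (M * N) a c = (\<Sum>b\<in>{b. entry M a b \<noteq> 0}. entry M a b * entry N b c)" by transfer simp
  also have "\<dots> = (\<Sum>b\<in>{b. entry M a b \<noteq> 0} \<inter> B. entry M a b * entry N b c)"
    by (rule sum.mono_neutral_right) (use assms in auto)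
  also have "\<dots> = (\<Sum>b\<in>B. entry M a b * entry N b c)"
    by (rule sum.mono_neutral_left) (use assms in auto)
  finally show ?thesis .
qed

lemma entry_mult_row: "entry (M * N) a c = (\<Sum>b\<in>{b. entry M a b \<noteq> 0}. entry M a b * entry N b c)"
  by (rule entry_mult) auto

lemma entry_mult_col: "entry (M * N) a c = (\<Sum>b\<in>{b. entry N b c \<noteq> 0}. entry M a b * entry N b c)"
  by (rule entry_mult) auto

instance fmat :: (type) real_algebra_1
proof
  fix U V W :: "'a fmat" and r s :: real
  show "U * V * W = U * (V * W)"
  proof (rule fmat_eqI)
    fix a d
    let ?B = "{b. entry U a b \<noteq> 0}" and ?C = "{c. entry W c d \<noteq> 0}"
    have "entry (U * V * W) a d = (\<Sum>c\<in>?C. (\<Sum>b\<in>?B. entry U a b * entry V b c) * entry W c d)"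
      unfolding entry_mult_col[of "U * V"] entry_mult_row[of U V] ..
    also have "\<dots> = (\<Sum>b\<in>?B. \<Sum>c\<in>?C. entry U a b * (entry V b c * entry W c d))"
      by (subst sum.swap) (simp add: sum_distrib_right mult.assoc)
    also have "\<dots> = entry (U * (V * W)) a d"
      unfolding entry_mult_row[of U "V * W"] entry_mult_col[of V W] by (simp add: sum_distrib_left)
    finally show "entry (U * V * W) a d = entry (U * (V * W)) a d" .
  qed
  show "1 * U = U"
    by (rule fmat_eqI, subst entry_mult[where B="{a}" for a]) (auto split: if_splits)
  show "U * 1 = U"
    by (rule fmat_eqI, subst entry_mult[where B="{b}" for b]) (auto split: if_splits)
  show "(U + V) * W = U * W + V * W"
    by (rule fmat_eqI) (simp add: entry_mult_col sum.distrib distrib_right)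
  show "U * (V + W) = U * V + U * W"
    by (rule fmat_eqI) (simp add: entry_mult_row sum.distrib distrib_left)
  show "r *\<^sub>R U * V = r *\<^sub>R (U * V)"
    by (rule fmat_eqI) (simp add: entry_mult_col scaleR_sum_right)
  show "U * r *\<^sub>R V = r *\<^sub>R (U * V)"
    by (rule fmat_eqI) (simp add: entry_mult_row scaleR_sum_right)
  show "(0::'a fmat) \<noteq> 1"
  proof
    assume "(0::'a fmat) = 1"
    then have "entry (0::'a fmat) undefined undefined = entry 1 undefined undefined" by simp
    then show False by simp
  qed
qed (auto intro!: fmat_eqI simp: algebra_simps)

lift_definition fstar :: "'k fmat \<Rightarrow> 'k fmat" is "\<lambda>M a b. cnj (M b a)" by simp

lemma entry_fstar [simp]: "entry (fstar M) a b = cnj (entry M b a)" by transfer simp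

lemma fstar_mult: "fstar (M * N) = fstar N * fstar M"
  by (rule fmat_eqI) (simp add: entry_mult_row[of M] entry_mult_col[of _ "fstar M"] mult.commute)

text \<open>Columns are finitely supported, so the row vector may have arbitrary support. This is
  how square-summable vectors meet the matrices.\<close>

definition vec_mult :: "('k \<Rightarrow> complex) \<Rightarrow> 'k fmat \<Rightarrow> 'k \<Rightarrow> complex" where
  "vec_mult \<xi> M b = (\<Sum>a\<in>{a. entry M a b \<noteq> 0}. \<xi> a * entry M a b)"

lemma vec_mult_eq:
  assumes "finite A" "\<And>a. \<xi> a \<noteq> 0 \<Longrightarrow> entry M a b \<noteq> 0 \<Longrightarrow> a \<in> A"
  shows "vec_mult \<xi> M b = (\<Sum>a\<in>A. \<xi> a * entry M a b)"
proof -
  have "vec_mult \<xi> M b = (\<Sum>a\<in>{a. entry M a b \<noteq> 0} \<inter> A. \<xi> a * entry M a b)"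
    unfolding vec_mult_def by (rule sum.mono_neutral_right) (use assms in auto)
  also have "\<dots> = (\<Sum>a\<in>A. \<xi> a * entry M a b)"
    by (rule sum.mono_neutral_left) (use assms in auto)
  finally show ?thesis .
qed

lemma vec_mult_one [simp]: "vec_mult \<xi> 1 = \<xi>"
  by (rule ext, subst vec_mult_eq[where A="{b}" for b]) (auto split: if_splits)

lemma vec_mult_diff: "vec_mult \<xi> (M - N) b = vec_mult \<xi> M b - vec_mult \<xi> N b"
proof -
  let ?A = "{a. entry M a b \<noteq> 0} \<union> {a. entry N a b \<noteq> 0}"
  have "vec_mult \<xi> (M - N) b = (\<Sum>a\<in>?A. \<xi> a * entry (M - N) a b)" by (rule vec_mult_eq) auto
  also have "\<dots> = (\<Sum>a\<in>?A. \<xi> a * entry M a b) - (\<Sum>a\<in>?A. \<xi> a * entry N a b)"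
    by (simp add: sum_subtractf algebra_simps)
  also have "(\<Sum>a\<in>?A. \<xi> a * entry M a b) = vec_mult \<xi> M b" by (rule vec_mult_eq[symmetric]) auto
  also have "(\<Sum>a\<in>?A. \<xi> a * entry N a b) = vec_mult \<xi> N b" by (rule vec_mult_eq[symmetric]) auto
  finally show ?thesis .
qed

lemma vec_mult_scaleR: "vec_mult \<xi> (r *\<^sub>R M) b = r *\<^sub>R vec_mult \<xi> M b"
proof -
  have "vec_mult \<xi> (r *\<^sub>R M) b = (\<Sum>a\<in>{a. entry M a b \<noteq> 0}. \<xi> a * entry (r *\<^sub>R M) a b)"
    by (rule vec_mult_eq) auto
  then show ?thesis by (simp add: vec_mult_def scaleR_sum_right)
qed

lemma vec_mult_assoc: "vec_mult \<xi> (M * N) = vec_mult (vec_mult \<xi> M) N"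
proof
  fix c
  let ?B = "{b. entry N b c \<noteq> 0}"
  let ?A = "\<Union>b\<in>?B. {a. entry M a b \<noteq> 0}"
  have fin: "finite ?A" by auto
  have e: "entry (M * N) a c = (\<Sum>b\<in>?B. entry M a b * entry N b c)" for a by (rule entry_mult_col)
  have "vec_mult \<xi> (M * N) c = (\<Sum>a\<in>?A. \<xi> a * entry (M * N) a c)"
  proof (rule vec_mult_eq[OF fin])
    fix a assume "entry (M * N) a c \<noteq> 0"
    then have "\<exists>b\<in>?B. entry M a b * entry N b c \<noteq> 0" unfolding e by (meson sum.neutral)
    then show "a \<in> ?A" by auto
  qed
  also have "\<dots> = (\<Sum>b\<in>?B. (\<Sum>a\<in>?A. \<xi> a * entry M a b) * entry N b c)"
    unfolding e sum_distrib_left sum_distrib_right by (subst sum.swap) (simp add: mult.assoc)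
  also have "\<dots> = (\<Sum>b\<in>?B. vec_mult \<xi> M b * entry N b c)"
  proof (intro sum.cong refl)
    fix b assume b: "b \<in> ?B"
    have "(\<Sum>a\<in>?A. \<xi> a * entry M a b) = vec_mult \<xi> M b"
      by (rule vec_mult_eq[symmetric, OF fin]) (use b in auto)
    then show "(\<Sum>a\<in>?A. \<xi> a * entry M a b) * entry N b c = vec_mult \<xi> M b * entry N b c" by simp
  qed
  finally show "vec_mult \<xi> (M * N) c = vec_mult (vec_mult \<xi> M) N c"
    by (simp only: vec_mult_def[of _ N])
qed

section \<open>Matrices over the group ring\<close>

lemma abs_exp_diff_le:
  fixes x y :: real
  assumes "\<bar>x\<bar> \<le> M" "\<bar>y\<bar> \<le> M"
  shows "\<bar>exp x - exp y\<bar> \<le> exp M * \<bar>x - y\<bar>"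
proof -
  have *: "exp v - exp u \<le> exp M * (v - u)" if "u \<le> v" "v \<le> M" for u v :: real
  proof -
    have "exp v - exp u = exp v * (1 - exp (u - v))" by (simp add: algebra_simps exp_add[symmetric])
    also have "\<dots> \<le> exp v * (v - u)" using exp_ge_add_one_self[of "u - v"] by (intro mult_left_mono) (linarith, simp)
    also have "\<dots> \<le> exp M * (v - u)" using that by (intro mult_right_mono) auto
    finally show ?thesis .
  qed
  show ?thesis
  proof (cases "x \<le> y")
    case True
    then show ?thesis using *[of x y] assms by simp
  next
    case False
    then show ?thesis using *[of y x] assms by simp
  qed
qed

text \<open>On [0, C] the powers of 1 - t / C decrease to the indicator of {0}. Their integrals
  detect an atom at 0, and an additional factor t removes it.\<close>

lemma integral_power_one_minus_tendsto:
  fixes \<mu> :: "real measure"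
  assumes "finite_measure \<mu>" and sets [measurable_cong, simp]: "sets \<mu> = sets borel"
    and supp: "AE t in \<mu>. t \<in> {0..C}" and C: "0 < C"
  shows "(\<lambda>n. \<integral>t. (1 - t / C) ^ n \<partial>\<mu>) \<longlonglongrightarrow> measure \<mu> {0}"
    and "(\<lambda>n. \<integral>t. (1 - t / C) ^ n * t \<partial>\<mu>) \<longlonglongrightarrow> 0"
proof -
  interpret finite_measure \<mu> by fact
  have sp: "space \<mu> = UNIV" using sets_eq_imp_space_eq[OF sets] by simp
  have lim: "(\<lambda>n. (1 - t / C) ^ n) \<longlonglongrightarrow> indicator {0} t" if "t \<in> {0..C}" for t
  proof (cases "t = 0")
    case False
    then have "(\<lambda>n. (1 - t / C) ^ n) \<longlonglongrightarrow> 0" using that C by (intro LIMSEQ_realpow_zero) (auto simp: divide_simps)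
    then show ?thesis using False by simp
  qed simp
  have bound: "\<bar>(1 - t / C) ^ n\<bar> \<le> 1" if "t \<in> {0..C}" for t n
  proof -
    have "\<bar>1 - t / C\<bar> \<le> 1" using that C by (auto simp: divide_simps)
    then show ?thesis by (simp add: power_abs power_le_one)
  qed
  have "(\<lambda>n. \<integral>t. (1 - t / C) ^ n \<partial>\<mu>) \<longlonglongrightarrow> (\<integral>t. indicat_real {0} t \<partial>\<mu>)"
  proof (rule integral_dominated_convergence[where w="\<lambda>_. 1"])
    show "AE t in \<mu>. (\<lambda>n. (1 - t / C) ^ n) \<longlonglongrightarrow> indicat_real {0} t" by (rule eventually_mono[OF supp lim])
    show "AE t in \<mu>. norm ((1 - t / C) ^ n) \<le> 1" for n
      unfolding real_norm_def by (rule eventually_mono[OF supp bound])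
  qed auto
  then show "(\<lambda>n. \<integral>t. (1 - t / C) ^ n \<partial>\<mu>) \<longlonglongrightarrow> measure \<mu> {0}" by (simp add: sp)
  have "(\<lambda>n. \<integral>t. (1 - t / C) ^ n * t \<partial>\<mu>) \<longlonglongrightarrow> (\<integral>t. 0 \<partial>\<mu>)"
  proof (rule integral_dominated_convergence[where w="\<lambda>_. C"])
    show "AE t in \<mu>. (\<lambda>n. (1 - t / C) ^ n * t) \<longlonglongrightarrow> 0"
    proof (rule eventually_mono[OF supp])
      fix t assume "t \<in> {0..C}"
      then have "(\<lambda>n. (1 - t / C) ^ n * t) \<longlonglongrightarrow> indicator {0} t * t" by (intro tendsto_mult lim tendsto_const)
      then show "(\<lambda>n. (1 - t / C) ^ n * t) \<longlonglongrightarrow> 0" by (cases "t = 0") auto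
    qed
    show "AE t in \<mu>. norm ((1 - t / C) ^ n * t) \<le> C" for n
    proof (rule eventually_mono[OF supp])
      fix t assume t: "t \<in> {0..C}"
      have "norm ((1 - t / C) ^ n * t) \<le> 1 * C"
        unfolding norm_mult using bound[OF t] t by (intro mult_mono) auto
      then show "norm ((1 - t / C) ^ n * t) \<le> C" by simp
    qed
  qed auto
  then show "(\<lambda>n. \<integral>t. (1 - t / C) ^ n * t \<partial>\<mu>) \<longlonglongrightarrow> 0" by simp
qed

lemma convex_on_LIMSEQ:
  fixes f :: "nat \<Rightarrow> 'v::real_vector \<Rightarrow> real"
  assumes "\<And>n. convex_on A (f n)" and lim: "\<And>x. x \<in> A \<Longrightarrow> (\<lambda>n. f n x) \<longlonglongrightarrow> g x"
  shows "convex_on A g"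
proof (rule convex_onI)
  show A: "convex A" by (rule convex_on_imp_convex[OF assms(1)])
  fix t :: real and x y assume t: "0 < t" "t < 1" and xy: "x \<in> A" "y \<in> A"
  have z: "(1 - t) *\<^sub>R x + t *\<^sub>R y \<in> A" by (rule convexD_alt[OF A xy]) (use t in auto)
  have "(\<lambda>n. (1 - t) * f n x + t * f n y) \<longlonglongrightarrow> (1 - t) * g x + t * g y"
    by (intro tendsto_add tendsto_mult tendsto_const lim xy)
  with lim[OF z] show "g ((1 - t) *\<^sub>R x + t *\<^sub>R y) \<le> (1 - t) * g x + t * g y"
  proof (rule LIMSEQ_le)
    have "f n ((1 - t) *\<^sub>R x + t *\<^sub>R y) \<le> (1 - t) * f n x + t * f n y" for n
      by (rule convex_onD[OF assms(1)]) (use t xy in auto)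
    then show "\<exists>N. \<forall>n\<ge>N. f n ((1 - t) *\<^sub>R x + t *\<^sub>R y) \<le> (1 - t) * f n x + t * f n y" by blast
  qed
qed

lemma convex_on_if_convex_on_lines:
  fixes f :: "'v::real_vector \<Rightarrow> real"
  assumes "\<And>x v. convex_on UNIV (\<lambda>t. f (x + t *\<^sub>R v))"
  shows "convex_on UNIV f"
proof (rule convex_onI)
  fix t :: real and x y :: 'v assume t: "0 < t" "t < 1"
  have "f (x + ((1 - t) *\<^sub>R 0 + t *\<^sub>R 1) *\<^sub>R (y - x)) \<le> (1 - t) * f (x + 0 *\<^sub>R (y - x)) + t * f (x + 1 *\<^sub>R (y - x))"
    by (rule convex_onD[OF assms[of x "y - x"]]) (use t in auto)
  moreover have "x + t *\<^sub>R (y - x) = (1 - t) *\<^sub>R x + t *\<^sub>R y" by (simp add: algebra_simps)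
  ultimately show "f ((1 - t) *\<^sub>R x + t *\<^sub>R y) \<le> (1 - t) * f x + t * f y" by simp
qed simp

locale group_ring_matrices = group G for G :: "'g monoid" (structure) +
  fixes p :: nat
begin

section \<open>Translation-invariant matrices and the von Neumann trace\<close>

definition idx :: "(nat \<times> 'g) set" where "idx = {..<p} \<times> carrier G"

lemma mem_idx [simp]: "(i, g) \<in> idx \<longleftrightarrow> i < p \<and> g \<in> carrier G" by (simp add: idx_def)

text \<open>Commutation with left translations. Indices outside \<open>idx\<close> exist because the
  type ranges over all of \<open>'g\<close>. They form a separate block instead of being forced to
  0, since the unit of the ring has diagonal entries 1 there too.\<close>

definition invariant :: "(nat \<times> 'g) fmat set" where
  "invariant = {M. (\<forall>i<p. \<forall>j<p. \<forall>g\<in>carrier G. \<forall>h\<in>carrier G. \<forall>x\<in>carrier G.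
                      entry M (i, x \<otimes> g) (j, x \<otimes> h) = entry M (i, g) (j, h))
                 \<and> (\<forall>a b. entry M a b \<noteq> 0 \<longrightarrow> (a \<in> idx \<longleftrightarrow> b \<in> idx))}"

lemma invariantI:
  assumes "\<And>i j g h x. i < p \<Longrightarrow> j < p \<Longrightarrow> g \<in> carrier G \<Longrightarrow> h \<in> carrier G \<Longrightarrow> x \<in> carrier G
             \<Longrightarrow> entry M (i, x \<otimes> g) (j, x \<otimes> h) = entry M (i, g) (j, h)"
    and "\<And>a b. entry M a b \<noteq> 0 \<Longrightarrow> a \<in> idx \<longleftrightarrow> b \<in> idx"
  shows "M \<in> invariant"
  unfolding invariant_def using assms by blast

lemma invariantD:
  assumes "M \<in> invariant" "i < p" "j < p" "g \<in> carrier G" "h \<in> carrier G" "x \<in> carrier G"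
  shows "entry M (i, x \<otimes> g) (j, x \<otimes> h) = entry M (i, g) (j, h)"
  using assms by (simp add: invariant_def)

lemma invariant_idx: "M \<in> invariant \<Longrightarrow> entry M a b \<noteq> 0 \<Longrightarrow> a \<in> idx \<longleftrightarrow> b \<in> idx"
  unfolding invariant_def by blast

definition ctr :: "(nat \<times> 'g) fmat \<Rightarrow> complex" where
  "ctr M = (\<Sum>i<p. entry M (i, \<one>) (i, \<one>))"

definition tr :: "(nat \<times> 'g) fmat \<Rightarrow> real" where "tr M = Re (ctr M)"

lemma invariant_mult:
  assumes M: "M \<in> invariant" and N: "N \<in> invariant"
  shows "M * N \<in> invariant"
proof (rule invariantI)
  fix i j g h x
  assume ij: "i < p" "j < p" and gh: "g \<in> carrier G" "h \<in> carrier G" and x: "x \<in> carrier G"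
  let ?B = "{b. entry M (i, g) b \<noteq> 0}"
  \<comment> \<open>Left translation by x carries the support of the row at g onto that of the row
    at x \<otimes> g; the product is reindexed along it.\<close>
  let ?f = "\<lambda>b. (fst b, x \<otimes> snd b)"
  have B: "?B \<subseteq> idx" using invariant_idx[OF M, of "(i, g)"] ij gh by auto
  have inj: "inj_on ?f ?B"
  proof (rule inj_onI)
    fix b c assume "b \<in> ?B" "c \<in> ?B" and eq: "?f b = ?f c"
    then have "b \<in> idx" "c \<in> idx" using B by blast+
    then show "b = c" using eq x by (cases b, cases c) simp
  qed
  have "entry (M * N) (i, x \<otimes> g) (j, x \<otimes> h) = (\<Sum>b\<in>?f ` ?B. entry M (i, x \<otimes> g) b * entry N b (j, x \<otimes> h))"
  proof (rule entry_mult)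
    fix b assume nz: "entry M (i, x \<otimes> g) b \<noteq> 0"
    obtain k l where b: "b = (k, l)" by (cases b)
    have kl: "k < p" "l \<in> carrier G" using invariant_idx[OF M nz] ij gh x b by auto
    have l: "l = x \<otimes> (inv x \<otimes> l)" using kl x by (simp add: m_assoc[symmetric])
    have "entry M (i, g) (k, inv x \<otimes> l) = entry M (i, x \<otimes> g) (k, x \<otimes> (inv x \<otimes> l))"
      by (rule invariantD[OF M, symmetric]) (use ij gh kl x in auto)
    then have "(k, inv x \<otimes> l) \<in> ?B" using nz b l by simp
    then show "b \<in> ?f ` ?B" using b l by force
  qed simp
  also have "\<dots> = (\<Sum>b\<in>?B. entry M (i, g) b * entry N b (j, h))"
  proof (subst sum.reindex[OF inj], intro sum.cong refl)
    fix b assume "b \<in> ?B"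
    then obtain k l where b: "b = (k, l)" "k < p" "l \<in> carrier G" using B by (cases b) auto
    show "((\<lambda>b. entry M (i, x \<otimes> g) b * entry N b (j, x \<otimes> h)) \<circ> ?f) b = entry M (i, g) b * entry N b (j, h)"
      using b invariantD[OF M ij(1) b(2) gh(1) b(3) x] invariantD[OF N b(2) ij(2) b(3) gh(2) x] by simp
  qed
  also have "\<dots> = entry (M * N) (i, g) (j, h)" by (rule entry_mult_row[symmetric])
  finally show "entry (M * N) (i, x \<otimes> g) (j, x \<otimes> h) = entry (M * N) (i, g) (j, h)" .
next
  fix a c assume "entry (M * N) a c \<noteq> 0"
  then obtain b where "entry M a b \<noteq> 0" "entry N b c \<noteq> 0"
    unfolding entry_mult_row by (metis (no_types, lifting) mult_eq_0_iff sum.neutral)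
  then show "a \<in> idx \<longleftrightarrow> c \<in> idx" using invariant_idx[OF M] invariant_idx[OF N] by blast
qed

text \<open>Unimodularity: translating the pair of indices by \<open>h\<^sup>-\<^sup>1\<close> turns a sum over columns into a sum
  over rows.\<close>

lemma ctr_commute:
  assumes M: "M \<in> invariant" and N: "N \<in> invariant"
  shows "ctr (M * N) = ctr (N * M)"
proof -
  \<comment> \<open>Group components of the columns met by the rows of \<open>M\<close> at \<one>.
    By invariance their inverses contain the components of the rows met by its columns at \<one>, so
    both traces become sums over one finite set up to inversion.\<close>
  define H where "H = snd ` (\<Union>i<p. {b. entry M (i, \<one>) b \<noteq> 0}) \<inter> carrier G"
  define H' where "H' = (\<lambda>h. inv h) ` H"
  have fin: "finite H" "finite H'" by (simp_all add: H_def H'_def)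
  have H: "H \<subseteq> carrier G" "H' \<subseteq> carrier G" by (auto simp: H_def H'_def)
  have move: "entry R (i, \<one>) (j, h) = entry R (i, inv h) (j, \<one>)" if "R \<in> invariant" "i < p" "j < p" "h \<in> carrier G" for R i j h
    using invariantD[OF that(1-3), of \<one> h "inv h"] that by simp
  have mn: "entry (M * N) (i, \<one>) (i, \<one>) = (\<Sum>(j, h)\<in>{..<p} \<times> H. entry M (i, \<one>) (j, h) * entry N (j, h) (i, \<one>))"
    if i: "i < p" for i
  proof (subst entry_mult[where B="{..<p} \<times> H"])
    fix b assume nz: "entry M (i, \<one>) b \<noteq> 0"
    then have "b \<in> idx" using invariant_idx[OF M nz] i by simp
    then show "b \<in> {..<p} \<times> H" using nz i by (cases b) (force simp: H_def)
  qed (simp_all add: fin case_prod_beta)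
  have nm: "entry (N * M) (j, \<one>) (j, \<one>) = (\<Sum>(i, k)\<in>{..<p} \<times> H'. entry N (j, \<one>) (i, k) * entry M (i, k) (j, \<one>))"
    if j: "j < p" for j
  proof (subst entry_mult[where B="{..<p} \<times> H'"])
    fix b assume nz: "entry M b (j, \<one>) \<noteq> 0"
    obtain i k where b: "b = (i, k)" by (cases b)
    have ik: "i < p" "k \<in> carrier G" using invariant_idx[OF M nz] j b by auto
    have "entry M (i, \<one>) (j, inv k) \<noteq> 0" using move[OF M ik(1) j, of "inv k"] ik nz b by simp
    then have "inv k \<in> H" using ik by (force simp: H_def)
    then have "inv (inv k) \<in> H'" unfolding H'_def by (rule imageI)
    then show "b \<in> {..<p} \<times> H'" using ik b by simp
  qed (simp_all add: fin case_prod_beta)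
  have "ctr (M * N) = (\<Sum>i<p. \<Sum>j<p. \<Sum>h\<in>H. entry M (i, \<one>) (j, h) * entry N (j, h) (i, \<one>))"
    by (simp add: ctr_def mn sum.cartesian_product)
  also have "\<dots> = (\<Sum>i<p. \<Sum>j<p. \<Sum>k\<in>H'. entry N (j, \<one>) (i, k) * entry M (i, k) (j, \<one>))"
  proof (rule sum.cong[OF refl], rule sum.cong[OF refl])
    fix i j assume "i \<in> {..<p}" "j \<in> {..<p}"
    then have ij: "i < p" "j < p" by auto
    have inj: "inj_on (\<lambda>h. inv h) H" using H by (auto simp: inj_on_def)
    have "(\<Sum>k\<in>H'. entry N (j, \<one>) (i, k) * entry M (i, k) (j, \<one>))
        = (\<Sum>h\<in>H. entry N (j, \<one>) (i, inv h) * entry M (i, inv h) (j, \<one>))"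
      unfolding H'_def by (subst sum.reindex[OF inj]) simp
    also have "\<dots> = (\<Sum>h\<in>H. entry M (i, \<one>) (j, h) * entry N (j, h) (i, \<one>))"
    proof (intro sum.cong refl)
      fix h assume "h \<in> H"
      then have h: "h \<in> carrier G" using H by auto
      then show "entry N (j, \<one>) (i, inv h) * entry M (i, inv h) (j, \<one>) = entry M (i, \<one>) (j, h) * entry N (j, h) (i, \<one>)"
        using move[OF M ij h] move[OF N ij(2,1), of "inv h"] by simp
    qed
    finally show "(\<Sum>h\<in>H. entry M (i, \<one>) (j, h) * entry N (j, h) (i, \<one>)) = (\<Sum>k\<in>H'. entry N (j, \<one>) (i, k) * entry M (i, k) (j, \<one>))" ..
  qed
  also have "\<dots> = ctr (N * M)" by (subst sum.swap) (simp add: ctr_def nm sum.cartesian_product)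
  finally show ?thesis .
qed

lemma entry_mult_fstar_diag: "entry (M * fstar M) a a = of_real (\<Sum>b\<in>{b. entry M a b \<noteq> 0}. (cmod (entry M a b))\<^sup>2)"
  unfolding entry_mult_row of_real_sum complex_norm_square by simp

lemma tr_mult_fstar: "tr (M * fstar M) = (\<Sum>i<p. \<Sum>b\<in>{b. entry M (i, \<one>) b \<noteq> 0}. (cmod (entry M (i, \<one>) b))\<^sup>2)"
  by (simp add: tr_def ctr_def entry_mult_fstar_diag)

sublocale tracial_star_algebra invariant fstar tr
proof
  show "1 \<in> invariant" by (rule invariantI) (auto split: if_splits)
  show "M + N \<in> invariant" if "M \<in> invariant" "N \<in> invariant" for M N
  proof (rule invariantI)
    fix a b assume "entry (M + N) a b \<noteq> 0"
    then have "entry M a b \<noteq> 0 \<or> entry N a b \<noteq> 0" by auto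
    then show "a \<in> idx \<longleftrightarrow> b \<in> idx" using that invariant_idx by blast
  qed (use that in \<open>simp add: invariantD\<close>)
  show "M * N \<in> invariant" if "M \<in> invariant" "N \<in> invariant" for M N
    using that by (rule invariant_mult)
  show "c *\<^sub>R M \<in> invariant" if "M \<in> invariant" for M c
  proof (rule invariantI)
    fix a b assume "entry (c *\<^sub>R M) a b \<noteq> 0"
    then have "entry M a b \<noteq> 0" by auto
    then show "a \<in> idx \<longleftrightarrow> b \<in> idx" using that invariant_idx by blast
  qed (use that in \<open>simp add: invariantD\<close>)
  show "fstar M \<in> invariant" if "M \<in> invariant" for M
  proof (rule invariantI)
    fix a b assume "entry (fstar M) a b \<noteq> 0"
    then have "entry M b a \<noteq> 0" by auto
    then show "a \<in> idx \<longleftrightarrow> b \<in> idx" using that invariant_idx by blast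
  qed (use that in \<open>simp add: invariantD\<close>)
  show "fstar (M + N) = fstar M + fstar N" "fstar (c *\<^sub>R M) = c *\<^sub>R fstar M" "fstar (fstar M) = M" for M N c
    by (auto intro: fmat_eqI)
  show "fstar (M * N) = fstar N * fstar M" for M N by (rule fstar_mult)
  show "tr (M + N) = tr M + tr N" "tr (c *\<^sub>R M) = c * tr M" for M N c
    by (simp_all add: tr_def ctr_def sum.distrib sum_distrib_left)
  show "tr (M * N) = tr (N * M)" if "M \<in> invariant" "N \<in> invariant" for M N
    using ctr_commute[OF that] by (simp add: tr_def)
  show "tr (fstar M) = tr M" for M by (simp add: tr_def ctr_def)
  show "tr (M * fstar M) \<ge> 0" for M unfolding tr_mult_fstar by (intro sum_nonneg) auto
qed

lemma ctr_self_adjoint: "fstar M = M \<Longrightarrow> ctr M = of_real (tr M)"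
proof -
  assume "fstar M = M"
  then have "cnj (entry M a a) = entry M a a" for a by (metis entry_fstar)
  then have "entry M a a = of_real (Re (entry M a a))" for a
    by (metis Reals_cnj_iff of_real_Re)
  then have "ctr M = (\<Sum>i<p. of_real (Re (entry M (i, \<one>) (i, \<one>))))"
    unfolding ctr_def by (intro sum.cong refl)
  then show ?thesis by (simp add: tr_def ctr_def)
qed

text \<open>Row sums of squares are constant along the orbits, hence dominated by the trace.\<close>

lemma row_square_sum_le:
  assumes M: "M \<in> invariant" and b: "b \<in> idx" and F: "finite F"
  shows "(\<Sum>a\<in>F. (cmod (entry M b a))\<^sup>2) \<le> tr (M * fstar M)"
proof -
  obtain j g where jg: "b = (j, g)" "j < p" "g \<in> carrier G" using b by (cases b) auto
  have MM: "M * fstar M \<in> invariant" using M by simp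
  have d: "entry (M * fstar M) b b = entry (M * fstar M) (j, \<one>) (j, \<one>)"
    using invariantD[OF MM, of j j \<one> \<one> g] jg by simp
  have "(\<Sum>a\<in>F. (cmod (entry M b a))\<^sup>2) = (\<Sum>a\<in>F \<inter> {a. entry M b a \<noteq> 0}. (cmod (entry M b a))\<^sup>2)"
    using F by (intro sum.mono_neutral_right) auto
  also have "\<dots> \<le> (\<Sum>a\<in>{a. entry M b a \<noteq> 0}. (cmod (entry M b a))\<^sup>2)"
    by (intro sum_mono2) auto
  also have "\<dots> = Re (entry (M * fstar M) b b)" by (simp add: entry_mult_fstar_diag)
  also have "\<dots> = Re (entry (M * fstar M) (j, \<one>) (j, \<one>))" by (simp only: d)
  also have "\<dots> \<le> (\<Sum>i<p. Re (entry (M * fstar M) (i, \<one>) (i, \<one>)))"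
    using jg by (intro member_le_sum) (auto simp: entry_mult_fstar_diag intro!: sum_nonneg)
  also have "\<dots> = tr (M * fstar M)" by (simp add: tr_def ctr_def)
  finally show ?thesis .
qed

text \<open>Schur test: with each modulus split as a product of two square roots, Cauchy-Schwarz
  lets the column bound control one factor; after summation over the columns the row bound controls
  the other. \<open>hnorm\<close> sees only the rows at \<one>, and these are finitely
  supported.\<close>

lemma bd_Schur:
  assumes M: "M \<in> invariant" and c: "0 \<le> c"
    and row: "\<And>a F. a \<in> idx \<Longrightarrow> finite F \<Longrightarrow> (\<Sum>b\<in>F. cmod (entry M a b)) \<le> c"
    and col: "\<And>b F. b \<in> idx \<Longrightarrow> finite F \<Longrightarrow> (\<Sum>a\<in>F. cmod (entry M a b)) \<le> c"
  shows "bd c M"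
  unfolding bd_def
proof (intro conjI ballI)
  fix N assume N: "N \<in> invariant"
  have "hnorm (N * M) ^ 2 \<le> (c * hnorm N) ^ 2"
  proof -
    have "(\<Sum>b\<in>{b. entry (N * M) (i, \<one>) b \<noteq> 0}. (cmod (entry (N * M) (i, \<one>) b))\<^sup>2)
        \<le> c\<^sup>2 * (\<Sum>a\<in>{a. entry N (i, \<one>) a \<noteq> 0}. (cmod (entry N (i, \<one>) a))\<^sup>2)" if i: "i < p" for i
    proof -
      define A where "A = {a. entry N (i, \<one>) a \<noteq> 0}"
      define B where "B = {b. entry (N * M) (i, \<one>) b \<noteq> 0}"
      define y where "y a = cmod (entry N (i, \<one>) a)" for a
      have fin: "finite A" "finite B" by (simp_all add: A_def B_def)
      have A: "A \<subseteq> idx" using invariant_idx[OF N, of "(i, \<one>)"] i by (auto simp: A_def)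
      have B: "B \<subseteq> idx" using invariant_idx[OF invariant_mult[OF N M], of "(i, \<one>)"] i by (auto simp: B_def)
      have "(cmod (entry (N * M) (i, \<one>) b))\<^sup>2 \<le> (\<Sum>a\<in>A. (y a)\<^sup>2 * cmod (entry M a b)) * c" if b: "b \<in> B" for b
      proof -
        have "cmod (entry (N * M) (i, \<one>) b) \<le> (\<Sum>a\<in>A. y a * cmod (entry M a b))"
          unfolding entry_mult_row A_def y_def by (rule order_trans[OF norm_sum]) (simp add: norm_mult)
        also have "\<dots> = (\<Sum>a\<in>A. (y a * sqrt (cmod (entry M a b))) * sqrt (cmod (entry M a b)))"
          by (simp add: mult.assoc)
        finally have "(cmod (entry (N * M) (i, \<one>) b))\<^sup>2
            \<le> (\<Sum>a\<in>A. (y a * sqrt (cmod (entry M a b))) * sqrt (cmod (entry M a b)))\<^sup>2"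
          by (intro power_mono) auto
        also have "\<dots> \<le> (\<Sum>a\<in>A. (y a * sqrt (cmod (entry M a b)))\<^sup>2) * (\<Sum>a\<in>A. (sqrt (cmod (entry M a b)))\<^sup>2)"
          by (rule Cauchy_Schwarz_ineq_sum)
        also have "\<dots> = (\<Sum>a\<in>A. (y a)\<^sup>2 * cmod (entry M a b)) * (\<Sum>a\<in>A. cmod (entry M a b))"
          by (simp add: power_mult_distrib)
        also have "\<dots> \<le> (\<Sum>a\<in>A. (y a)\<^sup>2 * cmod (entry M a b)) * c"
          using B b fin by (intro mult_left_mono col sum_nonneg) auto
        finally show ?thesis .
      qed
      then have "(\<Sum>b\<in>B. (cmod (entry (N * M) (i, \<one>) b))\<^sup>2) \<le> (\<Sum>b\<in>B. (\<Sum>a\<in>A. (y a)\<^sup>2 * cmod (entry M a b)) * c)"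
        by (rule sum_mono)
      also have "\<dots> = (\<Sum>a\<in>A. (y a)\<^sup>2 * (\<Sum>b\<in>B. cmod (entry M a b))) * c"
        unfolding sum_distrib_right[symmetric] by (subst sum.swap) (simp add: sum_distrib_left)
      also have "\<dots> \<le> (\<Sum>a\<in>A. (y a)\<^sup>2 * c) * c"
        using A fin c by (intro mult_right_mono sum_mono mult_left_mono row) auto
      also have "\<dots> = c\<^sup>2 * (\<Sum>a\<in>A. (y a)\<^sup>2)"
        by (simp add: sum_distrib_right[symmetric] power2_eq_square)
      finally show ?thesis by (simp add: A_def B_def y_def)
    qed
    then have "tr ((N * M) * fstar (N * M)) \<le> c\<^sup>2 * tr (N * fstar N)"
      unfolding tr_mult_fstar sum_distrib_left[of "c\<^sup>2"] by (intro sum_mono) (simp add: sum_distrib_left)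
    then show ?thesis using N M by (simp add: hnorm_square power_mult_distrib)
  qed
  then show "hnorm (N * M) \<le> c * hnorm N"
    by (rule power2_le_imp_le) (use c N in simp)
qed (use M c in auto)


text \<open>The matrix of right multiplication on row vectors over the group; it depends on g and h
  through inv g \<otimes> h only, which is left invariance. Because vectors stand on the left, the
  order of products is preserved.\<close>

definition embed :: "(nat \<Rightarrow> nat \<Rightarrow> 'g \<Rightarrow> complex) \<Rightarrow> (nat \<times> 'g) fmat" where
  "embed A = Fmat (\<lambda>a b. if a \<in> idx \<and> b \<in> idx then A (fst a) (fst b) (inv (snd a) \<otimes> snd b) else 0)"

lemma entry_embed:
  assumes A: "is_cgmat G p A"
  shows "entry (embed A) a b = (if a \<in> idx \<and> b \<in> idx then A (fst a) (fst b) (inv (snd a) \<otimes> snd b) else 0)"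
  unfolding embed_def
proof (subst Fmat_inverse, safe)
  fix i g
  have fin: "finite {x. A i j x \<noteq> 0}" if "i < p" "j < p" for i j
    using A that by (simp add: is_cgmat_def in_CG_def)
  show "finite {b. (if (i, g) \<in> idx \<and> b \<in> idx then A (fst (i, g)) (fst b) (inv (snd (i, g)) \<otimes> snd b) else 0) \<noteq> 0}" (is "finite ?R")
  proof (cases "(i, g) \<in> idx")
    case True
    have "?R \<subseteq> (\<Union>j<p. (\<lambda>x. (j, g \<otimes> x)) ` {x. A i j x \<noteq> 0})"
    proof
      fix b assume "b \<in> ?R"
      then obtain j h where b: "b = (j, h)" "j < p" "h \<in> carrier G" "A i j (inv g \<otimes> h) \<noteq> 0"
        by (cases b) (auto split: if_splits)
      then have "b = (j, g \<otimes> (inv g \<otimes> h))" using True by (simp add: m_assoc[symmetric])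
      then show "b \<in> (\<Union>j<p. (\<lambda>x. (j, g \<otimes> x)) ` {x. A i j x \<noteq> 0})" using b by blast
    qed
    then show ?thesis by (rule finite_subset) (use True fin in auto)
  next
    case False
    then have "?R = {}" by (auto simp del: mem_idx)
    then show ?thesis by (simp only: finite.emptyI)
  qed
  show "finite {a. (if a \<in> idx \<and> (i, g) \<in> idx then A (fst a) (fst (i, g)) (inv (snd a) \<otimes> snd (i, g)) else 0) \<noteq> 0}" (is "finite ?C")
  proof (cases "(i, g) \<in> idx")
    case True
    have "?C \<subseteq> (\<Union>j<p. (\<lambda>x. (j, g \<otimes> inv x)) ` {x. A j i x \<noteq> 0})"
    proof
      fix a assume "a \<in> ?C"
      then obtain j h where a: "a = (j, h)" "j < p" "h \<in> carrier G" "A j i (inv h \<otimes> g) \<noteq> 0"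
        by (cases a) (auto split: if_splits)
      then have "a = (j, g \<otimes> inv (inv h \<otimes> g))" using True by (simp add: inv_mult_group m_assoc[symmetric])
      then show "a \<in> (\<Union>j<p. (\<lambda>x. (j, g \<otimes> inv x)) ` {x. A j i x \<noteq> 0})" using a by blast
    qed
    then show ?thesis by (rule finite_subset) (use True fin in auto)
  next
    case False
    then have "?C = {}" by (auto simp del: mem_idx)
    then show ?thesis by (simp only: finite.emptyI)
  qed
qed

lemma entry_embed_idx:
  assumes "is_cgmat G p A" "i < p" "j < p" "g \<in> carrier G" "h \<in> carrier G"
  shows "entry (embed A) (i, g) (j, h) = A i j (inv g \<otimes> h)"
  using assms by (simp add: entry_embed)

lemma embed_invariant:
  assumes "is_cgmat G p A"
  shows "embed A \<in> invariant"
proof (rule invariantI)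
  fix i j g h x
  assume "i < p" "j < p" and g: "g \<in> carrier G" "h \<in> carrier G" "x \<in> carrier G"
  moreover have "inv (x \<otimes> g) \<otimes> (x \<otimes> h) = inv g \<otimes> h"
    using g by (simp add: inv_mult_group m_assoc) (simp add: m_assoc[symmetric])
  ultimately show "entry (embed A) (i, x \<otimes> g) (j, x \<otimes> h) = entry (embed A) (i, g) (j, h)"
    using assms by (simp add: entry_embed_idx)
qed (simp add: entry_embed[OF assms] split: if_splits)

lemma is_cgmat_star:
  assumes "is_cgmat G p A"
  shows "is_cgmat G p (cgmat_star G A)"
  unfolding is_cgmat_def in_CG_def
proof (intro allI impI conjI)
  fix i j assume ij: "i < p" "j < p"
  have fin: "finite {x. A j i x \<noteq> 0}" using assms ij by (simp add: is_cgmat_def in_CG_def)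
  have "{g. cgmat_star G A i j g \<noteq> 0} \<subseteq> (\<lambda>x. inv x) ` {x. A j i x \<noteq> 0}"
  proof
    fix g assume "g \<in> {g. cgmat_star G A i j g \<noteq> 0}"
    then have "g \<in> carrier G" "A j i (inv g) \<noteq> 0" by (auto simp: cgmat_star_def cg_star_def split: if_splits)
    then show "g \<in> (\<lambda>x. inv x) ` {x. A j i x \<noteq> 0}" by (intro image_eqI[of _ _ "inv g"]) auto
  qed
  then show "finite {g. cgmat_star G A i j g \<noteq> 0}" by (rule finite_subset) (use fin in simp)
  show "{g. cgmat_star G A i j g \<noteq> 0} \<subseteq> carrier G"
    by (auto simp: cgmat_star_def cg_star_def split: if_splits)
qed

lemma embed_star:
  assumes "is_cgmat G p A"
  shows "embed (cgmat_star G A) = fstar (embed A)"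
proof (rule fmat_eqI)
  fix a b :: "nat \<times> 'g"
  have "inv (inv (snd a) \<otimes> snd b) = inv (snd b) \<otimes> snd a" if "a \<in> idx" "b \<in> idx"
    using that by (cases a, cases b) (simp add: inv_mult_group)
  then show "entry (embed (cgmat_star G A)) a b = entry (fstar (embed A)) a b"
    unfolding entry_fstar entry_embed[OF assms] entry_embed[OF is_cgmat_star[OF assms]]
    by (cases a, cases b) (auto simp: cgmat_star_def cg_star_def)
qed

lemma is_cgmat_mult:
  assumes A: "is_cgmat G p A" and B: "is_cgmat G p B"
  shows "is_cgmat G p (cgmat_mult G p A B)"
  unfolding is_cgmat_def in_CG_def
proof (intro allI impI conjI)
  fix i j assume ij: "i < p" "j < p"
  let ?F = "\<Union>k<p. (\<lambda>(x, y). x \<otimes> y) ` ({x. A i k x \<noteq> 0} \<times> {y. B k j y \<noteq> 0})"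
  have supp: "finite {x. A i k x \<noteq> 0}" "finite {y. B k j y \<noteq> 0}" "{x. A i k x \<noteq> 0} \<subseteq> carrier G" if "k < p" for k
    using A B ij that by (simp_all add: is_cgmat_def in_CG_def)
  have nz: "g \<in> carrier G \<and> g \<in> ?F" if g: "cgmat_mult G p A B i j g \<noteq> 0" for g
  proof -
    have "\<exists>k<p. cg_mult G (A i k) (B k j) g \<noteq> 0"
      using g unfolding cgmat_mult_def by (rule contrapos_np) (auto intro!: sum.neutral)
    then obtain k where k: "k < p" "cg_mult G (A i k) (B k j) g \<noteq> 0" by blast
    then have gc: "g \<in> carrier G" by (auto simp: cg_mult_def split: if_splits)
    have "(\<Sum>x\<in>{x. A i k x \<noteq> 0}. A i k x * B k j (inv x \<otimes> g)) \<noteq> 0"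
      using k(2) gc by (simp add: cg_mult_def)
    then have "\<exists>x. A i k x \<noteq> 0 \<and> B k j (inv x \<otimes> g) \<noteq> 0"
      by (rule contrapos_np) (auto intro!: sum.neutral)
    then obtain x where x: "A i k x \<noteq> 0" "B k j (inv x \<otimes> g) \<noteq> 0" by blast
    then have "x \<in> carrier G" using supp(3)[OF k(1)] by auto
    then have eq: "x \<otimes> (inv x \<otimes> g) = g" using gc by (simp add: m_assoc[symmetric])
    have "(\<lambda>(x, y). x \<otimes> y) (x, inv x \<otimes> g) \<in> ?F" using x k(1) by blast
    then show ?thesis using gc by (simp only: eq prod.case)
  qed
  have "finite ?F" using supp by auto
  then show "finite {g. cgmat_mult G p A B i j g \<noteq> 0}" by (rule rev_finite_subset) (use nz in blast)
  show "{g. cgmat_mult G p A B i j g \<noteq> 0} \<subseteq> carrier G" using nz by blast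
qed

lemma embed_mult:
  assumes A: "is_cgmat G p A" and B: "is_cgmat G p B"
  shows "embed (cgmat_mult G p A B) = embed A * embed B"
proof (rule fmat_eqI)
  fix a c :: "nat \<times> 'g"
  obtain i g where a: "a = (i, g)" by (cases a)
  obtain k l where c: "c = (k, l)" by (cases c)
  note AB = is_cgmat_mult[OF A B]
  show "entry (embed (cgmat_mult G p A B)) a c = entry (embed A * embed B) a c"
  proof (cases "a \<in> idx \<and> c \<in> idx")
    case False
    then have "entry (embed A * embed B) a c = 0"
      unfolding entry_mult_row by (intro sum.neutral) (auto simp: entry_embed[OF A] entry_embed[OF B])
    then show ?thesis using False by (auto simp: entry_embed[OF AB])
  next
    case True
    then have ik: "i < p" "k < p" and gl: "g \<in> carrier G" "l \<in> carrier G" using a c by auto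
    let ?S = "\<lambda>j. {x. A i j x \<noteq> 0}"
    have supp: "finite (?S j)" "?S j \<subseteq> carrier G" if "j < p" for j
      using A ik that by (simp_all add: is_cgmat_def in_CG_def)
    let ?D = "Sigma {..<p} ?S" and ?f = "\<lambda>(j, x). (j, g \<otimes> x)"
    have finD: "finite ?D" using supp by auto
    have inj: "inj_on ?f ?D" using supp(2) gl by (auto simp: inj_on_def subset_iff)
    have "entry (embed A * embed B) a c = (\<Sum>b\<in>?f ` ?D. entry (embed A) a b * entry (embed B) b c)"
    proof (rule entry_mult)
      fix b assume nz: "entry (embed A) a b \<noteq> 0"
      obtain j h where b: "b = (j, h)" by (cases b)
      have jh: "j < p" "h \<in> carrier G" "A i j (inv g \<otimes> h) \<noteq> 0"
        using nz a b by (auto simp: entry_embed[OF A] split: if_splits)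
      show "b \<in> ?f ` ?D"
      proof (rule image_eqI)
        show "b = ?f (j, inv g \<otimes> h)" using b gl jh by (simp add: m_assoc[symmetric])
        show "(j, inv g \<otimes> h) \<in> ?D" using jh by simp
      qed
    qed (use finD in simp)
    also have "\<dots> = (\<Sum>(j, x)\<in>?D. A i j x * B j k (inv x \<otimes> (inv g \<otimes> l)))"
    proof (subst sum.reindex[OF inj], intro sum.cong refl)
      fix z assume "z \<in> ?D"
      then obtain j x where z: "z = (j, x)" "j < p" "x \<in> carrier G" using supp(2) by auto
      have "inv g \<otimes> (g \<otimes> x) = x" using z gl by (simp add: m_assoc[symmetric])
      moreover have "inv (g \<otimes> x) \<otimes> l = inv x \<otimes> (inv g \<otimes> l)" using z gl by (simp add: inv_mult_group m_assoc)
      ultimately show "((\<lambda>b. entry (embed A) a b * entry (embed B) b c) \<circ> ?f) z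
          = (case z of (j, x) \<Rightarrow> A i j x * B j k (inv x \<otimes> (inv g \<otimes> l)))"
        using z a c ik gl by (simp add: entry_embed_idx[OF A] entry_embed_idx[OF B])
    qed
    also have "\<dots> = (\<Sum>j<p. \<Sum>x\<in>?S j. A i j x * B j k (inv x \<otimes> (inv g \<otimes> l)))"
      by (rule sum.Sigma[symmetric]) (use supp in auto)
    also have "\<dots> = cgmat_mult G p A B i k (inv g \<otimes> l)"
      using gl by (simp add: cgmat_mult_def cg_mult_def)
    also have "\<dots> = entry (embed (cgmat_mult G p A B)) a c"
      using ik gl a c by (simp only: entry_embed_idx[OF AB])
    finally show ?thesis ..
  qed
qed

lemma is_cgmat_one: "is_cgmat G p (cgmat_one G)"
  by (auto simp: is_cgmat_def in_CG_def cgmat_one_def cg_unit_def)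

lemma is_cgmat_pow: "is_cgmat G p A \<Longrightarrow> is_cgmat G p (cgmat_pow G p A k)"
  by (induction k) (simp_all add: cgmat_pow_def is_cgmat_one is_cgmat_mult)

lemma embed_pow:
  assumes "is_cgmat G p A"
  shows "embed (cgmat_pow G p A k) = embed (cgmat_one G) * embed A ^ k"
proof (induction k)
  case (Suc k)
  have "embed (cgmat_pow G p A (Suc k)) = embed (cgmat_pow G p A k) * embed A"
    using embed_mult[OF is_cgmat_pow[OF assms] assms] by (simp add: cgmat_pow_def)
  then show ?case by (simp add: Suc mult.assoc power_Suc2 del: power_Suc)
qed (simp add: cgmat_pow_def)

text \<open>\<open>embed (cgmat_one G)\<close> is only the projection onto the index set; the trace does not see the difference.\<close>

lemma ctr_embed_one_mult: "ctr (embed (cgmat_one G) * M) = ctr M"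
  unfolding ctr_def
proof (intro sum.cong refl)
  fix i assume "i \<in> {..<p}"
  then have i: "i < p" by simp
  have e: "entry (embed (cgmat_one G)) (i, \<one>) b = (if b = (i, \<one>) then 1 else 0)" for b
    unfolding entry_embed[OF is_cgmat_one] using i by (cases b) (auto simp: cgmat_one_def cg_unit_def)
  show "entry (embed (cgmat_one G) * M) (i, \<one>) (i, \<one>) = entry M (i, \<one>) (i, \<one>)"
    by (subst entry_mult[where B="{(i, \<one>)}"]) (auto simp: e split: if_splits)
qed

lemma cgmat_trace_eq:
  assumes "is_cgmat G p A"
  shows "cgmat_trace G p A = ctr (embed A)"
  by (simp add: cgmat_trace_def ctr_def entry_embed_idx[OF assms])

text \<open>The complex moments prescribed for \<open>FK_spectral_measure\<close> are traces of
  self-adjoint elements and therefore real, so the abstract real-valued trace captures them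
  completely.\<close>

lemma cgmat_trace_moment:
  assumes "is_cgmat G p A"
  shows "cgmat_trace G p (cgmat_pow G p (cgmat_mult G p A (cgmat_star G A)) k)
     = of_real (tr ((embed A * fstar (embed A)) ^ k))"
proof -
  note AA = is_cgmat_mult[OF assms is_cgmat_star[OF assms]]
  have "cgmat_trace G p (cgmat_pow G p (cgmat_mult G p A (cgmat_star G A)) k)
      = ctr ((embed A * fstar (embed A)) ^ k)"
    by (simp add: cgmat_trace_eq[OF is_cgmat_pow[OF AA]] embed_pow[OF AA] ctr_embed_one_mult
        embed_mult[OF assms is_cgmat_star[OF assms]] embed_star[OF assms])
  also have "\<dots> = of_real (tr ((embed A * fstar (embed A)) ^ k))"
    by (rule ctr_self_adjoint) simp
  finally show ?thesis .
qed

text \<open>By the Schur test, the sum of the moduli of all coefficients bounds the operator. The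
  sets \<open>T i j\<close> may exceed the supports, so that all twists of one matrix and their
  differences can be summed over the same index sets.\<close>

lemma bd_embed:
  assumes A: "is_cgmat G p A"
    and T: "\<And>i j. i < p \<Longrightarrow> j < p \<Longrightarrow> finite (T i j)" "\<And>i j g. i < p \<Longrightarrow> j < p \<Longrightarrow> A i j g \<noteq> 0 \<Longrightarrow> g \<in> T i j"
  shows "bd (\<Sum>i<p. \<Sum>j<p. \<Sum>g\<in>T i j. cmod (A i j g)) (embed A)" (is "bd ?c _")
proof (rule bd_Schur)
  show "embed A \<in> invariant" using A by (rule embed_invariant)
  show c0: "0 \<le> ?c" by (intro sum_nonneg) auto
  fix a :: "nat \<times> 'g" and F :: "(nat \<times> 'g) set"
  assume a: "a \<in> idx" and F: "finite F"
  obtain i g where ig: "a = (i, g)" "i < p" "g \<in> carrier G" using a by (cases a) auto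
  \<comment> \<open>Covers rows and columns at once: \<open>q\<close> is the injection that takes
    the free group index to the argument of the coefficient.\<close>
  have le: "(\<Sum>b\<in>F. cmod (w b)) \<le> (\<Sum>j<p. \<Sum>x\<in>U j. cmod (W j x))"
    if w: "\<And>j h. w (j, h) = (if j < p \<and> h \<in> carrier G then W j (q h) else 0)" and q: "inj_on q (carrier G)"
      and U: "\<And>j. j < p \<Longrightarrow> finite (U j)" "\<And>j x. j < p \<Longrightarrow> W j x \<noteq> 0 \<Longrightarrow> x \<in> U j"
    for w :: "nat \<times> 'g \<Rightarrow> complex" and W q U
  proof -
    let ?f = "\<lambda>(j, h). (j, q h)"
    define F' where "F' = F \<inter> {b. w b \<noteq> 0}"
    have F': "j < p" "h \<in> carrier G" "W j (q h) \<noteq> 0" if "(j, h) \<in> F'" for j h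
      using that by (auto simp: F'_def w split: if_splits)
    have inj: "inj_on ?f F'" using F'(2) q by (auto simp: inj_on_def)
    have "(\<Sum>b\<in>F. cmod (w b)) = (\<Sum>b\<in>F'. cmod (w b))"
      using F by (intro sum.mono_neutral_right) (auto simp: F'_def)
    also have "\<dots> = (\<Sum>b\<in>F'. (\<lambda>(j, x). cmod (W j x)) (?f b))"
      using F' by (intro sum.cong refl) (auto simp: w)
    also have "\<dots> = (\<Sum>(j, x)\<in>?f ` F'. cmod (W j x))" by (subst sum.reindex[OF inj]) (simp add: o_def)
    also have "\<dots> \<le> (\<Sum>(j, x)\<in>Sigma {..<p} U. cmod (W j x))"
      using U F' by (intro sum_mono2) auto
    also have "\<dots> = (\<Sum>j<p. \<Sum>x\<in>U j. cmod (W j x))"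
      by (rule sum.Sigma[symmetric]) (use U in auto)
    finally show ?thesis .
  qed
  have "(\<Sum>b\<in>F. cmod (entry (embed A) a b)) \<le> (\<Sum>j<p. \<Sum>x\<in>T i j. cmod (A i j x))"
  proof (rule le[of _ _ "\<lambda>h. inv g \<otimes> h"])
    show "inj_on (\<lambda>h. inv g \<otimes> h) (carrier G)" using ig by (auto simp: inj_on_def)
  qed (use ig T in \<open>auto simp: entry_embed[OF A]\<close>)
  also have "\<dots> \<le> ?c"
    using ig by (intro member_le_sum[of i _ "\<lambda>i. \<Sum>j<p. \<Sum>x\<in>T i j. cmod (A i j x)"]) (auto intro!: sum_nonneg)
  finally show "(\<Sum>b\<in>F. cmod (entry (embed A) a b)) \<le> ?c" .
  have "(\<Sum>b\<in>F. cmod (entry (embed A) b a)) \<le> (\<Sum>j<p. \<Sum>x\<in>T j i. cmod (A j i x))"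
  proof (rule le[of _ _ "\<lambda>h. inv h \<otimes> g"])
    show "inj_on (\<lambda>h. inv h \<otimes> g) (carrier G)"
    proof (rule inj_onI)
      fix h k assume hk: "h \<in> carrier G" "k \<in> carrier G" "inv h \<otimes> g = inv k \<otimes> g"
      then have "inv (inv h) = inv (inv k)" using ig by simp
      then show "h = k" using hk by simp
    qed
  qed (use ig T in \<open>auto simp: entry_embed[OF A]\<close>)
  also have "\<dots> \<le> ?c"
  proof (rule sum_mono)
    fix j assume "j \<in> {..<p}"
    show "(\<Sum>x\<in>T j i. cmod (A j i x)) \<le> (\<Sum>k<p. \<Sum>x\<in>T j k. cmod (A j k x))"
      using ig by (intro member_le_sum[of i _ "\<lambda>k. \<Sum>x\<in>T j k. cmod (A j k x)"]) (auto intro!: sum_nonneg)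
  qed
  finally show "(\<Sum>b\<in>F. cmod (entry (embed A) b a)) \<le> ?c" .
qed

lemma ex_bd_embed:
  assumes "is_cgmat G p A"
  obtains b where "bd b (embed A)"
  using bd_embed[OF assms, of "\<lambda>i j. {g. A i j g \<noteq> 0}"] assms
  by (auto simp: is_cgmat_def in_CG_def)

text \<open>Existence and uniqueness make the definite description denote. Its integrability clause
  corresponds to nothing in \<open>is_spectral\<close> because powers are bounded on a compact
  support.\<close>

lemma is_spectral_FK_spectral_measure:
  assumes A: "is_cgmat G p A"
  shows "is_spectral (FK_spectral_measure G p A) (embed A)"
proof -
  obtain b where b: "bd b (embed A)" using ex_bd_embed[OF A] .
  have "b ^ 2 \<le> b ^ 2 + 1" "0 < b ^ 2 + 1" by (simp_all add: add_nonneg_pos)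
  then obtain \<mu> where \<mu>: "is_spectral \<mu> (embed A)" using ex_is_spectral[OF b] by blast
  have eq: "(sets \<nu> = sets borel \<and> finite_measure \<nu> \<and> (\<exists>C. emeasure \<nu> (- {0..C}) = 0) \<and>
      (\<forall>k::nat. integrable \<nu> (\<lambda>t. t ^ k) \<and> complex_of_real (\<integral>t. t ^ k \<partial>\<nu>) =
           cgmat_trace G p (cgmat_pow G p (cgmat_mult G p A (cgmat_star G A)) k))) \<longleftrightarrow> is_spectral \<nu> (embed A)"
    (is "?L \<nu> = _") for \<nu>
  proof
    assume L: "?L \<nu>"
    then obtain C where "emeasure \<nu> (- {0..C}) = 0" by blast
    then have "AE t in \<nu>. t \<in> {0..C}" using L by (intro AE_Icc_if_emeasure_Compl_eq_0) auto
    then show "is_spectral \<nu> (embed A)" using L unfolding is_spectral_def cgmat_trace_moment[OF A] of_real_eq_iff by blast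
  next
    assume R: "is_spectral \<nu> (embed A)"
    then obtain C where s: "sets \<nu> = sets borel" "finite_measure \<nu>" and C: "AE t in \<nu>. t \<in> {0..C}"
      by (auto simp: is_spectral_def)
    have "{t \<in> space \<nu>. \<not> t \<in> {0..C}} = - {0..C}" using sets_eq_imp_space_eq[OF s(1)] by auto
    then have "emeasure \<nu> (- {0..C}) = 0"
      using C s(1) by (subst (asm) AE_iff_measurable[where N="- {0..C}"]) auto
    moreover have "integrable \<nu> (\<lambda>t. t ^ k)" for k
      by (rule integrable_continuous_bounded_support[OF s(2,1) C]) (intro continuous_intros)
    ultimately show "?L \<nu>" using R s unfolding is_spectral_def cgmat_trace_moment[OF A] of_real_eq_iff by blast
  qed
  show ?thesis
    unfolding FK_spectral_measure_def eq
    by (rule theI[where P="\<lambda>\<nu>. is_spectral \<nu> (embed A)", OF \<mu>]) (rule is_spectral_unique[OF _ \<mu>])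
qed


text \<open>Conjugation by the diagonal matrix with entries exp (t \<phi>(g)). That matrix is in
  general neither bounded nor invariant, but conjugation by it is multiplicative and fixes the
  diagonal entries; passing to adjoints changes the sign of t.\<close>

definition twist :: "('g \<Rightarrow> real) \<Rightarrow> real \<Rightarrow> (nat \<times> 'g) fmat \<Rightarrow> (nat \<times> 'g) fmat" where
  "twist \<phi> t M = Fmat (\<lambda>a b. exp (t * (\<phi> (snd b) - \<phi> (snd a))) *\<^sub>R entry M a b)"

lemma entry_twist [simp]: "entry (twist \<phi> t M) a b = exp (t * (\<phi> (snd b) - \<phi> (snd a))) *\<^sub>R entry M a b"
  unfolding twist_def by (subst Fmat_inverse) auto

lemma twist_mult: "twist \<phi> t (M * N) = twist \<phi> t M * twist \<phi> t N"
proof (rule fmat_eqI)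
  fix a c :: "nat \<times> 'g"
  have "entry (twist \<phi> t M * twist \<phi> t N) a c
      = (\<Sum>b\<in>{b. entry M a b \<noteq> 0}. entry (twist \<phi> t M) a b * entry (twist \<phi> t N) b c)"
    by (rule entry_mult) auto
  also have "\<dots> = (\<Sum>b\<in>{b. entry M a b \<noteq> 0}. exp (t * (\<phi> (snd c) - \<phi> (snd a))) *\<^sub>R (entry M a b * entry N b c))"
  proof (intro sum.cong refl)
    fix b :: "nat \<times> 'g"
    have "exp (t * (\<phi> (snd b) - \<phi> (snd a))) * exp (t * (\<phi> (snd c) - \<phi> (snd b))) = exp (t * (\<phi> (snd c) - \<phi> (snd a)))"
      by (simp add: exp_add[symmetric] algebra_simps)
    then show "entry (twist \<phi> t M) a b * entry (twist \<phi> t N) b c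
        = exp (t * (\<phi> (snd c) - \<phi> (snd a))) *\<^sub>R (entry M a b * entry N b c)"
      by (simp add: mult.commute)
  qed
  finally show "entry (twist \<phi> t (M * N)) a c = entry (twist \<phi> t M * twist \<phi> t N) a c"
    by (simp add: entry_mult_row scaleR_sum_right)
qed

lemma twist_one: "twist \<phi> t 1 = 1" by (rule fmat_eqI) auto
lemma twist_diff: "twist \<phi> t (M - N) = twist \<phi> t M - twist \<phi> t N" by (rule fmat_eqI) (simp add: scaleR_diff_right)
lemma twist_scaleR: "twist \<phi> t (c *\<^sub>R M) = c *\<^sub>R twist \<phi> t M" by (rule fmat_eqI) simp
lemma twist_of_real: "twist \<phi> t (of_real c) = of_real c" by (simp add: of_real_def twist_scaleR twist_one)
lemma twist_power: "twist \<phi> t (M ^ n) = twist \<phi> t M ^ n" by (induction n) (simp_all add: twist_one twist_mult)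
lemma twist_twist: "twist \<phi> s (twist \<phi> t M) = twist \<phi> (s + t) M"
  by (rule fmat_eqI) (simp add: exp_add distrib_right)
lemma fstar_twist: "fstar (twist \<phi> t M) = twist \<phi> (- t) (fstar M)"
  by (rule fmat_eqI) (simp add: algebra_simps)
lemma tr_twist: "tr (twist \<phi> t M) = tr M" by (simp add: tr_def ctr_def)

text \<open>Twisting by -h lowers the parameter of the first factor from x + 2h to x + h and, as the
  adjoint reverses the sign, raises that of the starred factor from x to x + h.\<close>

lemma tr_twist_power:
  "tr ((of_real \<alpha> - \<beta> *\<^sub>R (twist \<phi> (x + 2 * h) M * fstar (twist \<phi> x M))) ^ n)
     = tr ((of_real \<alpha> - \<beta> *\<^sub>R (twist \<phi> (x + h) M * fstar (twist \<phi> (x + h) M))) ^ n)"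
proof -
  have "twist \<phi> (x + h) M * fstar (twist \<phi> (x + h) M) = twist \<phi> (- h) (twist \<phi> (x + 2 * h) M * fstar (twist \<phi> x M))"
    by (simp add: twist_mult twist_twist fstar_twist algebra_simps)
  then have "(of_real \<alpha> - \<beta> *\<^sub>R (twist \<phi> (x + h) M * fstar (twist \<phi> (x + h) M))) ^ n
     = twist \<phi> (- h) ((of_real \<alpha> - \<beta> *\<^sub>R (twist \<phi> (x + 2 * h) M * fstar (twist \<phi> x M))) ^ n)"
    by (simp only: twist_power twist_diff twist_scaleR twist_of_real)
  then show ?thesis by (simp only: tr_twist)
qed

section \<open>Twisted coefficients and convexity along a line\<close>

definition exp_twist :: "('g \<Rightarrow> real) \<Rightarrow> (nat \<Rightarrow> nat \<Rightarrow> 'g \<Rightarrow> complex) \<Rightarrow> nat \<Rightarrow> nat \<Rightarrow> 'g \<Rightarrow> complex" where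
  "exp_twist \<psi> A = (\<lambda>i j g. complex_of_real (exp (\<psi> g)) * A i j g)"

lemma is_cgmat_exp_twist: "is_cgmat G p A \<Longrightarrow> is_cgmat G p (exp_twist \<psi> A)"
  by (simp add: is_cgmat_def in_CG_def exp_twist_def)

lemma real_character_diff:
  assumes \<phi>: "real_character G \<phi>" and g: "g \<in> carrier G" and h: "h \<in> carrier G"
  shows "\<phi> (inv g \<otimes> h) = \<phi> h - \<phi> g"
proof -
  have "\<phi> \<one> = \<phi> \<one> + \<phi> \<one>" using \<phi> unfolding real_character_def by (metis one_closed r_one)
  moreover have "\<phi> \<one> = \<phi> (inv g) + \<phi> g" using \<phi> g unfolding real_character_def by (metis inv_closed l_inv)
  ultimately show ?thesis using \<phi> g h unfolding real_character_def by simp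
qed

text \<open>Additivity splits the exponent at inv g \<otimes> h into \<phi> h - \<phi> g, so
  weighting the coefficients amounts to conjugation by a diagonal matrix.\<close>

lemma embed_exp_twist:
  assumes "is_cgmat G p A" "real_character G \<phi>"
  shows "embed (exp_twist (\<lambda>g. t * \<phi> g) A) = twist \<phi> t (embed A)"
proof (rule fmat_eqI)
  fix a b :: "nat \<times> 'g"
  show "entry (embed (exp_twist (\<lambda>g. t * \<phi> g) A)) a b = entry (twist \<phi> t (embed A)) a b"
    unfolding entry_twist entry_embed[OF assms(1)] entry_embed[OF is_cgmat_exp_twist[OF assms(1)]]
    by (cases a, cases b) (simp add: exp_twist_def real_character_diff[OF assms(2)] scaleR_conv_of_real)
qed

lemma convex_on_integral_ln_exp_twist:
  assumes A: "is_cgmat G p A" and \<phi>: "real_character G \<phi>" and e: "0 < \<epsilon>"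
  shows "convex_on UNIV (\<lambda>t. \<integral>y. ln (y + \<epsilon>) \<partial>FK_spectral_measure G p (exp_twist (\<lambda>g. t * \<phi> g) A))"
proof (rule convex_on_integral_ln_spectral[OF _ _ _ _ e])
  let ?A = "\<lambda>t. exp_twist (\<lambda>g. t * \<phi> g) A"
  let ?T = "\<lambda>i j. {g. A i j g \<noteq> 0}"
  have At: "is_cgmat G p (?A t)" for t using A by (rule is_cgmat_exp_twist)
  have T: "finite (?T i j)" if "i < p" "j < p" for i j using A that by (simp add: is_cgmat_def in_CG_def)
  show "is_spectral (FK_spectral_measure G p (?A t)) (embed (?A t))" for t
    by (rule is_spectral_FK_spectral_measure[OF At])
  show "tr ((of_real \<alpha> - \<beta> *\<^sub>R (embed (?A (x + 2 * h)) * fstar (embed (?A x)))) ^ n)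
      = tr ((of_real \<alpha> - \<beta> *\<^sub>R (embed (?A (x + h)) * fstar (embed (?A (x + h))))) ^ n)" for \<alpha> \<beta> x h n
    unfolding embed_exp_twist[OF A \<phi>] by (rule tr_twist_power)
  fix l u :: real
  \<comment> \<open>A bound for the modulus of t on the interval: exp (m |\<phi> g|) then bounds all
    weights and, multiplied by |\<phi> g|, their Lipschitz constants in t.\<close>
  define m where "m = max \<bar>l\<bar> \<bar>u\<bar>"
  have m: "\<bar>t * \<phi> g\<bar> \<le> m * \<bar>\<phi> g\<bar>" if "t \<in> {l..u}" for t g
    unfolding abs_mult using that by (intro mult_right_mono) (auto simp: m_def)
  show "\<exists>b. \<forall>t\<in>{l..u}. bd b (embed (?A t))"
  proof (intro exI ballI)
    fix t assume t: "t \<in> {l..u}"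
    show "bd (\<Sum>i<p. \<Sum>j<p. \<Sum>g\<in>?T i j. exp (m * \<bar>\<phi> g\<bar>) * cmod (A i j g)) (embed (?A t))"
    proof (rule bd_mono)
      show "bd (\<Sum>i<p. \<Sum>j<p. \<Sum>g\<in>?T i j. cmod (?A t i j g)) (embed (?A t))"
        by (rule bd_embed[OF At]) (auto simp: T exp_twist_def)
      show "(\<Sum>i<p. \<Sum>j<p. \<Sum>g\<in>?T i j. cmod (?A t i j g)) \<le> (\<Sum>i<p. \<Sum>j<p. \<Sum>g\<in>?T i j. exp (m * \<bar>\<phi> g\<bar>) * cmod (A i j g))"
      proof (rule sum_mono, rule sum_mono, rule sum_mono)
        fix i j g
        have "t * \<phi> g \<le> m * \<bar>\<phi> g\<bar>" using m[OF t, of g] by linarith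
        then show "cmod (?A t i j g) \<le> exp (m * \<bar>\<phi> g\<bar>) * cmod (A i j g)"
          by (simp add: exp_twist_def norm_mult mult_right_mono)
      qed
    qed
  qed
  show "\<exists>L. \<forall>s\<in>{l..u}. \<forall>t\<in>{l..u}. bd (L * \<bar>s - t\<bar>) (embed (?A s) - embed (?A t))"
  proof (intro exI ballI)
    fix s t assume s: "s \<in> {l..u}" and t: "t \<in> {l..u}"
    define D where "D = (\<lambda>i j g. complex_of_real (exp (s * \<phi> g) - exp (t * \<phi> g)) * A i j g)"
    have D: "is_cgmat G p D"
      unfolding is_cgmat_def in_CG_def
    proof (intro allI impI conjI)
      fix i j assume ij: "i < p" "j < p"
      have sub: "{g. D i j g \<noteq> 0} \<subseteq> ?T i j" by (auto simp: D_def)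
      then show "finite {g. D i j g \<noteq> 0}" using T[OF ij] by (rule finite_subset)
      show "{g. D i j g \<noteq> 0} \<subseteq> carrier G" using sub A ij by (auto simp: is_cgmat_def in_CG_def)
    qed
    have emb: "embed (?A s) - embed (?A t) = embed D"
      by (rule fmat_eqI) (simp add: entry_embed[OF At] entry_embed[OF D], simp add: D_def exp_twist_def algebra_simps)
    show "bd ((\<Sum>i<p. \<Sum>j<p. \<Sum>g\<in>?T i j. exp (m * \<bar>\<phi> g\<bar>) * \<bar>\<phi> g\<bar> * cmod (A i j g)) * \<bar>s - t\<bar>) (embed (?A s) - embed (?A t))"
      unfolding emb
    proof (rule bd_mono)
      show "bd (\<Sum>i<p. \<Sum>j<p. \<Sum>g\<in>?T i j. cmod (D i j g)) (embed D)"
        by (rule bd_embed[OF D]) (auto simp: T D_def)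
      have "(\<Sum>i<p. \<Sum>j<p. \<Sum>g\<in>?T i j. cmod (D i j g)) \<le> (\<Sum>i<p. \<Sum>j<p. \<Sum>g\<in>?T i j. exp (m * \<bar>\<phi> g\<bar>) * \<bar>\<phi> g\<bar> * cmod (A i j g) * \<bar>s - t\<bar>)"
      proof (rule sum_mono, rule sum_mono, rule sum_mono)
        fix i j g
        have "\<bar>exp (s * \<phi> g) - exp (t * \<phi> g)\<bar> \<le> exp (m * \<bar>\<phi> g\<bar>) * \<bar>s * \<phi> g - t * \<phi> g\<bar>"
          by (rule abs_exp_diff_le) (use m s t in auto)
        also have "\<bar>s * \<phi> g - t * \<phi> g\<bar> = \<bar>\<phi> g\<bar> * \<bar>s - t\<bar>"
          by (simp add: abs_mult[symmetric] algebra_simps)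
        finally have "\<bar>exp (s * \<phi> g) - exp (t * \<phi> g)\<bar> * cmod (A i j g) \<le> (exp (m * \<bar>\<phi> g\<bar>) * (\<bar>\<phi> g\<bar> * \<bar>s - t\<bar>)) * cmod (A i j g)"
          by (rule mult_right_mono) simp
        then show "cmod (D i j g) \<le> exp (m * \<bar>\<phi> g\<bar>) * \<bar>\<phi> g\<bar> * cmod (A i j g) * \<bar>s - t\<bar>"
          unfolding D_def norm_mult norm_of_real by (simp only: mult_ac)
      qed
      then show "(\<Sum>i<p. \<Sum>j<p. \<Sum>g\<in>?T i j. cmod (D i j g)) \<le> (\<Sum>i<p. \<Sum>j<p. \<Sum>g\<in>?T i j. exp (m * \<bar>\<phi> g\<bar>) * \<bar>\<phi> g\<bar> * cmod (A i j g)) * \<bar>s - t\<bar>"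
        by (simp only: sum_distrib_right)
    qed
  qed
qed


section \<open>Injectivity of right multiplication and the atom at 0\<close>

lemma l2_rmult_sum_eq_vec_mult:
  fixes y :: "nat \<Rightarrow> 'g \<Rightarrow> complex"
  assumes A: "is_cgmat G p A" and j: "j < p" and g: "g \<in> carrier G"
  defines "\<xi> \<equiv> \<lambda>a. if a \<in> idx then y (fst a) (snd a) else 0"
  shows "(\<Sum>i<p. l2_rmult G (y i) (A i j) g) = vec_mult \<xi> (embed A) (j, g)"
proof -
  let ?S = "\<lambda>i. {h. A i j h \<noteq> 0}"
  have supp: "finite (?S i)" "?S i \<subseteq> carrier G" if "i < p" for i
    using A j that by (simp_all add: is_cgmat_def in_CG_def)
  let ?D = "Sigma {..<p} ?S" and ?f = "\<lambda>(i, h). (i, g \<otimes> inv h)"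
  have finD: "finite ?D" using supp by auto
  have cancel_g: "inv (g \<otimes> inv h) \<otimes> g = h" if "h \<in> carrier G" for h
    using that g by (simp add: inv_mult_group m_assoc)
  have inj: "inj_on ?f ?D"
  proof (rule inj_onI)
    fix u v assume uv: "u \<in> ?D" "v \<in> ?D" and eq: "?f u = ?f v"
    obtain i h k l where u: "u = (i, h)" and v: "v = (k, l)" by (cases u, cases v) auto
    have hl: "h \<in> carrier G" "l \<in> carrier G" using uv u v supp(2) by auto
    have "i = k" "g \<otimes> inv h = g \<otimes> inv l" using eq u v by auto
    then have "inv (g \<otimes> inv h) \<otimes> g = inv (g \<otimes> inv l) \<otimes> g" by simp
    then have "h = l" unfolding cancel_g[OF hl(1)] cancel_g[OF hl(2)] .
    then show "u = v" using u v \<open>i = k\<close> by simp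
  qed
  have "vec_mult \<xi> (embed A) (j, g) = (\<Sum>a\<in>?f ` ?D. \<xi> a * entry (embed A) a (j, g))"
  proof (rule vec_mult_eq)
    fix a assume nz: "entry (embed A) a (j, g) \<noteq> 0"
    obtain i k where a: "a = (i, k)" by (cases a)
    have ik: "i < p" "k \<in> carrier G" "A i j (inv k \<otimes> g) \<noteq> 0"
      using nz a by (auto simp: entry_embed[OF A] split: if_splits)
    show "a \<in> ?f ` ?D"
    proof (rule image_eqI)
      show "a = ?f (i, inv k \<otimes> g)" using a ik g by (simp add: inv_mult_group m_assoc[symmetric])
      show "(i, inv k \<otimes> g) \<in> ?D" using ik by simp
    qed
  qed (use finD in simp)
  also have "\<dots> = (\<Sum>(i, h)\<in>?D. y i (g \<otimes> inv h) * A i j h)"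
  proof (subst sum.reindex[OF inj], intro sum.cong refl)
    fix u assume "u \<in> ?D"
    then obtain i h where u: "u = (i, h)" "i < p" "h \<in> carrier G" using supp(2) by auto
    show "((\<lambda>a. \<xi> a * entry (embed A) a (j, g)) \<circ> ?f) u = (case u of (i, h) \<Rightarrow> y i (g \<otimes> inv h) * A i j h)"
      using u g j by (simp add: \<xi>_def entry_embed_idx[OF A] cancel_g)
  qed
  also have "\<dots> = (\<Sum>i<p. \<Sum>h\<in>?S i. y i (g \<otimes> inv h) * A i j h)"
    by (rule sum.Sigma[symmetric]) (use supp in auto)
  also have "\<dots> = (\<Sum>i<p. l2_rmult G (y i) (A i j) g)" using g by (simp add: l2_rmult_def)
  finally show ?thesis ..
qed

text \<open>The polynomials \<open>(1 - t / C)\<^sup>n\<close> decrease to the indicator of \<open>{0}\<close> on the support of the spectral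
  measure, so \<open>kernel_approx A C n\<close> plays the role of the projection onto the kernel.\<close>

definition kernel_approx :: "(nat \<Rightarrow> nat \<Rightarrow> 'g \<Rightarrow> complex) \<Rightarrow> real \<Rightarrow> nat \<Rightarrow> (nat \<times> 'g) fmat" where
  "kernel_approx A C n = (of_real 1 + (- 1 / C) *\<^sub>R (embed A * fstar (embed A))) ^ n"

lemma
  assumes "is_cgmat G p A"
  shows kernel_approx_invariant: "kernel_approx A C n \<in> invariant"
    and fstar_kernel_approx: "fstar (kernel_approx A C n) = kernel_approx A C n"
    and kernel_approx_mult: "kernel_approx A C n * kernel_approx A C m = kernel_approx A C (n + m)"
proof -
  have "embed A \<in> invariant" using assms by (rule embed_invariant)
  then show "kernel_approx A C n \<in> invariant" by (simp add: kernel_approx_def)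
qed (simp_all add: kernel_approx_def power_add)

lemma tr_kernel_approx:
  assumes "is_cgmat G p A"
  shows "tr (kernel_approx A C n) = (\<integral>t. (1 - t / C) ^ n \<partial>FK_spectral_measure G p A)"
    and "tr (kernel_approx A C n * (embed A * fstar (embed A))) = (\<integral>t. (1 - t / C) ^ n * t \<partial>FK_spectral_measure G p A)"
  using is_spectral_polynomial[OF is_spectral_FK_spectral_measure[OF assms], of 1 "- 1 / C" n 0]
    is_spectral_polynomial[OF is_spectral_FK_spectral_measure[OF assms], of 1 "- 1 / C" n 1]
  by (simp_all add: kernel_approx_def)

lemma ex_spectral_bound:
  assumes A: "is_cgmat G p A"
  obtains C where "0 < C" "AE t in FK_spectral_measure G p A. t \<in> {0..C}"
proof -
  obtain b where b: "bd b (embed A)" using ex_bd_embed[OF A] .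
  have "b ^ 2 \<le> b ^ 2 + 1" "0 < b ^ 2 + 1" by (simp_all add: add_nonneg_pos)
  then show ?thesis using is_spectral_AE[OF is_spectral_FK_spectral_measure[OF A] b] that by blast
qed

lemma FK_spectral_measure_props:
  assumes "is_cgmat G p A"
  shows "finite_measure (FK_spectral_measure G p A)" "sets (FK_spectral_measure G p A) = sets borel"
  using is_spectral_FK_spectral_measure[OF assms] by (simp_all add: is_spectral_def)

text \<open>A kernel vector is fixed by every \<open>kernel_approx A C n\<close>. By Cauchy-Schwarz
  against a column, the square of each coordinate is at most the squared norm \<open>N\<close> times
  the integral of (1 - t / C)^(2n), and that integral tends to the mass at 0.\<close>

lemma rmult_injective_if_no_atom:
  assumes A: "is_cgmat G p A" and zero: "measure (FK_spectral_measure G p A) {0} = 0"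
  shows "rmult_injective G p A"
  unfolding rmult_injective_def
proof (intro allI impI)
  fix y :: "nat \<Rightarrow> 'g \<Rightarrow> complex" and i g
  assume H: "(\<forall>i<p. in_l2 G (y i)) \<and> (\<forall>j<p. \<forall>g. (\<Sum>i<p. l2_rmult G (y i) (A i j) g) = 0)" and i: "i < p"
  define \<xi> where "\<xi> a = (if a \<in> idx then y (fst a) (snd a) else 0)" for a
  obtain C where C: "0 < C" "AE t in FK_spectral_measure G p A. t \<in> {0..C}" using ex_spectral_bound[OF A] .
  have vz: "vec_mult \<xi> (embed A) = (\<lambda>_. 0)"
  proof
    fix b
    show "vec_mult \<xi> (embed A) b = 0"
    proof (cases "b \<in> idx")
      case True
      then obtain j h where b: "b = (j, h)" "j < p" "h \<in> carrier G" by (cases b) auto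
      show ?thesis using l2_rmult_sum_eq_vec_mult[OF A b(2,3), of y] H b by (simp add: \<xi>_def[abs_def])
    next
      case False
      then show ?thesis by (simp add: vec_mult_def entry_embed[OF A])
    qed
  qed
  have fix_\<xi>: "vec_mult \<xi> (kernel_approx A C n) = \<xi>" for n
  proof (induction n)
    case (Suc n)
    let ?Y = "of_real 1 + (- 1 / C) *\<^sub>R (embed A * fstar (embed A))"
    have "vec_mult \<xi> (embed A * fstar (embed A)) = vec_mult (\<lambda>_. 0) (fstar (embed A))"
      by (simp add: vec_mult_assoc vz)
    then have z: "vec_mult \<xi> (embed A * fstar (embed A)) = (\<lambda>_. 0)" by (simp add: vec_mult_def[abs_def])
    have "?Y = 1 - (1 / C) *\<^sub>R (embed A * fstar (embed A))" by simp
    then have "vec_mult \<xi> ?Y b = \<xi> b" for b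
      by (simp only: vec_mult_diff vec_mult_scaleR vec_mult_one z) simp
    then have "vec_mult \<xi> ?Y = \<xi>" by blast
    moreover have "kernel_approx A C (Suc n) = ?Y * kernel_approx A C n" by (simp add: kernel_approx_def)
    ultimately show ?case using Suc by (simp only: vec_mult_assoc)
  qed (simp add: kernel_approx_def)
  define N where "N = (\<Sum>i<p. infsum (\<lambda>g. (cmod (y i g))\<^sup>2) (carrier G))"
  have sumN: "(\<Sum>a\<in>F. (cmod (\<xi> a))\<^sup>2) \<le> N" if F: "finite F" for F
  proof -
    let ?F = "snd ` F \<inter> carrier G"
    have "(\<Sum>a\<in>F. (cmod (\<xi> a))\<^sup>2) = (\<Sum>a\<in>F \<inter> idx. (cmod (\<xi> a))\<^sup>2)"
      by (rule sum.mono_neutral_right) (use F in \<open>auto simp: \<xi>_def\<close>)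
    also have "\<dots> \<le> (\<Sum>a\<in>{..<p} \<times> ?F. (cmod (\<xi> a))\<^sup>2)"
      using F by (intro sum_mono2) (auto simp: idx_def intro!: image_eqI)
    also have "\<dots> = (\<Sum>i<p. \<Sum>g\<in>?F. (cmod (\<xi> (i, g)))\<^sup>2)" by (simp add: sum.cartesian_product)
    also have "\<dots> = (\<Sum>i<p. \<Sum>g\<in>?F. (cmod (y i g))\<^sup>2)" by (intro sum.cong refl) (auto simp: \<xi>_def)
    also have "\<dots> \<le> N"
      unfolding N_def using F H by (intro sum_mono finite_sum_le_infsum) (auto simp: in_l2_def)
    finally show ?thesis .
  qed
  have N0: "0 \<le> N" using sumN[of "{}"] by simp
  show "y i g = 0"
  proof (cases "g \<in> carrier G")
    case False
    then show ?thesis using H i by (simp add: in_l2_def)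
  next
    case True
    have est: "(cmod (\<xi> (i, g)))\<^sup>2 \<le> N * (\<integral>t. (1 - t / C) ^ (n + n) \<partial>FK_spectral_measure G p A)" for n
    proof -
      let ?Q = "kernel_approx A C n"
      let ?F = "{a. entry ?Q a (i, g) \<noteq> 0}"
      have "cmod (\<xi> (i, g)) = cmod (\<Sum>a\<in>?F. \<xi> a * entry ?Q a (i, g))"
        using fun_cong[OF fix_\<xi>[of n], of "(i, g)"] by (simp only: vec_mult_def)
      also have "\<dots> \<le> (\<Sum>a\<in>?F. cmod (\<xi> a) * cmod (entry ?Q a (i, g)))"
        by (rule order_trans[OF norm_sum]) (simp add: norm_mult)
      finally have "(cmod (\<xi> (i, g)))\<^sup>2 \<le> (\<Sum>a\<in>?F. cmod (\<xi> a) * cmod (entry ?Q a (i, g)))\<^sup>2"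
        by (rule power_mono) simp
      also have "\<dots> \<le> (\<Sum>a\<in>?F. (cmod (\<xi> a))\<^sup>2) * (\<Sum>a\<in>?F. (cmod (entry ?Q a (i, g)))\<^sup>2)"
        by (rule Cauchy_Schwarz_ineq_sum)
      also have "\<dots> \<le> N * tr (?Q * fstar ?Q)"
      proof (rule mult_mono)
        show "(\<Sum>a\<in>?F. (cmod (\<xi> a))\<^sup>2) \<le> N" by (rule sumN) simp
        have "cmod (entry ?Q a (i, g)) = cmod (entry ?Q (i, g) a)" for a
          by (metis complex_mod_cnj entry_fstar fstar_kernel_approx[OF A])
        then show "(\<Sum>a\<in>?F. (cmod (entry ?Q a (i, g)))\<^sup>2) \<le> tr (?Q * fstar ?Q)"
          using row_square_sum_le[OF kernel_approx_invariant[OF A], of "(i, g)" ?F C n] i True by simp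
      qed (use N0 in \<open>auto intro!: sum_nonneg\<close>)
      also have "tr (?Q * fstar ?Q) = (\<integral>t. (1 - t / C) ^ (n + n) \<partial>FK_spectral_measure G p A)"
        by (simp only: fstar_kernel_approx[OF A] kernel_approx_mult[OF A] tr_kernel_approx(1)[OF A])
      finally show ?thesis .
    qed
    have "(\<lambda>n. \<integral>t. (1 - t / C) ^ n \<partial>FK_spectral_measure G p A) \<longlonglongrightarrow> 0"
      using integral_power_one_minus_tendsto(1)[OF FK_spectral_measure_props[OF A] C(2,1)] zero by simp
    moreover have "strict_mono (\<lambda>n::nat. n + n)" by (simp add: strict_mono_def)
    ultimately have "(\<lambda>n. \<integral>t. (1 - t / C) ^ (n + n) \<partial>FK_spectral_measure G p A) \<longlonglongrightarrow> 0"
      using LIMSEQ_subseq_LIMSEQ[of _ 0 "\<lambda>n. n + n"] by (force simp: o_def)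
    then have "(\<lambda>n. N * (\<integral>t. (1 - t / C) ^ (n + n) \<partial>FK_spectral_measure G p A)) \<longlonglongrightarrow> N * 0"
      by (intro tendsto_mult tendsto_const)
    then have "(cmod (\<xi> (i, g)))\<^sup>2 \<le> N * 0" by (rule LIMSEQ_le_const) (use est in blast)
    then show ?thesis using i True by (simp add: \<xi>_def)
  qed
qed

text \<open>The rows of the kernel approximations at \<one> converge entrywise; the limit is a row
  of the projection onto the kernel, square-summable and annihilated by A. Injectivity makes it
  vanish, so the traces of the approximations tend to 0, while they also tend to the mass at
  0.\<close>

lemma no_atom_if_rmult_injective:
  assumes A: "is_cgmat G p A" and inj: "rmult_injective G p A"
  shows "measure (FK_spectral_measure G p A) {0} = 0"
proof -
  let ?\<mu> = "FK_spectral_measure G p A"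
  obtain C where C: "0 < C" "AE t in ?\<mu>. t \<in> {0..C}" using ex_spectral_bound[OF A] .
  define Q where "Q n = kernel_approx A C n" for n
  define I where "I n = (\<integral>t. (1 - t / C) ^ n \<partial>?\<mu>)" for n
  note props = FK_spectral_measure_props[OF A]
  have Ilim: "I \<longlonglongrightarrow> measure ?\<mu> {0}"
    using integral_power_one_minus_tendsto(1)[OF props C(2,1)] by (simp add: I_def[abs_def])
  have Q: "Q n \<in> invariant" "fstar (Q n) = Q n" "Q n * Q m = Q (n + m)" "tr (Q n) = I n" for n m
    using kernel_approx_invariant[OF A] fstar_kernel_approx[OF A] kernel_approx_mult[OF A] tr_kernel_approx(1)[OF A]
    by (simp_all add: Q_def I_def)
  have bound: "(\<Sum>a\<in>F. (cmod (entry (Q n) (i, \<one>) a))\<^sup>2) \<le> I (n + n)" if "i < p" "finite F" for i F n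
    using row_square_sum_le[OF Q(1), of "(i, \<one>)" F n] that by (simp add: Q)
  have ptw: "(\<lambda>n. entry (Q n) (i, \<one>) a) \<longlonglongrightarrow> 0" if i: "i < p" for i a
  proof -
    have conv: "convergent (\<lambda>n. entry (Q n) (i, \<one>) a)" for a
    proof -
      have "Cauchy (\<lambda>n. entry (Q n) (i, \<one>) a)"
      proof (rule metric_CauchyI)
        fix e :: real assume e: "0 < e"
        \<comment> \<open>Since \<open>Q n * Q m\<close> = \<open>Q (n + m)\<close>, the distance is
          controlled by traces alone, that is, by values of the convergent sequence
          \<open>I\<close>.\<close>
        have dist2: "(dist (entry (Q n) (i, \<one>) a) (entry (Q m) (i, \<one>) a))\<^sup>2 \<le> I (n + n) - 2 * I (n + m) + I (m + m)" for n m
        proof -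
          have "(cmod (entry (Q n - Q m) (i, \<one>) a))\<^sup>2 \<le> tr ((Q n - Q m) * fstar (Q n - Q m))"
            using row_square_sum_le[of "Q n - Q m" "(i, \<one>)" "{a}"] Q(1) i by simp
          also have "(Q n - Q m) * fstar (Q n - Q m) = Q (n + n) - Q (n + m) - (Q (m + n) - Q (m + m))"
            by (simp add: Q left_diff_distrib right_diff_distrib)
          finally show ?thesis by (simp add: Q dist_norm add.commute[of m n])
        qed
        have "Cauchy I" using Ilim by (rule LIMSEQ_imp_Cauchy)
        moreover have "0 < e\<^sup>2 / 2" using e by simp
        ultimately obtain N where N: "\<And>n m. N \<le> n \<Longrightarrow> N \<le> m \<Longrightarrow> dist (I n) (I m) < e\<^sup>2 / 2"
          unfolding Cauchy_def by meson
        show "\<exists>N. \<forall>m\<ge>N. \<forall>n\<ge>N. dist (entry (Q m) (i, \<one>) a) (entry (Q n) (i, \<one>) a) < e"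
        proof (intro exI allI impI)
          fix m n assume mn: "N \<le> m" "N \<le> n"
          have "\<bar>I (m + m) - I (m + n)\<bar> < e\<^sup>2 / 2" "\<bar>I (n + n) - I (m + n)\<bar> < e\<^sup>2 / 2"
            using N[of "m + m" "m + n"] N[of "n + n" "m + n"] mn by (simp_all add: dist_real_def)
          moreover have "x - 2 * y + z < 2 * c" if "\<bar>x - y\<bar> < c" "\<bar>z - y\<bar> < c" for x y z c :: real
            using that by linarith
          ultimately have "I (m + m) - 2 * I (m + n) + I (n + n) < 2 * (e\<^sup>2 / 2)" by blast
          then have "(dist (entry (Q m) (i, \<one>) a) (entry (Q n) (i, \<one>) a))\<^sup>2 < e\<^sup>2"
            using dist2[of m n] by simp
          then show "dist (entry (Q m) (i, \<one>) a) (entry (Q n) (i, \<one>) a) < e"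
            by (rule power2_less_imp_less) (use e in simp)
        qed
      qed
      then show ?thesis by (rule Cauchy_convergent)
    qed
    define v where "v a = lim (\<lambda>n. entry (Q n) (i, \<one>) a)" for a
    have v: "(\<lambda>n. entry (Q n) (i, \<one>) a) \<longlonglongrightarrow> v a" for a
      unfolding v_def using conv convergent_LIMSEQ_iff by blast
    have v_out: "v a = 0" if "a \<notin> idx" for a
    proof -
      have "entry (Q n) (i, \<one>) a = 0" for n using invariant_idx[OF Q(1), of n "(i, \<one>)" a] that i by auto
      then have "(\<lambda>_. 0) \<longlonglongrightarrow> v a" using v[of a] by simp
      then show ?thesis by (simp add: LIMSEQ_const_iff)
    qed
    have subseq: "strict_mono (\<lambda>n::nat. n + n)" by (simp add: strict_mono_def)
    have I2: "(\<lambda>n. I (n + n)) \<longlonglongrightarrow> measure ?\<mu> {0}"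
      using LIMSEQ_subseq_LIMSEQ[OF Ilim subseq] by (simp add: o_def)
    have v_sum: "(\<Sum>a\<in>F. (cmod (v a))\<^sup>2) \<le> measure ?\<mu> {0}" if F: "finite F" for F
    proof -
      have "(\<lambda>n. \<Sum>a\<in>F. (cmod (entry (Q n) (i, \<one>) a))\<^sup>2) \<longlonglongrightarrow> (\<Sum>a\<in>F. (cmod (v a))\<^sup>2)"
        by (intro tendsto_intros v)
      then show ?thesis using I2 by (rule LIMSEQ_le) (use bound[OF i F] in blast)
    qed
    have l2: "in_l2 G (\<lambda>g. v (k, g))" if k: "k < p" for k
      unfolding in_l2_def
    proof (intro conjI allI impI)
      show "v (k, g) = 0" if "g \<notin> carrier G" for g using v_out that by simp
      show "(\<lambda>g. (cmod (v (k, g)))\<^sup>2) summable_on carrier G"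
      proof (rule nonneg_bdd_above_summable_on)
        show "bdd_above (sum (\<lambda>g. (cmod (v (k, g)))\<^sup>2) ` {F. F \<subseteq> carrier G \<and> finite F})"
        proof (rule bdd_aboveI2)
          fix F assume "F \<in> {F. F \<subseteq> carrier G \<and> finite F}"
          then have "finite ((\<lambda>g. (k, g)) ` F)" by simp
          from v_sum[OF this] show "(\<Sum>g\<in>F. (cmod (v (k, g)))\<^sup>2) \<le> measure ?\<mu> {0}"
            by (subst (asm) sum.reindex) (auto simp: inj_on_def)
        qed
      qed simp
    qed
    \<comment> \<open>The squared entries of \<open>Q n * embed A\<close> are at most the integral
      of (1 - t / C)^(2n) t. The factor t removes the atom, so this tends to 0.\<close>
    have kill: "vec_mult v (embed A) b = 0" if b: "b \<in> idx" for b
    proof -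
      let ?F = "{a. entry (embed A) a b \<noteq> 0}"
      have "(\<lambda>n. \<Sum>a\<in>?F. entry (Q n) (i, \<one>) a * entry (embed A) a b) \<longlonglongrightarrow> (\<Sum>a\<in>?F. v a * entry (embed A) a b)"
        by (intro tendsto_intros v)
      then have lim1: "(\<lambda>n. entry (Q n * embed A) (i, \<one>) b) \<longlonglongrightarrow> vec_mult v (embed A) b"
        by (simp add: entry_mult_col vec_mult_def)
      have "(\<lambda>n. entry (Q n * embed A) (i, \<one>) b) \<longlonglongrightarrow> 0"
      proof -
        have le: "(cmod (entry (Q n * embed A) (i, \<one>) b))\<^sup>2 \<le> (\<integral>t. (1 - t / C) ^ (n + n) * t \<partial>?\<mu>)" for n
        proof -
          have inv: "embed A \<in> invariant" using A by (rule embed_invariant)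
          have "(cmod (entry (Q n * embed A) (i, \<one>) b))\<^sup>2 \<le> tr ((Q n * embed A) * fstar (Q n * embed A))"
            using row_square_sum_le[of "Q n * embed A" "(i, \<one>)" "{b}"] Q(1) inv i by simp
          also have "\<dots> = tr (Q n * (embed A * fstar (embed A) * Q n))" by (simp add: Q mult.assoc)
          also have "\<dots> = tr ((embed A * fstar (embed A) * Q n) * Q n)"
            by (rule tr_commute) (use Q(1) inv in auto)
          also have "\<dots> = tr ((embed A * fstar (embed A)) * Q (n + n))" by (simp add: Q(3) mult.assoc)
          also have "\<dots> = tr (Q (n + n) * (embed A * fstar (embed A)))"
            by (rule tr_commute) (use Q(1) inv in auto)
          also have "\<dots> = (\<integral>t. (1 - t / C) ^ (n + n) * t \<partial>?\<mu>)"
            unfolding Q_def by (rule tr_kernel_approx(2)[OF A])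
          finally show ?thesis .
        qed
        have lim0: "(\<lambda>n. \<integral>t. (1 - t / C) ^ (n + n) * t \<partial>?\<mu>) \<longlonglongrightarrow> 0"
          using LIMSEQ_subseq_LIMSEQ[OF integral_power_one_minus_tendsto(2)[OF props C(2,1)] subseq] by (simp add: o_def)
        have "(\<lambda>n. (cmod (entry (Q n * embed A) (i, \<one>) b))\<^sup>2) \<longlonglongrightarrow> 0"
          by (rule tendsto_sandwich[OF _ _ tendsto_const lim0]) (use le in auto)
        then have "(\<lambda>n. sqrt ((cmod (entry (Q n * embed A) (i, \<one>) b))\<^sup>2)) \<longlonglongrightarrow> sqrt 0" by (rule tendsto_real_sqrt)
        then have "(\<lambda>n. cmod (entry (Q n * embed A) (i, \<one>) b)) \<longlonglongrightarrow> 0" by simp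
        then show ?thesis by (rule tendsto_norm_zero_cancel)
      qed
      then show ?thesis using lim1 LIMSEQ_unique by blast
    qed
    have veq: "(\<lambda>b. if b \<in> idx then v (fst b, snd b) else 0) = v" using v_out by auto
    have "(\<Sum>k<p. l2_rmult G (\<lambda>g. v (k, g)) (A k j) g) = 0" if j: "j < p" for j g
    proof (cases "g \<in> carrier G")
      case True
      then show ?thesis
        using l2_rmult_sum_eq_vec_mult[OF A j True, of "\<lambda>k g. v (k, g)"] kill[of "(j, g)"] j
        unfolding veq by simp
    next
      case False
      then show ?thesis by (simp add: l2_rmult_def)
    qed
    then have "(\<forall>k<p. in_l2 G (\<lambda>g. v (k, g))) \<and> (\<forall>j<p. \<forall>g. (\<Sum>k<p. l2_rmult G (\<lambda>g. v (k, g)) (A k j) g) = 0)"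
      using l2 by simp
    from inj[unfolded rmult_injective_def, THEN spec, of "\<lambda>k g. v (k, g)", THEN mp, OF this]
    have vz: "v (k, g) = 0" if "k < p" for k g using that by blast
    have "v a = 0"
    proof (cases "a \<in> idx")
      case True
      then show ?thesis using vz by (cases a) simp
    qed (rule v_out)
    then show ?thesis using v[of a] by simp
  qed
  have "(\<lambda>n. Re (\<Sum>i<p. entry (Q n) (i, \<one>) (i, \<one>))) \<longlonglongrightarrow> Re (\<Sum>i<p. 0)"
    by (rule tendsto_Re, rule tendsto_sum, rule ptw) simp
  moreover have "Re (\<Sum>i<p. entry (Q n) (i, \<one>) (i, \<one>)) = I n" for n
    using Q(4)[of n] by (simp only: tr_def ctr_def)
  ultimately have "I \<longlonglongrightarrow> 0" by simp
  then show ?thesis using Ilim LIMSEQ_unique by blast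
qed


section \<open>Several variables and the limit of vanishing \<epsilon>\<close>

definition log_weight :: "('n::finite \<Rightarrow> 'g \<Rightarrow> real) \<Rightarrow> real ^ 'n \<Rightarrow> 'g \<Rightarrow> real" where
  "log_weight \<Phi> s g = (\<Sum>i\<in>UNIV. s $ i * \<Phi> i g)"

lemma kappa_mat_exp: "kappa_mat \<Phi> (\<chi> i. exp (s $ i)) A = exp_twist (log_weight \<Phi> s) A"
  by (intro ext) (simp add: kappa_mat_def kappa_def exp_twist_def log_weight_def exp_powr_real exp_sum)

lemma real_character_log_weight:
  assumes "\<forall>i. real_character G (\<Phi> i)"
  shows "real_character G (log_weight \<Phi> v)"
  using assms by (simp add: real_character_def log_weight_def distrib_left sum.distrib)

text \<open>On the line through s with direction v, the matrix twisted by s becomes the new base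
  matrix and only a twist by the single character \<open>log_weight \<Phi> v\<close> varies, so the
  one-variable result applies on every line.\<close>

lemma exp_twist_line:
  "exp_twist (log_weight \<Phi> (s + t *\<^sub>R v)) A = exp_twist (\<lambda>g. t * log_weight \<Phi> v g) (exp_twist (log_weight \<Phi> s) A)"
proof -
  have "log_weight \<Phi> (s + t *\<^sub>R v) g = t * log_weight \<Phi> v g + log_weight \<Phi> s g" for g
    by (simp add: log_weight_def distrib_right sum.distrib sum_distrib_left mult.assoc)
  then show ?thesis by (simp add: exp_twist_def exp_add mult.assoc)
qed

lemma exp_twist_log_weight_zero: "exp_twist (log_weight \<Phi> 0) A = A"
  by (intro ext) (simp add: exp_twist_def log_weight_def)

text \<open>Convexity bounds the regularised integrals from below uniformly in n. By
  \<open>integral_ln_add_tendsto\<close> this yields at once no atom, integrability and convergence;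
  injectivity, which the determinant also requires, is recovered from the missing atom.\<close>

lemma FK_det_r_exp_twist:
  fixes \<Phi> :: "'n::finite \<Rightarrow> 'g \<Rightarrow> real"
  assumes A: "is_cgmat G p A" and \<Phi>: "\<forall>i. real_character G (\<Phi> i)" and nz: "FK_det_r G p A \<noteq> 0"
  defines "L \<equiv> \<lambda>s :: real ^ 'n. LINT t:{0<..}|FK_spectral_measure G p (exp_twist (log_weight \<Phi> s) A). ln t"
  shows "FK_det_r G p (exp_twist (log_weight \<Phi> s) A) = exp (1/2 * L s)"
    and "convex_on UNIV L"
proof -
  let ?M = "\<lambda>s :: real ^ 'n. exp_twist (log_weight \<Phi> s) A"
  let ?\<mu> = "\<lambda>s. FK_spectral_measure G p (?M s)"
  have M: "is_cgmat G p (?M s)" for s using A by (rule is_cgmat_exp_twist)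
  note props = FK_spectral_measure_props[OF M]
  define F where "F n s = (\<integral>t. ln (t + inverse (real (Suc n))) \<partial>?\<mu> s)" for n s
  have convF: "convex_on UNIV (F n)" for n
  proof (rule convex_on_if_convex_on_lines)
    fix s v :: "real ^ 'n"
    show "convex_on UNIV (\<lambda>t. F n (s + t *\<^sub>R v))"
      unfolding F_def exp_twist_line
      by (rule convex_on_integral_ln_exp_twist[OF M real_character_log_weight[OF \<Phi>]]) simp
  qed
  have inj: "rmult_injective G p A" and int: "set_integrable (FK_spectral_measure G p A) {0<..} (\<lambda>t. ln t)"
    using nz by (auto simp: FK_det_r_def Let_def split: if_splits)
  have atom: "measure (FK_spectral_measure G p A) {0} = 0" by (rule no_atom_if_rmult_injective[OF A inj])
  define I where "I = (LINT t:{0<..}|FK_spectral_measure G p A. ln t)"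
  have F0: "I \<le> F n 0" for n
  proof -
    obtain C where "AE t in FK_spectral_measure G p A. t \<in> {0..C}" using ex_spectral_bound[OF A] by blast
    from integral_ln_le_integral_ln_add[OF FK_spectral_measure_props[OF A] this atom int]
    show ?thesis by (simp add: F_def I_def exp_twist_log_weight_zero)
  qed
  have anti: "F n s \<le> F 0 s" for n s
  proof -
    obtain C where C: "AE t in ?\<mu> s. t \<in> {0..C}" using ex_spectral_bound[OF M] by blast
    have int: "integrable (?\<mu> s) (\<lambda>t. ln (t + inverse (real (Suc n))))" for n
      by (rule integral_ln_add_eq_lim(2)[OF props C _ order_refl]) simp
    show ?thesis
      unfolding F_def
    proof (rule integral_mono_AE[OF int int], rule eventually_mono[OF C])
      fix t assume t: "t \<in> {0..C}"
      have "inverse (real (Suc n)) \<le> inverse (real (Suc 0))" by (simp add: divide_simps)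
      moreover have "0 < inverse (real (Suc n))" by simp
      ultimately show "ln (t + inverse (real (Suc n))) \<le> ln (t + inverse (real (Suc 0)))"
        using t by (intro ln_mono) (auto intro: add_nonneg_pos)
    qed
  qed
  \<comment> \<open>0 is the midpoint of s and -s. The value at 0 is at least \<open>I\<close>, by
    the hypothesis on the untwisted matrix, and the value at -s is at most \<open>F 0 (- s)\<close>,
    which does not depend on n.\<close>
  have lower: "2 * I - F 0 (- s) \<le> F n s" for n s
  proof -
    have "F n ((1 - 1/2) *\<^sub>R s + (1/2) *\<^sub>R (- s)) \<le> (1 - 1/2) * F n s + (1/2) * F n (- s)"
      by (rule convex_onD[OF convF]) auto
    moreover have "(1 - 1/2) *\<^sub>R s + (1/2) *\<^sub>R (- s) = 0" by simp
    ultimately have "2 * F n 0 \<le> F n s + F n (- s)" by simp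
    then show ?thesis using F0[of n] anti[of n "- s"] by linarith
  qed
  have lim: "measure (?\<mu> s) {0} = 0" "set_integrable (?\<mu> s) {0<..} ln" "(\<lambda>n. F n s) \<longlonglongrightarrow> L s" for s
  proof -
    obtain C where C: "AE t in ?\<mu> s. t \<in> {0..C}" using ex_spectral_bound[OF M] by blast
    have "2 * I - F 0 (- s) \<le> (\<integral>t. ln (t + inverse (real (Suc n))) \<partial>?\<mu> s)" for n
      using lower[of s n] by (simp only: F_def)
    note * = integral_ln_add_tendsto[OF props C this]
    show "measure (?\<mu> s) {0} = 0" "set_integrable (?\<mu> s) {0<..} ln" "(\<lambda>n. F n s) \<longlonglongrightarrow> L s"
      using * by (simp_all only: F_def L_def)
  qed
  show "FK_det_r G p (?M s) = exp (1/2 * L s)"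
    using rmult_injective_if_no_atom[OF M lim(1)] lim(2) by (simp add: FK_det_r_def L_def)
  show "convex_on UNIV L" by (rule convex_on_LIMSEQ[OF convF lim(3)])
qed

end

theorem theorem5p7:
  fixes G :: "'g monoid" and p :: nat and \<Omega> :: "nat \<Rightarrow> nat \<Rightarrow> 'g \<Rightarrow> complex"
    and \<Phi> :: "'n::finite \<Rightarrow> 'g \<Rightarrow> real"
  assumes "group G" and "finitely_generated_group G" and "residually_finite G"
    and "is_cgmat G p \<Omega>" and "FK_det_r G p \<Omega> \<noteq> 0"
    and "\<forall>i. real_character G (\<Phi> i)"
  shows "(\<forall>T :: real^'n. (\<forall>i. T $ i > 0) \<longrightarrow> FK_det_r G p (kappa_mat \<Phi> T \<Omega>) > 0)
    \<and> convex_on UNIV (\<lambda>s :: real^'n. ln (FK_det_r G p (kappa_mat \<Phi> (\<chi> i. exp (s $ i)) \<Omega>)))"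
proof -
  interpret group_ring_matrices G p using assms(1) by (simp add: group_ring_matrices_def)
  note det = FK_det_r_exp_twist[OF assms(4,6,5)]
  show ?thesis
  proof (intro conjI allI impI)
    fix T :: "real ^ 'n" assume "\<forall>i. T $ i > 0"
    define s where "s = (\<chi> i. ln (T $ i))"
    have T: "T = (\<chi> i. exp (s $ i))" using \<open>\<forall>i. T $ i > 0\<close> by (simp add: vec_eq_iff s_def)
    show "FK_det_r G p (kappa_mat \<Phi> T \<Omega>) > 0" by (subst T) (simp only: kappa_mat_exp det(1) exp_gt_zero)
  next
    show "convex_on UNIV (\<lambda>s :: real^'n. ln (FK_det_r G p (kappa_mat \<Phi> (\<chi> i. exp (s $ i)) \<Omega>)))"
      unfolding kappa_mat_exp det(1) ln_exp by (rule convex_on_cmul[OF _ det(2)]) simp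
  qed
qed

end
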